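(* Let $(M,\langle\cdot,\cdot\rangle)$ be a Riemannian manifold, $\mathcal M=\mathrm{Imm}([0,1],M)$ the space of smooth immersions $[0,1]\to M$ equipped with the Riemannian metric $$G_c(h,k)=\langle h(0),k(0)\rangle+\int_0^1\Big(\langle\nabla_\ell h^N,\nabla_\ell k^N\rangle+\tfrac14\langle\nabla_\ell h^T,\nabla_\ell k^T\rangle\Big)\|c'(t)\|\,\mathrm dt,$$ and let $c_0,c_1\in\mathcal M$. The geodesic distance induced by $G$ between $c_0$ and $c_1$ is given by $$d(c_0,c_1)=\inf_{c(0,\cdot)=c_0,\;c(1,\cdot)=c_1}\int_0^1\sqrt{\|c_s(s,0)\|^2+\int_0^1\|\nabla_sq(s,t)\|^2\,\mathrm dt}\;\mathrm ds,$$ where the infimum is over paths $s\mapsto c(s,\cdot)$ in $\mathcal M$ from $c_0$ to $c_1$ and $q=c_t/\sqrt{\|c_t\|}$. It can also be written $$d(c_0,c_1)=\inf_{c(0,\cdot)=c_0,\;c(1,\cdot)=c_1}\int_0^1\sqrt{\|c_s(s,0)\|^2+\int_0^1\|\tilde q_s(s,t)+\Omega(s,t)\|^2\,\mathrm dt}\;\mathrm ds,$$ where $$\tilde q(s,t)=P_{c(\cdot,0)}^{s,0}\circ P_{c(s,\cdot)}^{t,0}\big(q(s,t)\big)\in T_{c_0(0)}M,$$ and $$\Omega(s,t)=P_{c(\cdot,0)}^{s,0}\circ P_{c(s,\cdot)}^{t,0}\big(\nabla_a\omega^{s,t}(s,t)\big)=P_{c(\cdot,0)}^{s,0}\left(\int_0^tP_{c(s,\cdot)}^{\tau,0}\Big(\mathcal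 R\big(c_t(s,\tau),c_s(s,\tau)\big)P_{c(s,\cdot)}^{t,\tau}q(s,t)\Big)\,\mathrm d\tau\right),$$ with $$\omega^{s,t}(a,\tau)=P_{c(a,\cdot)}^{0,\tau}\circ P_{c(\cdot,0)}^{s,a}\circ P_{c(s,\cdot)}^{t,0}\big(q(s,t)\big).$$
   Context: $(M,\langle\cdot,\cdot\rangle)$ is a (finite-dimensional, smooth) Riemannian manifold with norm $\|\cdot\|$, Levi-Civita connection $\nabla$ and curvature tensor $\mathcal R(X,Y)Z=\nabla_X\nabla_YZ-\nabla_Y\nabla_XZ-\nabla_{[X,Y]}Z$. $\mathcal M=\mathrm{Imm}([0,1],M)=\{c\in C^\infty([0,1],M): c'(t)\ne0\ \forall t\in[0,1]\}$. A tangent vector $h\in T_c\mathcal M$ is a smooth vector field along $c$, i.e. a smooth map $h:[0,1]\to TM$ with $h(t)\in T_{c(t)}M$. For $c\in\mathcal M$ and $h\in T_c\mathcal M$: $v=c'/\|c'\|$, $\nabla_\ell h=\frac1{\|c'\|}\nabla_{c'}h$ is the covariant derivative of $h$ along $c$ with respect to arc length, $\nabla_\ell h^T=\langle\nabla_\ell h,v\rangle v$ and $\nabla_\ell h^N=\nabla_\ell h-\nabla_\ell h^T$. A path in $\mathcal M$ is a smooth map $(s,t)\mapsto c(s,t)$, $(s,t)\in[0,1]^2$, with $c(s,\cdot)\in\mathcal M$ for all $s$. Write $c_s=\partial c/\partial s$, $c_t=\partial c/\partial t$, and $\nabla_s$, $\nabla_t$ for covariant differentiation of vector fields along the map $c$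 in the $s$ and $t$ directions. The geodesic distance induced by $G$ is $d(c_0,c_1)=\inf\int_0^1\sqrt{G_{c(s,\cdot)}(c_s(s,\cdot),c_s(s,\cdot))}\,\mathrm ds$, the infimum being over all such paths with $c(0,\cdot)=c_0$ and $c(1,\cdot)=c_1$. $P_\gamma^{t_1,t_2}:T_{\gamma(t_1)}M\to T_{\gamma(t_2)}M$ denotes parallel transport along a curve $\gamma$ from $\gamma(t_1)$ to $\gamma(t_2)$. $\tilde q_s=\partial\tilde q/\partial s$ is the ordinary derivative in the fixed vector space $T_{c_0(0)}M$. For fixed $(s,t)$, $(a,\tau)\mapsto\omega^{s,t}(a,\tau)\in T_{c(a,\tau)}M$ is a vector field along $(a,\tau)\mapsto c(a,\tau)$, and $\nabla_a\omega^{s,t}(s,t)$ is its covariant derivative in the first variable $a$, evaluated at $(a,\tau)=(s,t)$. *)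

theory Defs
  imports "HOL-Analysis.Analysis"
begin

section \<open>Smooth maps between Euclidean spaces\<close>

text \<open>
  Derivatives are taken within \<open>S\<close>.  The predicate is only used where these are unique:
  for \<open>S\<close> open, or relatively open in \<open>[0,1]\<close> or \<open>[0,1]\<^sup>2\<close>.  In the latter case the derivatives
  at boundary points are the one-sided ones.
\<close>

fun Ck_on :: "nat \<Rightarrow> 'a::real_normed_vector set \<Rightarrow> ('a \<Rightarrow> 'b::real_normed_vector) \<Rightarrow> bool" where
  "Ck_on 0 S f \<longleftrightarrow> continuous_on S f"
| "Ck_on (Suc k) S f \<longleftrightarrow>
     f differentiable_on S \<and> (\<forall>v. Ck_on k S (\<lambda>x. frechet_derivative f (at x within S) v))"

definition smooth_on :: "'a::real_normed_vector set \<Rightarrow> ('a \<Rightarrow> 'b::real_normed_vector) \<Rightarrow> bool" where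
  "smooth_on S f \<longleftrightarrow> (\<forall>k. Ck_on k S f)"


section \<open>Manifolds, tangent vectors, Riemannian metrics\<close>

text \<open>A chart is a pair of a domain and a coordinate map, of which only the values on the
  domain matter.\<close>

type_synonym ('m, 'e) chart = "'m set \<times> ('m \<Rightarrow> 'e)"

abbreviation chart_dom :: "('m, 'e) chart \<Rightarrow> 'm set" where
  "chart_dom \<equiv> fst"

abbreviation chart_map :: "('m, 'e) chart \<Rightarrow> 'm \<Rightarrow> 'e" where
  "chart_map \<equiv> snd"

definition chart_inv :: "('m, 'e) chart \<Rightarrow> 'e \<Rightarrow> 'm" where
  "chart_inv \<kappa> = inv_into (chart_dom \<kappa>) (chart_map \<kappa>)"

definition chart_image :: "('m, 'e) chart \<Rightarrow> 'e set" where
  "chart_image \<kappa> = chart_map \<kappa> ` chart_dom \<kappa>"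

definition smooth_atlas :: "('m::topological_space, 'e::euclidean_space) chart set \<Rightarrow> bool" where
  "smooth_atlas A \<longleftrightarrow>
     (\<forall>\<kappa>\<in>A. open (chart_dom \<kappa>) \<and> open (chart_image \<kappa>) \<and>
        homeomorphism (chart_dom \<kappa>) (chart_image \<kappa>) (chart_map \<kappa>) (chart_inv \<kappa>)) \<and>
     (\<Union>\<kappa>\<in>A. chart_dom \<kappa>) = UNIV \<and>
     (\<forall>\<kappa>\<in>A. \<forall>\<mu>\<in>A. smooth_on (chart_map \<kappa> ` (chart_dom \<kappa> \<inter> chart_dom \<mu>)) (chart_map \<mu> \<circ> chart_inv \<kappa>))"

text \<open>
  The underlying set of the manifold is the type \<open>'m\<close>; the model space \<open>'e\<close> is \<open>\<real>\<^sup>n\<close> with \<open>n \<ge> 1\<close>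
  (a \<open>0\<close>-dimensional manifold has no immersed curves).  At each point \<open>p\<close> one chart
  \<open>chart_at M p\<close> is fixed, and \<open>T\<^sub>pM\<close> is the vector space \<open>'e\<close>: \<open>v :: 'e\<close> stands for the tangent vector
  at \<open>p\<close> with components \<open>v\<close> in the chart \<open>chart_at M p\<close>.  Its components in a chart \<open>\<kappa>\<close> around \<open>p\<close>
  are \<open>to_chart M \<kappa> p v\<close>.  The second field below is the family of bilinear forms
  \<open>\<langle>\<cdot>,\<cdot>\<rangle>\<close> on the spaces \<open>T\<^sub>pM\<close>.
\<close>

record ('m, 'e) riem_structure =
  Atlas :: "('m, 'e) chart set"
  Metric :: "'m \<Rightarrow> 'e \<Rightarrow> 'e \<Rightarrow> real"

definition chart_at :: "('m, 'e) riem_structure \<Rightarrow> 'm \<Rightarrow> ('m, 'e) chart" where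
  "chart_at M p = (SOME \<kappa>. \<kappa> \<in> Atlas M \<and> p \<in> chart_dom \<kappa>)"

definition chart_change ::
    "('m, 'e::euclidean_space) chart \<Rightarrow> ('m, 'e) chart \<Rightarrow> 'm \<Rightarrow> 'e \<Rightarrow> 'e" where
  "chart_change \<kappa> \<mu> p v = frechet_derivative (chart_map \<mu> \<circ> chart_inv \<kappa>) (at (chart_map \<kappa> p)) v"

definition to_chart ::
    "('m, 'e::euclidean_space) riem_structure \<Rightarrow> ('m, 'e) chart \<Rightarrow> 'm \<Rightarrow> 'e \<Rightarrow> 'e" where
  "to_chart M \<kappa> p v = chart_change (chart_at M p) \<kappa> p v"

definition from_chart ::
    "('m, 'e::euclidean_space) riem_structure \<Rightarrow> ('m, 'e) chart \<Rightarrow> 'm \<Rightarrow> 'e \<Rightarrow> 'e" where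
  "from_chart M \<kappa> p v = chart_change \<kappa> (chart_at M p) p v"

text \<open>The metric at the point with coordinates \<open>\<xi>\<close> in \<open>\<kappa>\<close>, as a bilinear form in components.\<close>

definition metric_in_chart ::
    "('m, 'e::euclidean_space) riem_structure \<Rightarrow> ('m, 'e) chart \<Rightarrow> 'e \<Rightarrow> 'e \<Rightarrow> 'e \<Rightarrow> real" where
  "metric_in_chart M \<kappa> \<xi> u w =
     (let p = chart_inv \<kappa> \<xi> in Metric M p (from_chart M \<kappa> p u) (from_chart M \<kappa> p w))"

definition riemannian_manifold ::
    "('m::{t2_space,second_countable_topology}, 'e::euclidean_space) riem_structure \<Rightarrow> bool" where
  "riemannian_manifold M \<longleftrightarrow>
     smooth_atlas (Atlas M) \<and>
     (\<forall>p. bilinear (Metric M p) \<and>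
        (\<forall>u w. Metric M p u w = Metric M p w u) \<and>
        (\<forall>u. u \<noteq> 0 \<longrightarrow> Metric M p u u > 0)) \<and>
     (\<forall>\<kappa>\<in>Atlas M. \<forall>u w. smooth_on (chart_image \<kappa>) (\<lambda>\<xi>. metric_in_chart M \<kappa> \<xi> u w))"

definition tnorm :: "('m, 'e) riem_structure \<Rightarrow> 'm \<Rightarrow> 'e \<Rightarrow> real" where
  "tnorm M p u = sqrt (Metric M p u u)"


section \<open>Smooth maps into a manifold and vector fields along them\<close>

definition smooth_map_on ::
    "('m::topological_space, 'e::euclidean_space) riem_structure \<Rightarrow> 'a::real_normed_vector set \<Rightarrow>
     ('a \<Rightarrow> 'm) \<Rightarrow> bool" where
  "smooth_map_on M S f \<longleftrightarrow>
     continuous_on S f \<and>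
     (\<forall>\<kappa>\<in>Atlas M. smooth_on (S \<inter> f -` chart_dom \<kappa>) (\<lambda>x. chart_map \<kappa> (f x)))"

definition smooth_field_along ::
    "('m::topological_space, 'e::euclidean_space) riem_structure \<Rightarrow> 'a::real_normed_vector set \<Rightarrow>
     ('a \<Rightarrow> 'm) \<Rightarrow> ('a \<Rightarrow> 'e) \<Rightarrow> bool" where
  "smooth_field_along M S f X \<longleftrightarrow>
     (\<forall>\<kappa>\<in>Atlas M. smooth_on (S \<inter> f -` chart_dom \<kappa>) (\<lambda>x. to_chart M \<kappa> (f x) (X x)))"

text \<open>All curves have parameter interval \<open>[0,1]\<close>.\<close>

definition velocity ::
    "('m, 'e::euclidean_space) riem_structure \<Rightarrow> (real \<Rightarrow> 'm) \<Rightarrow> real \<Rightarrow> 'e" where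
  "velocity M \<gamma> t =
     vector_derivative (\<lambda>\<tau>. chart_map (chart_at M (\<gamma> t)) (\<gamma> \<tau>)) (at t within {0..1})"


section \<open>Levi-Civita connection, curvature, parallel transport\<close>

text \<open>
  The Levi-Civita connection in a chart: \<open>christoffel M \<kappa> \<xi> u w\<close> is \<open>\<nabla>\<^sub>u w\<close> at \<open>\<xi>\<close> for the vector fields
  with constant components \<open>u\<close> and \<open>w\<close>.  As constant fields commute, symmetry in \<open>u\<close> and \<open>w\<close> says
  that the connection is torsion-free; the last condition says that it is metric.
\<close>

definition christoffel ::
    "('m, 'e::euclidean_space) riem_structure \<Rightarrow> ('m, 'e) chart \<Rightarrow> 'e \<Rightarrow> 'e \<Rightarrow> 'e \<Rightarrow> 'e" where
  "christoffel M \<kappa> \<xi> =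
     (THE \<Gamma>. bilinear \<Gamma> \<and> (\<forall>u w. \<Gamma> u w = \<Gamma> w u) \<and>
        (\<forall>x u w. frechet_derivative (\<lambda>\<zeta>. metric_in_chart M \<kappa> \<zeta> u w) (at \<xi>) x =
           metric_in_chart M \<kappa> \<xi> (\<Gamma> x u) w + metric_in_chart M \<kappa> \<xi> u (\<Gamma> x w)))"

text \<open>Vector fields on the domain of \<open>\<kappa>\<close> are given here by their components \<open>X, Y, Z :: 'e \<Rightarrow> 'e\<close> in
  the coordinates of \<open>\<kappa>\<close>.\<close>

definition nabla ::
    "('m, 'e::euclidean_space) riem_structure \<Rightarrow> ('m, 'e) chart \<Rightarrow> ('e \<Rightarrow> 'e) \<Rightarrow> ('e \<Rightarrow> 'e) \<Rightarrow> 'e \<Rightarrow> 'e" where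
  "nabla M \<kappa> X Y \<xi> = frechet_derivative Y (at \<xi>) (X \<xi>) + christoffel M \<kappa> \<xi> (X \<xi>) (Y \<xi>)"

definition lie_bracket :: "('e::euclidean_space \<Rightarrow> 'e) \<Rightarrow> ('e \<Rightarrow> 'e) \<Rightarrow> 'e \<Rightarrow> 'e" where
  "lie_bracket X Y \<xi> = frechet_derivative Y (at \<xi>) (X \<xi>) - frechet_derivative X (at \<xi>) (Y \<xi>)"

definition curvature_of_fields ::
    "('m, 'e::euclidean_space) riem_structure \<Rightarrow> ('m, 'e) chart \<Rightarrow>
     ('e \<Rightarrow> 'e) \<Rightarrow> ('e \<Rightarrow> 'e) \<Rightarrow> ('e \<Rightarrow> 'e) \<Rightarrow> 'e \<Rightarrow> 'e" where
  "curvature_of_fields M \<kappa> X Y Z \<xi> =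
     nabla M \<kappa> X (nabla M \<kappa> Y Z) \<xi> - nabla M \<kappa> Y (nabla M \<kappa> X Z) \<xi>
       - nabla M \<kappa> (lie_bracket X Y) Z \<xi>"

text \<open>The value at \<open>p\<close> only depends on the values of the fields at \<open>p\<close>; we extend \<open>x, y, z \<in> T\<^sub>pM\<close> to
  fields with constant components in \<open>chart_at M p\<close>.\<close>

definition curvature ::
    "('m, 'e::euclidean_space) riem_structure \<Rightarrow> 'm \<Rightarrow> 'e \<Rightarrow> 'e \<Rightarrow> 'e \<Rightarrow> 'e" where
  "curvature M p x y z =
     (let \<kappa> = chart_at M p
      in curvature_of_fields M \<kappa> (\<lambda>_. x) (\<lambda>_. y) (\<lambda>_. z) (chart_map \<kappa> p))"

text \<open>The covariant derivative at \<open>t\<close> of the vector field \<open>X\<close> along \<open>\<gamma>\<close>, computed in the chart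
  \<open>\<kappa> = chart_at M (\<gamma> t)\<close>; note that \<open>to_chart M \<kappa> (\<gamma> t)\<close> is the identity.\<close>

definition cov_deriv ::
    "('m, 'e::euclidean_space) riem_structure \<Rightarrow> (real \<Rightarrow> 'm) \<Rightarrow> (real \<Rightarrow> 'e) \<Rightarrow> real \<Rightarrow> 'e" where
  "cov_deriv M \<gamma> X t =
     (let \<kappa> = chart_at M (\<gamma> t)
      in vector_derivative (\<lambda>\<tau>. to_chart M \<kappa> (\<gamma> \<tau>) (X \<tau>)) (at t within {0..1})
         + christoffel M \<kappa> (chart_map \<kappa> (\<gamma> t)) (velocity M \<gamma> t) (X t))"

definition parallel_along ::
    "('m::topological_space, 'e::euclidean_space) riem_structure \<Rightarrow> (real \<Rightarrow> 'm) \<Rightarrow> (real \<Rightarrow> 'e) \<Rightarrow> bool" where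
  "parallel_along M \<gamma> X \<longleftrightarrow>
     smooth_field_along M {0..1} \<gamma> X \<and> (\<forall>t\<in>{0..1}. cov_deriv M \<gamma> X t = 0)"

definition parallel_transport ::
    "('m::topological_space, 'e::euclidean_space) riem_structure \<Rightarrow> (real \<Rightarrow> 'm) \<Rightarrow> real \<Rightarrow> real \<Rightarrow> 'e \<Rightarrow> 'e" where
  "parallel_transport M \<gamma> t\<^sub>1 t\<^sub>2 w = (THE u. \<exists>X. parallel_along M \<gamma> X \<and> X t\<^sub>1 = w \<and> X t\<^sub>2 = u)"


section \<open>The space of immersed curves, its metric and geodesic distance\<close>

text \<open>Curves are functions on \<open>\<real>\<close> of which only the restriction to \<open>[0,1]\<close> matters.\<close>

definition Imm :: "('m::topological_space, 'e::euclidean_space) riem_structure \<Rightarrow> (real \<Rightarrow> 'm) set" where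
  "Imm M = {c. smooth_map_on M {0..1} c \<and> (\<forall>t\<in>{0..1}. velocity M c t \<noteq> 0)}"

definition speed :: "('m, 'e::euclidean_space) riem_structure \<Rightarrow> (real \<Rightarrow> 'm) \<Rightarrow> real \<Rightarrow> real" where
  "speed M c t = tnorm M (c t) (velocity M c t)"

definition unit_tangent :: "('m, 'e::euclidean_space) riem_structure \<Rightarrow> (real \<Rightarrow> 'm) \<Rightarrow> real \<Rightarrow> 'e" where
  "unit_tangent M c t = velocity M c t /\<^sub>R speed M c t"

definition arc_deriv ::
    "('m, 'e::euclidean_space) riem_structure \<Rightarrow> (real \<Rightarrow> 'm) \<Rightarrow> (real \<Rightarrow> 'e) \<Rightarrow> real \<Rightarrow> 'e" where
  "arc_deriv M c h t = cov_deriv M c h t /\<^sub>R speed M c t"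

definition arc_deriv_tan ::
    "('m, 'e::euclidean_space) riem_structure \<Rightarrow> (real \<Rightarrow> 'm) \<Rightarrow> (real \<Rightarrow> 'e) \<Rightarrow> real \<Rightarrow> 'e" where
  "arc_deriv_tan M c h t =
     Metric M (c t) (arc_deriv M c h t) (unit_tangent M c t) *\<^sub>R unit_tangent M c t"

definition arc_deriv_nor ::
    "('m, 'e::euclidean_space) riem_structure \<Rightarrow> (real \<Rightarrow> 'm) \<Rightarrow> (real \<Rightarrow> 'e) \<Rightarrow> real \<Rightarrow> 'e" where
  "arc_deriv_nor M c h t = arc_deriv M c h t - arc_deriv_tan M c h t"

definition elastic_metric ::
    "('m, 'e::euclidean_space) riem_structure \<Rightarrow> (real \<Rightarrow> 'm) \<Rightarrow> (real \<Rightarrow> 'e) \<Rightarrow> (real \<Rightarrow> 'e) \<Rightarrow> real" where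
  "elastic_metric M c h k =
     Metric M (c 0) (h 0) (k 0) +
     integral {0..1} (\<lambda>t.
       (Metric M (c t) (arc_deriv_nor M c h t) (arc_deriv_nor M c k t)
        + 1/4 * Metric M (c t) (arc_deriv_tan M c h t) (arc_deriv_tan M c k t)) * speed M c t)"

definition imm_paths ::
    "('m::topological_space, 'e::euclidean_space) riem_structure \<Rightarrow> (real \<Rightarrow> 'm) \<Rightarrow> (real \<Rightarrow> 'm) \<Rightarrow>
     (real \<Rightarrow> real \<Rightarrow> 'm) set" where
  "imm_paths M c\<^sub>0 c\<^sub>1 =
     {c. smooth_map_on M ({0..1} \<times> {0..1}) (\<lambda>(s, t). c s t) \<and>
         (\<forall>s\<in>{0..1}. c s \<in> Imm M) \<and>
         (\<forall>t\<in>{0..1}. c 0 t = c\<^sub>0 t \<and> c 1 t = c\<^sub>1 t)}"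

definition path_ds ::
    "('m, 'e::euclidean_space) riem_structure \<Rightarrow> (real \<Rightarrow> real \<Rightarrow> 'm) \<Rightarrow> real \<Rightarrow> real \<Rightarrow> 'e" where
  "path_ds M c s t = velocity M (\<lambda>a. c a t) s"

definition path_dt ::
    "('m, 'e::euclidean_space) riem_structure \<Rightarrow> (real \<Rightarrow> real \<Rightarrow> 'm) \<Rightarrow> real \<Rightarrow> real \<Rightarrow> 'e" where
  "path_dt M c s t = velocity M (c s) t"

text \<open>Extended real values, so that the distance is \<open>\<infinity>\<close> if there is no path from \<open>c\<^sub>0\<close> to \<open>c\<^sub>1\<close>.\<close>

definition geodesic_distance ::
    "('m::topological_space, 'e::euclidean_space) riem_structure \<Rightarrow>
     ((real \<Rightarrow> 'm) \<Rightarrow> (real \<Rightarrow> 'e) \<Rightarrow> (real \<Rightarrow> 'e) \<Rightarrow> real) \<Rightarrow> (real \<Rightarrow> 'm) \<Rightarrow> (real \<Rightarrow> 'm) \<Rightarrow> ereal" where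
  "geodesic_distance M G c\<^sub>0 c\<^sub>1 =
     (INF c\<in>imm_paths M c\<^sub>0 c\<^sub>1. ereal (integral {0..1} (\<lambda>s. sqrt (G (c s) (path_ds M c s) (path_ds M c s)))))"


section \<open>The square root velocity representation\<close>

definition srv ::
    "('m, 'e::euclidean_space) riem_structure \<Rightarrow> (real \<Rightarrow> real \<Rightarrow> 'm) \<Rightarrow> real \<Rightarrow> real \<Rightarrow> 'e" where
  "srv M c s t = path_dt M c s t /\<^sub>R sqrt (tnorm M (c s t) (path_dt M c s t))"

definition srv_ds ::
    "('m, 'e::euclidean_space) riem_structure \<Rightarrow> (real \<Rightarrow> real \<Rightarrow> 'm) \<Rightarrow> real \<Rightarrow> real \<Rightarrow> 'e" where
  "srv_ds M c s t = cov_deriv M (\<lambda>a. c a t) (\<lambda>a. srv M c a t) s"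

definition transport_to_origin ::
    "('m::topological_space, 'e::euclidean_space) riem_structure \<Rightarrow> (real \<Rightarrow> real \<Rightarrow> 'm) \<Rightarrow>
     real \<Rightarrow> real \<Rightarrow> 'e \<Rightarrow> 'e" where
  "transport_to_origin M c s t =
     parallel_transport M (\<lambda>a. c a 0) s 0 \<circ> parallel_transport M (c s) t 0"

definition srv_tilde ::
    "('m::topological_space, 'e::euclidean_space) riem_structure \<Rightarrow> (real \<Rightarrow> real \<Rightarrow> 'm) \<Rightarrow>
     real \<Rightarrow> real \<Rightarrow> 'e" where
  "srv_tilde M c s t = transport_to_origin M c s t (srv M c s t)"

definition srv_tilde_ds ::
    "('m::topological_space, 'e::euclidean_space) riem_structure \<Rightarrow> (real \<Rightarrow> real \<Rightarrow> 'm) \<Rightarrow>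
     real \<Rightarrow> real \<Rightarrow> 'e" where
  "srv_tilde_ds M c s t = vector_derivative (\<lambda>a. srv_tilde M c a t) (at s within {0..1})"

definition omega_field ::
    "('m::topological_space, 'e::euclidean_space) riem_structure \<Rightarrow> (real \<Rightarrow> real \<Rightarrow> 'm) \<Rightarrow>
     real \<Rightarrow> real \<Rightarrow> real \<Rightarrow> real \<Rightarrow> 'e" where
  "omega_field M c s t a \<tau> =
     (parallel_transport M (c a) 0 \<tau> \<circ> parallel_transport M (\<lambda>b. c b 0) s a
        \<circ> parallel_transport M (c s) t 0) (srv M c s t)"

definition Omega ::
    "('m::topological_space, 'e::euclidean_space) riem_structure \<Rightarrow> (real \<Rightarrow> real \<Rightarrow> 'm) \<Rightarrow>
     real \<Rightarrow> real \<Rightarrow> 'e" where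
  "Omega M c s t =
     transport_to_origin M c s t (cov_deriv M (\<lambda>a. c a t) (\<lambda>a. omega_field M c s t a t) s)"

end

theory Submission
  imports Defs
begin

text \<open>
  All three claims are pointwise in \<open>(s, t)\<close>. Since \<open>\<nabla>\<^sub>t c\<^sub>s = \<nabla>\<^sub>s c\<^sub>t\<close>, differentiating \<open>q = c\<^sub>t / \<bar>c\<^sub>t\<bar>\<^sup>1\<^sup>/\<^sup>2\<close> turns the
  integrand of the elastic metric into \<open>\<bar>\<nabla>\<^sub>s q\<bar>\<^sup>2\<close>. For the other two claims let \<open>Y\<^sub>e(a, \<tau>)\<close> be the transport of
  \<open>e \<in> T\<^bsub>c(0,0)\<^esub>M\<close> first along \<open>c(\<cdot>, 0)\<close> and then along \<open>c(a, \<cdot>)\<close>. The field \<open>Z = \<nabla>\<^sub>a Y\<^sub>e\<close> exists by differentiating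
  the parallel transport equation in the parameter, and \<open>\<nabla>\<^sub>\<tau> Z = R(c\<^sub>t, c\<^sub>s) Y\<^sub>e\<close>, \<open>Z(0) = 0\<close>; transporting back to
  \<open>\<tau> = 0\<close> and integrating gives the formula for \<open>\<Omega>\<close>. As the transports are isometries, the transported \<open>q\<close>
  pairs with \<open>e\<close> to \<open>\<langle>q, Y\<^sub>e\<rangle>\<close>. Its derivative is \<open>\<langle>\<nabla>\<^sub>s q, Y\<^sub>e\<rangle> + \<langle>q, \<nabla>\<^sub>s Y\<^sub>e\<rangle>\<close>, and by constancy of \<open>\<langle>Y\<^sub>f, Y\<^sub>e\<rangle>\<close> the
  last term is \<open>- \<langle>\<Omega>, e\<rangle>\<close>, so the derivative of the transported \<open>q\<close> plus \<open>\<Omega>\<close> is the transported \<open>\<nabla>\<^sub>s q\<close>.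
\<close>

section \<open>Differentiable maps on sets with unique derivatives\<close>

text \<open>A vector at \<open>p\<close> is given by its components in \<open>chart_at M p\<close>,
  and this chart jumps as \<open>p\<close> varies, so a field along a curve is in general not even
  continuous as a function into \<open>'e\<close>. Derivatives make sense only for components in one
  chart fixed near the point, and \<open>has_cov\<close> is the relation that records them: unlike
  \<open>cov_deriv\<close>, which returns some value for any field, it also asserts that the
  derivative exists. For the same reason the existence of parallel fields and their
  differentiability in the parameter are first local statements, which are then spread over the unit
  interval by bisection. Parallel transport is never differentiated as an operator. A transported
  vector is paired with a fixed \<open>e\<close>, the transport is moved onto \<open>e\<close> by
  the isometry property, and what remains is the product rule for the metric, applied to the given
  field and to the field obtained from \<open>e\<close>.\<close>

text \<open>The hypothesis of \<open>frechet_derivative_unique_within\<close>; it holds for open sets and for relatively open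
  subsets of boxes, so the calculus of \<open>Ck_on\<close> below covers all domains on which \<open>smooth_on\<close> is used.\<close>

definition udiff :: "'a::euclidean_space set \<Rightarrow> bool" where
  "udiff S \<longleftrightarrow> (\<forall>x\<in>S. \<forall>i\<in>Basis. \<forall>e>0. \<exists>d. 0 < \<bar>d\<bar> \<and> \<bar>d\<bar> < e \<and> x + d *\<^sub>R i \<in> S)"

lemma udiff_unique:
  assumes "udiff S" "x \<in> S"
    and "(f has_derivative f') (at x within S)" "(f has_derivative f'') (at x within S)"
  shows "f' = f''"
  using assms unfolding udiff_def by (intro frechet_derivative_unique_within[of f f' x S f'']) auto

lemma udiff_frechet_derivative:
  assumes "udiff S" "x \<in> S" "(f has_derivative f') (at x within S)"
  shows "frechet_derivative f (at x within S) = f'"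
  using assms udiff_unique
  by (metis differentiableI frechet_derivative_works)

lemma udiff_openin:
  assumes T: "udiff T" and S: "openin (top_of_set T) S"
  shows "udiff S"
  unfolding udiff_def
proof (intro ballI allI impI)
  fix x i and e :: real assume x: "x \<in> S" and i: "i \<in> (Basis :: 'a set)" and e: "0 < e"
  from S x obtain r where r: "r > 0" "\<And>x'. x' \<in> T \<Longrightarrow> dist x' x < r \<Longrightarrow> x' \<in> S"
    unfolding openin_euclidean_subtopology_iff by blast
  have "x \<in> T" using S x openin_imp_subset by blast
  with T i e r(1) obtain d where d: "0 < \<bar>d\<bar>" "\<bar>d\<bar> < min e r" "x + d *\<^sub>R i \<in> T"
    unfolding udiff_def by (metis min_less_iff_conj)
  have "dist (x + d *\<^sub>R i) x = \<bar>d\<bar>" using i by (simp add: dist_norm)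
  with d r(2) show "\<exists>d. 0 < \<bar>d\<bar> \<and> \<bar>d\<bar> < e \<and> x + d *\<^sub>R i \<in> S" by auto
qed

lemma udiff_UNIV: "udiff (UNIV :: 'a::euclidean_space set)"
  unfolding udiff_def
proof (intro ballI allI impI)
  fix x i :: 'a and e :: real assume "0 < e"
  then show "\<exists>d. 0 < \<bar>d\<bar> \<and> \<bar>d\<bar> < e \<and> x + d *\<^sub>R i \<in> UNIV" by (intro exI[of _ "e/2"]) auto
qed

lemma udiff_open: "open S \<Longrightarrow> udiff S"
  using udiff_openin[OF udiff_UNIV] by simp

text \<open>The step must point into the box: upwards on the lower face of direction
  \<open>i\<close>, downwards elsewhere. Strict inequality leaves room for it in every
  direction.\<close>

lemma udiff_cbox:
  assumes "\<And>i. i \<in> Basis \<Longrightarrow> a \<bullet> i < b \<bullet> i"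
  shows "udiff (cbox a b)"
  unfolding udiff_def
proof (intro ballI allI impI)
  fix x i and e :: real assume x: "x \<in> cbox a b" and i: "i \<in> (Basis :: 'a set)" and e: "0 < e"
  have mem: "x + d *\<^sub>R i \<in> cbox a b" if "a \<bullet> i \<le> x \<bullet> i + d" "x \<bullet> i + d \<le> b \<bullet> i" for d
    using x that i by (auto simp: mem_box inner_simps inner_Basis)
  show "\<exists>d. 0 < \<bar>d\<bar> \<and> \<bar>d\<bar> < e \<and> x + d *\<^sub>R i \<in> cbox a b"
  proof (cases "x \<bullet> i = a \<bullet> i")
    case True
    then show ?thesis using assms[OF i] e
      by (intro exI[of _ "min e (b \<bullet> i - a \<bullet> i) / 2"] conjI mem) (auto simp: min_def field_simps)
  next
    case False
    with x i have "a \<bullet> i < x \<bullet> i" by (auto simp: mem_box order.order_iff_strict)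
    moreover have "x \<bullet> i \<le> b \<bullet> i" using x i by (auto simp: mem_box)
    ultimately show ?thesis using e
      by (intro exI[of _ "- (min e (x \<bullet> i - a \<bullet> i) / 2)"] conjI mem) (auto simp: min_def field_simps)
  qed
qed

lemma udiff_Icc: "a < b \<Longrightarrow> udiff {a..b::real}"
  using udiff_cbox[of a b] by simp

lemma udiff_rect: "a < b \<Longrightarrow> c < d \<Longrightarrow> udiff ({a..b::real} \<times> {c..d::real})"
  using udiff_cbox[of "(a,c)" "(b,d)"] by (force simp: Basis_prod_def cbox_Pair_eq)

section \<open>The calculus of \<open>Ck_on\<close>\<close>

lemma frechet_derivative_cong_on:
  assumes "\<And>x. x \<in> S \<Longrightarrow> f x = g x" "x \<in> S"
  shows "frechet_derivative f (at x within S) = frechet_derivative g (at x within S)"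
proof -
  have "(f has_derivative F) (at x within S) = (g has_derivative F) (at x within S)" for F
    using assms by (metis has_derivative_transform)
  then show ?thesis by (simp add: frechet_derivative_def)
qed

lemma Ck_on_cong:
  assumes "\<And>x. x \<in> S \<Longrightarrow> f x = g x"
  shows "Ck_on k S f = Ck_on k S g"
  using assms
proof (induction k arbitrary: f g)
  case 0 then show ?case by (simp cong: continuous_on_cong)
next
  case (Suc k)
  have "f differentiable_on S \<longleftrightarrow> g differentiable_on S"
    using Suc.prems unfolding differentiable_on_def differentiable_def by (metis has_derivative_transform)
  moreover have "Ck_on k S (\<lambda>x. frechet_derivative f (at x within S) v) =
      Ck_on k S (\<lambda>x. frechet_derivative g (at x within S) v)" for v
    by (rule Suc.IH) (simp add: frechet_derivative_cong_on[OF Suc.prems])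
  ultimately show ?case by simp
qed

text \<open>The entry point for most smoothness proofs: a derivative known by a formula may replace
  the one selected by \<open>frechet_derivative\<close>, since \<open>udiff\<close> makes them
  equal.\<close>

lemma Ck_on_SucI:
  assumes "udiff S" "\<And>x. x \<in> S \<Longrightarrow> (f has_derivative f' x) (at x within S)"
    and "\<And>v. Ck_on k S (\<lambda>x. f' x v)"
  shows "Ck_on (Suc k) S f"
proof -
  have "Ck_on k S (\<lambda>x. frechet_derivative f (at x within S) v) = Ck_on k S (\<lambda>x. f' x v)" for v
    by (intro Ck_on_cong) (simp add: udiff_frechet_derivative[OF assms(1) _ assms(2)])
  moreover have "f differentiable_on S"
    using assms(2) unfolding differentiable_on_def differentiable_def by blast
  ultimately show ?thesis using assms(3) by simp
qed

lemma Ck_on_has_derivative: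
  assumes "Ck_on (Suc k) S f" "x \<in> S"
  shows "(f has_derivative frechet_derivative f (at x within S)) (at x within S)"
  using assms by (simp add: differentiable_on_def frechet_derivative_works)

lemma Ck_on_frechet_derivative:
  "Ck_on (Suc k) S f \<Longrightarrow> Ck_on k S (\<lambda>x. frechet_derivative f (at x within S) v)"
  by simp

declare Ck_on.simps(2) [simp del]

lemma Ck_on_Suc_imp: "Ck_on (Suc k) S f \<Longrightarrow> Ck_on k S f"
proof (induction k arbitrary: f)
  case 0 then show ?case by (simp add: Ck_on.simps(2) differentiable_imp_continuous_on)
next
  case (Suc k) then show ?case by (metis Ck_on.simps(2))
qed

lemma Ck_on_le: "Ck_on k S f \<Longrightarrow> j \<le> k \<Longrightarrow> Ck_on j S f"
  by (induction k) (auto simp: le_Suc_eq dest: Ck_on_Suc_imp)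

lemma Ck_on_imp_continuous_on: "Ck_on k S f \<Longrightarrow> continuous_on S f"
  using Ck_on_le[of k S f 0] by simp

lemma Ck_on_const: "udiff S \<Longrightarrow> Ck_on k S (\<lambda>x. c)"
proof (induction k arbitrary: c)
  case (Suc k)
  then show ?case by (intro Ck_on_SucI[where f' = "\<lambda>_ _. 0"]) auto
qed simp

lemma Ck_on_bounded_linear:
  assumes L: "bounded_linear L" and S: "udiff S"
  shows "Ck_on k S f \<Longrightarrow> Ck_on k S (\<lambda>x. L (f x))"
proof (induction k arbitrary: f)
  case 0 then show ?case
    by (auto intro: continuous_on_compose2[OF linear_continuous_on[OF L, of UNIV]])
next
  case (Suc k)
  show ?case
    by (rule Ck_on_SucI[OF S bounded_linear.has_derivative[OF L Ck_on_has_derivative[OF Suc.prems]]])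
      (auto intro: Suc.IH Ck_on_frechet_derivative[OF Suc.prems])
qed

lemma Ck_on_id: "udiff S \<Longrightarrow> Ck_on k S (\<lambda>x. x)"
proof (cases k)
  case (Suc j) assume "udiff S" then show ?thesis unfolding Suc
    by (intro Ck_on_SucI[where f' = "\<lambda>_ h. h"]) (auto intro: Ck_on_const)
qed auto

lemma Ck_on_linear: "bounded_linear L \<Longrightarrow> udiff S \<Longrightarrow> Ck_on k S L"
  using Ck_on_bounded_linear[OF _ _ Ck_on_id] by blast

lemma Ck_on_add:
  assumes S: "udiff S"
  shows "Ck_on k S f \<Longrightarrow> Ck_on k S g \<Longrightarrow> Ck_on k S (\<lambda>x. f x + g x)"
proof (induction k arbitrary: f g)
  case 0 then show ?case by (auto intro: continuous_intros)
next
  case (Suc k)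
  show ?case
    by (rule Ck_on_SucI[OF S has_derivative_add[OF Ck_on_has_derivative[OF Suc.prems(1)]
            Ck_on_has_derivative[OF Suc.prems(2)]]])
      (auto intro: Suc.IH Ck_on_frechet_derivative[OF Suc.prems(1)]
        Ck_on_frechet_derivative[OF Suc.prems(2)])
qed

lemma Ck_on_sum:
  assumes S: "udiff S" and f: "\<And>i. i \<in> I \<Longrightarrow> Ck_on k S (f i)"
  shows "Ck_on k S (\<lambda>x. \<Sum>i\<in>I. f i x)"
  using f by (induction I rule: infinite_finite_induct)
    (auto intro: Ck_on_const Ck_on_add S)

lemma Ck_on_bilinear:
  assumes B: "bounded_bilinear B" and S: "udiff S"
  shows "Ck_on k S f \<Longrightarrow> Ck_on k S g \<Longrightarrow> Ck_on k S (\<lambda>x. B (f x) (g x))"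
proof (induction k arbitrary: f g)
  case 0 then show ?case by (auto intro: bounded_bilinear.continuous_on[OF B])
next
  case (Suc k)
  show ?case
    by (rule Ck_on_SucI[OF S bounded_bilinear.FDERIV[OF B Ck_on_has_derivative[OF Suc.prems(1)]
            Ck_on_has_derivative[OF Suc.prems(2)]]])
      (auto intro!: Suc.IH Ck_on_add S Ck_on_frechet_derivative[OF Suc.prems(1)]
        Ck_on_frechet_derivative[OF Suc.prems(2)]
        intro: Ck_on_Suc_imp[OF Suc.prems(1)] Ck_on_Suc_imp[OF Suc.prems(2)])
qed

lemmas Ck_on_scaleR = Ck_on_bilinear[OF bounded_bilinear_scaleR]
lemmas Ck_on_inner = Ck_on_bilinear[OF bounded_bilinear_inner]

lemma Ck_on_uminus: "udiff S \<Longrightarrow> Ck_on k S f \<Longrightarrow> Ck_on k S (\<lambda>x. - f x)"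
  by (rule Ck_on_bounded_linear[OF bounded_linear_minus[OF bounded_linear_ident]])

lemma Ck_on_diff: "udiff S \<Longrightarrow> Ck_on k S f \<Longrightarrow> Ck_on k S g \<Longrightarrow> Ck_on k S (\<lambda>x. f x - g x)"
  using Ck_on_add[OF _ _ Ck_on_uminus, of S k f g] by simp

section \<open>Families of linear and bilinear maps\<close>

lemma linear_basis_sum:
  fixes L :: "'a::euclidean_space \<Rightarrow> 'b::real_vector"
  assumes "linear L" shows "L w = (\<Sum>b\<in>Basis. (w \<bullet> b) *\<^sub>R L b)"
proof -
  have "L w = L (\<Sum>b\<in>Basis. (w \<bullet> b) *\<^sub>R b)" by (simp add: euclidean_representation)
  then show ?thesis using assms by (simp add: linear_sum linear_cmul)
qed

text \<open>Expanding \<open>w\<close> in the basis turns the value into a finite sum of products,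
  so a family of linear maps counts as smooth as soon as its values on fixed vectors do.\<close>

lemma Ck_on_linear_family:
  fixes w :: "'a::euclidean_space \<Rightarrow> 'b::euclidean_space"
  assumes S: "udiff S" and lin: "\<And>x. x \<in> S \<Longrightarrow> linear (B x)"
    and B: "\<And>b. Ck_on k S (\<lambda>x. B x b)" and w: "Ck_on k S w"
  shows "Ck_on k S (\<lambda>x. B x (w x))"
proof -
  have "Ck_on k S (\<lambda>x. B x (w x)) = Ck_on k S (\<lambda>x. \<Sum>b\<in>Basis. (w x \<bullet> b) *\<^sub>R B x b)"
    by (intro Ck_on_cong linear_basis_sum lin)
  then show ?thesis
    by (simp only:) (intro Ck_on_sum S Ck_on_scaleR Ck_on_inner B w Ck_on_const)
qed

lemma Ck_on_bilinear_family:
  fixes u :: "'a::euclidean_space \<Rightarrow> 'b::euclidean_space" and w :: "'a \<Rightarrow> 'c::euclidean_space"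
  assumes S: "udiff S" and lin: "\<And>x. x \<in> S \<Longrightarrow> bilinear (B x)"
    and B: "\<And>b c. Ck_on k S (\<lambda>x. B x b c)" and u: "Ck_on k S u" and w: "Ck_on k S w"
  shows "Ck_on k S (\<lambda>x. B x (u x) (w x))"
proof (rule Ck_on_linear_family[OF S _ _ w])
  show "linear (B x (u x))" if "x \<in> S" for x using lin[OF that] by (simp add: bilinear_def)
  show "Ck_on k S (\<lambda>x. B x (u x) b)" for b
    by (rule Ck_on_linear_family[OF S, where B = "\<lambda>x v. B x v b"])
      (use lin B u in \<open>auto simp: bilinear_def\<close>)
qed

text \<open>Induction on \<open>k\<close>: the derivative of the composite applies the family of
  linear maps \<open>?G (f x)\<close> to \<open>?F x v\<close>, which is the situation of
  \<open>Ck_on_linear_family\<close>.\<close>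

lemma Ck_on_compose:
  fixes f :: "'a::euclidean_space \<Rightarrow> 'b::euclidean_space"
  assumes S: "udiff S" and im: "f ` S \<subseteq> T"
  shows "Ck_on k T g \<Longrightarrow> Ck_on k S f \<Longrightarrow> Ck_on k S (\<lambda>x. g (f x))"
proof (induction k arbitrary: g)
  case 0 then show ?case using im by (auto intro: continuous_on_compose2)
next
  case (Suc k)
  let ?G = "\<lambda>y. frechet_derivative g (at y within T)"
  let ?F = "\<lambda>x. frechet_derivative f (at x within S)"
  have G: "(g has_derivative ?G y) (at y within T)" if "y \<in> T" for y
    using Ck_on_has_derivative[OF Suc.prems(1) that] .
  have "((\<lambda>x. g (f x)) has_derivative (\<lambda>h. ?G (f x) (?F x h))) (at x within S)" if "x \<in> S" for x
    using that im
    by (intro has_derivative_in_compose[OF Ck_on_has_derivative[OF Suc.prems(2)]]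
       has_derivative_subset[OF G]) auto
  then show ?case
  proof (rule Ck_on_SucI[OF S])
    fix v
    show "Ck_on k S (\<lambda>x. ?G (f x) (?F x v))"
    proof (rule Ck_on_linear_family[OF S])
      show "linear (?G (f x))" if "x \<in> S" for x
        using G that im by (meson has_derivative_linear image_subset_iff)
      show "Ck_on k S (\<lambda>x. ?G (f x) b)" for b
        by (intro Suc.IH Ck_on_frechet_derivative[OF Suc.prems(1)] Ck_on_Suc_imp[OF Suc.prems(2)])
      show "Ck_on k S (\<lambda>x. ?F x v)" by (rule Ck_on_frechet_derivative[OF Suc.prems(2)])
    qed
  qed
qed

text \<open>Differentiation in \<open>y\<close> commutes with the linear operations in
  \<open>v\<close>. This lets the derivatives of the single functions \<open>B y b\<close> be
  reassembled in the product rules along curves.\<close>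

lemma linear_frechet_derivative_family:
  assumes O: "open S" "x \<in> S" and lin: "\<And>y. y \<in> S \<Longrightarrow> linear (B y)"
    and d: "\<And>v. (\<lambda>y. B y v) differentiable at x"
  shows "linear (\<lambda>v. frechet_derivative (\<lambda>y. B y v) (at x) h)"
proof -
  note D = d[unfolded frechet_derivative_works]
  have tr: "frechet_derivative g (at x) = g'" if "(f has_derivative g') (at x)" "\<And>y. y \<in> S \<Longrightarrow> f y = g y" for f g g'
    using has_derivative_transform_within_open[OF that(1) O that(2)] by (simp add: frechet_derivative_at[symmetric])
  show ?thesis
  proof (rule linearI)
    fix u v
    show "frechet_derivative (\<lambda>y. B y (u + v)) (at x) h =
       frechet_derivative (\<lambda>y. B y u) (at x) h + frechet_derivative (\<lambda>y. B y v) (at x) h"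
      by (subst tr[OF has_derivative_add[OF D[of u] D[of v]]]) (auto simp: linear_add lin)
  next
    fix c u
    show "frechet_derivative (\<lambda>y. B y (c *\<^sub>R u)) (at x) h = c *\<^sub>R frechet_derivative (\<lambda>y. B y u) (at x) h"
      by (subst tr[OF has_derivative_scaleR_right[OF D[of u], of c]]) (auto simp: linear_cmul lin)
  qed
qed

lemma has_vector_derivative_compose_frechet:
  assumes "(\<xi> has_vector_derivative \<xi>') (at t within T)" "g differentiable at (\<xi> t)"
  shows "((\<lambda>t. g (\<xi> t)) has_vector_derivative frechet_derivative g (at (\<xi> t)) \<xi>') (at t within T)"
proof -
  have g: "(g has_derivative frechet_derivative g (at (\<xi> t))) (at (\<xi> t))"
    using assms(2) by (simp add: frechet_derivative_works)
  have "((\<lambda>t. g (\<xi> t)) has_derivative (\<lambda>h. frechet_derivative g (at (\<xi> t)) (h *\<^sub>R \<xi>'))) (at t within T)"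
    by (rule has_derivative_compose[OF assms(1)[unfolded has_vector_derivative_def] g])
  then show ?thesis
    using linear_cmul[OF has_derivative_linear[OF g]] by (simp add: has_vector_derivative_def)
qed

lemma has_vector_derivative_stays_in_open:
  assumes \<xi>: "(\<xi> has_vector_derivative \<xi>') (at t within T)" and O: "open S" "\<xi> t \<in> S"
  obtains r where "r > 0" "\<And>x. x \<in> T \<Longrightarrow> dist x t < r \<Longrightarrow> \<xi> x \<in> S"
proof -
  have "(\<xi> \<longlongrightarrow> \<xi> t) (at t within T)"
    using has_vector_derivative_continuous[OF \<xi>] by (simp add: continuous_within)
  then have "\<forall>\<^sub>F x in at t within T. \<xi> x \<in> S" using O by (rule topological_tendstoD)
  then obtain r where "r > 0" "\<And>x. x \<in> T \<Longrightarrow> x \<noteq> t \<Longrightarrow> dist x t < r \<Longrightarrow> \<xi> x \<in> S"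
    unfolding eventually_at by blast
  then have "\<And>x. x \<in> T \<Longrightarrow> dist x t < r \<Longrightarrow> \<xi> x \<in> S" using O(2) by metis
  with \<open>r > 0\<close> show ?thesis by (rule that)
qed

text \<open>Product rule for a family known only through its values on fixed vectors: the basis
  expansion is differentiated termwise and collected again by linearity of both \<open>B\<close> and
  its derivative.\<close>

lemma has_vector_derivative_linear_family:
  fixes w :: "real \<Rightarrow> 'c::euclidean_space"
  assumes O: "open S" "\<xi> t \<in> S" and lin: "\<And>y. y \<in> S \<Longrightarrow> linear (B y)"
    and d: "\<And>v. (\<lambda>y. B y v) differentiable at (\<xi> t)"
    and \<xi>: "(\<xi> has_vector_derivative \<xi>') (at t within T)" and ev: "t \<in> T"
    and w: "(w has_vector_derivative w') (at t within T)"
  shows "((\<lambda>t. B (\<xi> t) (w t)) has_vector_derivative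
           frechet_derivative (\<lambda>y. B y (w t)) (at (\<xi> t)) \<xi>' + B (\<xi> t) w') (at t within T)"
proof -
  let ?D = "\<lambda>v. frechet_derivative (\<lambda>y. B y v) (at (\<xi> t)) \<xi>'"
  have b: "((\<lambda>t. B (\<xi> t) b) has_vector_derivative ?D b) (at t within T)" for b
    by (rule has_vector_derivative_compose_frechet[OF \<xi> d])
  have wb: "((\<lambda>t. w t \<bullet> b) has_field_derivative w' \<bullet> b) (at t within T)" for b
    using bounded_linear.has_vector_derivative[OF bounded_linear_inner_left w, of b]
    by (simp add: has_real_derivative_iff_has_vector_derivative)
  have "((\<lambda>t. \<Sum>b\<in>Basis. (w t \<bullet> b) *\<^sub>R B (\<xi> t) b) has_vector_derivative
      (\<Sum>b\<in>Basis. (w t \<bullet> b) *\<^sub>R ?D b + (w' \<bullet> b) *\<^sub>R B (\<xi> t) b)) (at t within T)"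
    by (intro has_vector_derivative_sum has_vector_derivative_scaleR wb b)
  also have "(\<Sum>b\<in>Basis. (w t \<bullet> b) *\<^sub>R ?D b + (w' \<bullet> b) *\<^sub>R B (\<xi> t) b) = ?D (w t) + B (\<xi> t) w'"
    using linear_basis_sum[OF linear_frechet_derivative_family[OF O lin d, of \<xi>'], of "w t"]
      linear_basis_sum[OF lin[OF O(2)], of w'] by (simp add: sum.distrib)
  finally have *: "((\<lambda>t. \<Sum>b\<in>Basis. (w t \<bullet> b) *\<^sub>R B (\<xi> t) b) has_vector_derivative
      ?D (w t) + B (\<xi> t) w') (at t within T)" .
  \<comment> \<open>\<open>B\<close> is linear only over \<open>S\<close>, so the expansion is valid
    only as long as \<xi> stays in \<open>S\<close>; this holds near \<open>t\<close>.\<close>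
  obtain r where "r > 0" "\<And>x. x \<in> T \<Longrightarrow> dist x t < r \<Longrightarrow> \<xi> x \<in> S"
    using has_vector_derivative_stays_in_open[OF \<xi> O] by blast
  then show ?thesis
    by (intro has_vector_derivative_transform_within[OF * \<open>r > 0\<close> ev] linear_basis_sum[symmetric] lin)
qed

lemma has_vector_derivative_bilinear_family:
  fixes u :: "real \<Rightarrow> 'b::euclidean_space" and w :: "real \<Rightarrow> 'c::euclidean_space"
  assumes O: "open S" "\<xi> t \<in> S" and lin: "\<And>y. y \<in> S \<Longrightarrow> bilinear (B y)"
    and d: "\<And>v w. (\<lambda>y. B y v w) differentiable at (\<xi> t)"
    and \<xi>: "(\<xi> has_vector_derivative \<xi>') (at t within T)" and ev: "t \<in> T"
    and u: "(u has_vector_derivative u') (at t within T)"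
    and w: "(w has_vector_derivative w') (at t within T)"
  shows "((\<lambda>t. B (\<xi> t) (u t) (w t)) has_vector_derivative
           frechet_derivative (\<lambda>y. B y (u t) (w t)) (at (\<xi> t)) \<xi>' + B (\<xi> t) u' (w t) + B (\<xi> t) (u t) w')
           (at t within T)"
proof -
  have l1: "linear (\<lambda>v. B y v b)" and l2: "linear (B y v)" if "y \<in> S" for y b v
    using lin[OF that] by (auto simp: bilinear_def)
  let ?D = "\<lambda>b. frechet_derivative (\<lambda>y. B y (u t) b) (at (\<xi> t)) \<xi>'"
  have b: "((\<lambda>t. B (\<xi> t) (u t) b) has_vector_derivative ?D b + B (\<xi> t) u' b) (at t within T)" for b
    by (rule has_vector_derivative_linear_family[OF O l1 d \<xi> ev u])
  have wb: "((\<lambda>t. w t \<bullet> b) has_field_derivative w' \<bullet> b) (at t within T)" for b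
    using bounded_linear.has_vector_derivative[OF bounded_linear_inner_left w, of b]
    by (simp add: has_real_derivative_iff_has_vector_derivative)
  have "((\<lambda>t. \<Sum>b\<in>Basis. (w t \<bullet> b) *\<^sub>R B (\<xi> t) (u t) b) has_vector_derivative
      (\<Sum>b\<in>Basis. (w t \<bullet> b) *\<^sub>R (?D b + B (\<xi> t) u' b) + (w' \<bullet> b) *\<^sub>R B (\<xi> t) (u t) b)) (at t within T)"
    by (intro has_vector_derivative_sum has_vector_derivative_scaleR wb b)
  also have "(\<Sum>b\<in>Basis. (w t \<bullet> b) *\<^sub>R (?D b + B (\<xi> t) u' b) + (w' \<bullet> b) *\<^sub>R B (\<xi> t) (u t) b)
      = ?D (w t) + B (\<xi> t) u' (w t) + B (\<xi> t) (u t) w'"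
    using linear_basis_sum[OF linear_frechet_derivative_family[OF O l2 d, of "u t" \<xi>'], of "w t"]
      linear_basis_sum[OF l2[OF O(2)], of u' "w t"] linear_basis_sum[OF l2[OF O(2)], of "u t" w']
    by (simp add: sum.distrib scaleR_add_right)
  finally have *: "((\<lambda>t. \<Sum>b\<in>Basis. (w t \<bullet> b) *\<^sub>R B (\<xi> t) (u t) b) has_vector_derivative
      ?D (w t) + B (\<xi> t) u' (w t) + B (\<xi> t) (u t) w') (at t within T)" .
  obtain r where "r > 0" "\<And>x. x \<in> T \<Longrightarrow> dist x t < r \<Longrightarrow> \<xi> x \<in> S"
    using has_vector_derivative_stays_in_open[OF \<xi> O] by blast
  then show ?thesis
    by (intro has_vector_derivative_transform_within[OF * \<open>r > 0\<close> ev] linear_basis_sum[symmetric] l2)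
qed

section \<open>Linear systems and linear differential equations\<close>

text \<open>\<open>f\<close> is merely continuous at \<open>x\<close>. The difference quotient
  splits into \<open>f\<close> times the remainder of \<open>g\<close>, which tends to 0, and
  \<open>f y - f x\<close> times the bounded quotient of \<open>g'\<close>.\<close>

lemma has_derivative_scaleR_vanishing:
  fixes f :: "'a::real_normed_vector \<Rightarrow> real" and g :: "'a \<Rightarrow> 'b::real_normed_vector"
  assumes f: "(f \<longlongrightarrow> f x) (at x within S)" and g: "(g has_derivative g') (at x within S)" and 0: "g x = 0"
  shows "((\<lambda>y. f y *\<^sub>R g y) has_derivative (\<lambda>h. f x *\<^sub>R g' h)) (at x within S)"
proof -
  have bl: "bounded_linear g'" and lim: "((\<lambda>y. (1 / norm (y - x)) *\<^sub>R (g y - g' (y - x))) \<longlongrightarrow> 0) (at x within S)"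
    using g unfolding has_derivative_within by (auto simp: 0)
  obtain K where K: "\<And>h. norm (g' h) \<le> norm h * K" using bounded_linear.bounded[OF bl] by blast
  have 1: "((\<lambda>y. f y *\<^sub>R ((1 / norm (y - x)) *\<^sub>R (g y - g' (y - x)))) \<longlongrightarrow> f x *\<^sub>R 0) (at x within S)"
    by (intro tendsto_scaleR f lim)
  have 2: "((\<lambda>y. (f y - f x) *\<^sub>R ((1 / norm (y - x)) *\<^sub>R g' (y - x))) \<longlongrightarrow> 0) (at x within S)"
  proof (rule Lim_null_comparison)
    show "((\<lambda>y. \<bar>f y - f x\<bar> * K) \<longlongrightarrow> 0) (at x within S)"
      by (intro tendsto_mult_left_zero tendsto_rabs_zero Lim_null[THEN iffD1, OF f])
    show "\<forall>\<^sub>F y in at x within S. norm ((f y - f x) *\<^sub>R ((1 / norm (y - x)) *\<^sub>R g' (y - x))) \<le> \<bar>f y - f x\<bar> * K"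
      unfolding eventually_at_filter
    proof (intro always_eventually allI impI)
      fix y assume "y \<noteq> x"
      then have "norm (g' (y - x)) / norm (y - x) \<le> K"
        using K[of "y - x"] by (simp add: divide_le_eq mult.commute)
      then show "norm ((f y - f x) *\<^sub>R ((1 / norm (y - x)) *\<^sub>R g' (y - x))) \<le> \<bar>f y - f x\<bar> * K"
        using mult_left_mono[OF _ abs_ge_zero[of "f y - f x"]] by fastforce
    qed
  qed
  have "((\<lambda>y. (1 / norm (y - x)) *\<^sub>R (f y *\<^sub>R g y - f x *\<^sub>R g' (y - x))) \<longlongrightarrow> 0) (at x within S)"
    using tendsto_add[OF 1 2] by (simp add: algebra_simps diff_divide_distrib)
  then show ?thesis
    unfolding has_derivative_within using bl by (auto intro: bounded_linear_const_scaleR simp: 0)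
qed

text \<open>Differentiability of \<open>y\<close> at \<open>x\<close> comes from \<open>y z = y x + L ((r z - r x) - (H z - H x) (y z))\<close>, where \<open>L\<close> inverts
  \<open>H x\<close>: in the last term a continuous function multiplies a differentiable one that vanishes at \<open>x\<close>.\<close>

lemma Ck_on_linear_solve:
  fixes H :: "'a::euclidean_space \<Rightarrow> 'e::euclidean_space \<Rightarrow> 'e"
  assumes S: "udiff S" and lin: "\<And>x. x \<in> S \<Longrightarrow> linear (H x)" and inj: "\<And>x. x \<in> S \<Longrightarrow> inj (H x)"
  shows "(\<And>b. Ck_on k S (\<lambda>x. H x b)) \<Longrightarrow> Ck_on k S r \<Longrightarrow> (\<And>x. x \<in> S \<Longrightarrow> H x (y x) = r x) \<Longrightarrow> Ck_on k S y"
proof (induction k arbitrary: r y)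
  case 0
  have "(y \<longlongrightarrow> y x0) (at x0 within S)" if x0: "x0 \<in> S" for x0
  proof -
    obtain Li where Li: "linear Li" "\<And>v. Li (H x0 v) = v"
      using linear_injective_left_inverse[OF lin[OF x0] inj[OF x0]] by (metis comp_apply id_apply)
    obtain K where K: "K > 0" "\<And>v. norm (Li v) \<le> norm v * K"
      using bounded_linear.pos_bounded[OF linear_conv_bounded_linear[THEN iffD1, OF Li(1)]] by blast
    define \<eta> where "\<eta> x = (\<Sum>b\<in>Basis. norm (H x b - H x0 b))" for x
    define \<rho> where "\<rho> x = norm (r x - r x0)" for x
    have "((\<lambda>x. H x b) \<longlongrightarrow> H x0 b) (at x0 within S)" for b
      using 0(1)[of b] x0 by (simp add: continuous_on)
    then have \<eta>0: "(\<eta> \<longlongrightarrow> 0) (at x0 within S)"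
      unfolding \<eta>_def by (intro tendsto_null_sum tendsto_norm_zero) (simp add: Lim_null[symmetric])
    have "(r \<longlongrightarrow> r x0) (at x0 within S)" using 0(2) x0 by (simp add: continuous_on)
    then have \<rho>0: "(\<rho> \<longlongrightarrow> 0) (at x0 within S)"
      unfolding \<rho>_def by (intro tendsto_norm_zero) (simp add: Lim_null[symmetric])
    have diff: "norm (H x v - H x0 v) \<le> \<eta> x * norm v" if "x \<in> S" for x v
    proof -
      have "H x v - H x0 v = (\<Sum>b\<in>Basis. (v \<bullet> b) *\<^sub>R (H x b - H x0 b))"
        by (simp add: linear_basis_sum[OF lin[OF that], of v] linear_basis_sum[OF lin[OF x0], of v]
            sum_subtractf scaleR_diff_right)
      also have "norm \<dots> \<le> (\<Sum>b\<in>Basis. norm v * norm (H x b - H x0 b))"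
        by (intro sum_norm_le) (simp add: mult_right_mono Basis_le_norm)
      finally show ?thesis by (simp add: \<eta>_def sum_distrib_left mult.commute)
    qed
    have key: "norm (y x - y x0) \<le> K * (\<rho> x + \<eta> x * norm (y x))" if "x \<in> S" for x
    proof -
      have "y x - y x0 = Li (H x0 (y x - y x0))" by (simp add: Li)
      also have "H x0 (y x - y x0) = (r x - r x0) - (H x (y x) - H x0 (y x))"
        by (simp add: linear_diff[OF lin[OF x0]] 0(3) that x0)
      finally have "norm (y x - y x0) \<le> K * norm ((r x - r x0) - (H x (y x) - H x0 (y x)))"
        by (metis K(2) mult.commute)
      also have "norm ((r x - r x0) - (H x (y x) - H x0 (y x))) \<le> \<rho> x + \<eta> x * norm (y x)"
        unfolding \<rho>_def using diff[OF that, of "y x"] norm_triangle_ineq4 order_trans by (smt (verit))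
      finally show ?thesis using K(1) by (simp add: mult_left_mono)
    qed
    have "((\<lambda>x. y x - y x0) \<longlongrightarrow> 0) (at x0 within S)"
    proof (rule Lim_null_comparison)
      show "((\<lambda>x. 2 * K * (\<rho> x + \<eta> x * norm (y x0))) \<longlongrightarrow> 0) (at x0 within S)"
        by (intro tendsto_mult_right_zero tendsto_add_zero \<rho>0 tendsto_mult_left_zero \<eta>0)
      \<comment> \<open>Below this threshold \<open>K * \<eta> x\<close> is at most 1/2, so the part
        of \<open>norm (y x)\<close> that comes from \<open>y x - y x0\<close> can be absorbed on
        the left; hence the factor 2.\<close>
      have "\<forall>\<^sub>F x in at x0 within S. \<eta> x < 1 / (2 * K)"
        by (rule order_tendstoD(2)[OF \<eta>0]) (use K(1) in simp)
      moreover have "\<forall>\<^sub>F x in at x0 within S. x \<in> S" by (simp add: eventually_at_filter)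
      ultimately show "\<forall>\<^sub>F x in at x0 within S. norm (y x - y x0) \<le> 2 * K * (\<rho> x + \<eta> x * norm (y x0))"
      proof eventually_elim
        case (elim x)
        have e0: "0 \<le> \<eta> x" by (simp add: \<eta>_def sum_nonneg)
        let ?d = "norm (y x - y x0)"
        have ny: "norm (y x) \<le> ?d + norm (y x0)" by (metis diff_add_cancel norm_triangle_ineq)
        have "K * \<eta> x \<le> 1/2" using elim(1) K(1) by (simp add: field_simps)
        then have h: "K * \<eta> x * ?d \<le> 1/2 * ?d" by (intro mult_right_mono) auto
        have "?d \<le> K * (\<rho> x + \<eta> x * (?d + norm (y x0)))"
          by (rule order_trans[OF key[OF elim(2)]])
            (use K(1) e0 ny in \<open>auto intro!: mult_left_mono add_left_mono\<close>)
        then show ?case using h by (simp add: algebra_simps)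
      qed
    qed
    then show ?thesis by (simp add: Lim_null[symmetric])
  qed
  then show ?case by (simp add: continuous_on)
next
  case (Suc k)
  let ?H' = "\<lambda>x b. frechet_derivative (\<lambda>x. H x b) (at x within S)"
  let ?r' = "\<lambda>x. frechet_derivative r (at x within S)"
  define G where "G x v = ?r' x v - (\<Sum>b\<in>Basis. (y x \<bullet> b) *\<^sub>R ?H' x b v)" for x v
  define L where "L x = (SOME Li. linear Li \<and> (\<forall>v. Li (H x v) = v))" for x
  have L: "linear (L x)" "L x (H x v) = v" if "x \<in> S" for x v
  proof -
    have "\<exists>Li. linear Li \<and> (\<forall>v. Li (H x v) = v)"
      using linear_injective_left_inverse[OF lin[OF that] inj[OF that]] by (metis comp_apply id_apply)
    from someI_ex[OF this] show "linear (L x)" "L x (H x v) = v" unfolding L_def by auto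
  qed
  have HL: "H x (L x v) = v" if "x \<in> S" for x v
    using linear_injective_imp_surjective[OF lin[OF that] inj[OF that]] L(2)[OF that] by (metis surjD)
  have yk: "Ck_on k S y"
    by (rule Suc.IH[OF _ _ Suc.prems(3)]) (auto intro: Ck_on_Suc_imp Suc.prems)
  have y': "(y has_derivative (\<lambda>v. L x (G x v))) (at x within S)" if x: "x \<in> S" for x
  proof -
    have cy: "(y \<longlongrightarrow> y x) (at x within S)"
      using Ck_on_imp_continuous_on[OF yk] x by (simp add: continuous_on)
    have Hd: "((\<lambda>x. H x b) has_derivative ?H' x b) (at x within S)" for b
      by (rule Ck_on_has_derivative[OF Suc.prems(1) x])
    have "((\<lambda>z. (y z \<bullet> b) *\<^sub>R (H z b - H x b)) has_derivative (\<lambda>v. (y x \<bullet> b) *\<^sub>R ?H' x b v)) (at x within S)" for b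
      by (rule has_derivative_scaleR_vanishing)
        (auto intro!: tendsto_inner cy has_derivative_diff[OF Hd has_derivative_const, simplified])
    then have "((\<lambda>z. \<Sum>b\<in>Basis. (y z \<bullet> b) *\<^sub>R (H z b - H x b)) has_derivative
        (\<lambda>v. \<Sum>b\<in>Basis. (y x \<bullet> b) *\<^sub>R ?H' x b v)) (at x within S)" by (rule has_derivative_sum)
    then have "((\<lambda>z. (r z - r x) - (\<Sum>b\<in>Basis. (y z \<bullet> b) *\<^sub>R (H z b - H x b))) has_derivative G x) (at x within S)"
      unfolding G_def
      by (intro has_derivative_diff) (use has_derivative_diff[OF Ck_on_has_derivative[OF Suc.prems(2) x] has_derivative_const] in auto)
    from has_derivative_add[OF has_derivative_const bounded_linear.has_derivative[OF linear_conv_bounded_linear[THEN iffD1, OF L(1)[OF x]] this], of "y x"]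
    have *: "((\<lambda>z. y x + L x ((r z - r x) - (\<Sum>b\<in>Basis. (y z \<bullet> b) *\<^sub>R (H z b - H x b)))) has_derivative (\<lambda>v. L x (G x v))) (at x within S)"
      by simp
    show ?thesis
    proof (rule has_derivative_transform[OF x _ *])
      fix z assume z: "z \<in> S"
      have "(\<Sum>b\<in>Basis. (y z \<bullet> b) *\<^sub>R (H z b - H x b)) = H z (y z) - H x (y z)"
        by (simp add: linear_basis_sum[OF lin[OF z], of "y z"] linear_basis_sum[OF lin[OF x], of "y z"]
            sum_subtractf scaleR_diff_right)
      then have "(r z - r x) - (\<Sum>b\<in>Basis. (y z \<bullet> b) *\<^sub>R (H z b - H x b)) = H x (y z - y x)"
        by (simp add: Suc.prems(3) x z linear_diff[OF lin[OF x]])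
      then show "y z = y x + L x ((r z - r x) - (\<Sum>b\<in>Basis. (y z \<bullet> b) *\<^sub>R (H z b - H x b)))"
        by (simp add: L x)
    qed
  qed
  show ?case
  proof (rule Ck_on_SucI[OF S y'])
    fix v
    have "Ck_on k S (\<lambda>x. G x v)" unfolding G_def
      by (intro Ck_on_diff S Ck_on_sum Ck_on_scaleR Ck_on_inner yk Ck_on_const
          Ck_on_frechet_derivative[OF Suc.prems(1)] Ck_on_frechet_derivative[OF Suc.prems(2)])
    \<comment> \<open>The derivative solves the system with the same \<open>H\<close> and right-hand
      side \<open>G\<close>, so the induction hypothesis covers it.\<close>
    then show "Ck_on k S (\<lambda>x. L x (G x v))"
      by (rule Suc.IH[rotated]) (auto intro: HL Ck_on_Suc_imp Suc.prems)
  qed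
qed

lemma continuous_on_linear_family:
  fixes w :: "'a::topological_space \<Rightarrow> 'b::euclidean_space" and B :: "'a \<Rightarrow> 'b \<Rightarrow> 'c::real_normed_vector"
  assumes "\<And>x. x \<in> S \<Longrightarrow> linear (B x)" "\<And>b. continuous_on S (\<lambda>x. B x b)" "continuous_on S w"
  shows "continuous_on S (\<lambda>x. B x (w x))"
proof -
  have "continuous_on S (\<lambda>x. \<Sum>b\<in>Basis. (w x \<bullet> b) *\<^sub>R B x b)" by (intro continuous_intros assms)
  then show ?thesis by (rule continuous_on_eq) (simp add: linear_basis_sum[OF assms(1), symmetric])
qed

section \<open>Linear differential equations on short intervals\<close>

lemma vector_derivative_bound:
  fixes f :: "real \<Rightarrow> 'b::real_normed_vector"
  assumes "\<And>x. x \<in> {a..b} \<Longrightarrow> (f has_vector_derivative f' x) (at x within {a..b})"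
    and "\<And>x. x \<in> {a..b} \<Longrightarrow> norm (f' x) \<le> C" and "x \<in> {a..b}" "y \<in> {a..b}"
  shows "norm (f x - f y) \<le> C * \<bar>x - y\<bar>"
proof -
  have "onorm (\<lambda>h. h *\<^sub>R f' x) \<le> C" if "x \<in> {a..b}" for x
    by (rule onorm_le) (use assms(2)[OF that] in \<open>simp add: mult.commute[of C] mult_left_mono\<close>)
  from differentiable_bound[OF _ assms(1)[unfolded has_vector_derivative_def] this assms(3,4)]
  show ?thesis by simp
qed

text \<open>Picard iteration: the bound 1/2 on \<open>K * (\<beta> - \<alpha>)\<close> makes the
  integral operator a contraction with factor 1/2. Composition with \<open>clamp\<close> extends
  functions constantly beyond the interval, which places them in the complete space of bounded
  continuous functions.\<close>

lemma linear_ode_short: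
  fixes A :: "real \<Rightarrow> 'e::euclidean_space \<Rightarrow> 'e"
  assumes ab: "\<alpha> \<le> \<beta>" and lin: "\<And>t. t \<in> {\<alpha>..\<beta>} \<Longrightarrow> linear (A t)"
    and cA: "\<And>x. continuous_on {\<alpha>..\<beta>} (\<lambda>t. A t x)" and cb: "continuous_on {\<alpha>..\<beta>} b"
    and K: "\<And>t x. t \<in> {\<alpha>..\<beta>} \<Longrightarrow> norm (A t x) \<le> K * norm x" and K0: "0 \<le> K" and short: "K * (\<beta> - \<alpha>) \<le> 1/2"
  obtains z where "z \<alpha> = z0"
    "\<And>t. t \<in> {\<alpha>..\<beta>} \<Longrightarrow> (z has_vector_derivative A t (z t) + b t) (at t within {\<alpha>..\<beta>})"
proof -
  have cg: "continuous_on {\<alpha>..\<beta>} (\<lambda>t. A t (f t) + b t)" if "continuous_on {\<alpha>..\<beta>} f" for f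
    by (rule continuous_on_add[OF continuous_on_linear_family[OF lin cA that] cb])
  define I where "I f t = z0 + integral {\<alpha>..t} (\<lambda>\<tau>. A \<tau> (apply_bcontfun f \<tau>) + b \<tau>)" for f t
  have "\<exists>g. \<forall>x. apply_bcontfun g x = I f (clamp \<alpha> \<beta> x)" for f
  proof -
    have "continuous_on (cbox \<alpha> \<beta>) (I f)" unfolding I_def
      by (intro continuous_intros) (auto intro!: indefinite_integral_continuous_1 integrable_continuous_real cg)
    then show ?thesis by (rule continuous_on_cbox_bcontfunE) blast
  qed
  then obtain T where T: "\<And>f x. apply_bcontfun (T f) x = I f (clamp \<alpha> \<beta> x)" by metis
  have cl: "clamp \<alpha> \<beta> x \<in> {\<alpha>..\<beta>}" for x using clamp_in_interval[of \<alpha> \<beta> x] ab by simp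
  have "dist (T f) (T g) \<le> 1/2 * dist f g" for f g
  proof (rule dist_bound)
    fix x
    let ?t = "clamp \<alpha> \<beta> x"
    have t: "\<alpha> \<le> ?t" "?t \<le> \<beta>" using cl[of x] by auto
    have sub: "{\<alpha>..?t} \<subseteq> {\<alpha>..\<beta>}" using t by auto
    have int: "(\<lambda>\<tau>. A \<tau> (apply_bcontfun h \<tau>) + b \<tau>) integrable_on {\<alpha>..?t}" for h
      by (intro integrable_continuous_real continuous_on_subset[OF cg sub]) auto
    have "I f ?t - I g ?t = integral {\<alpha>..?t} (\<lambda>\<tau>. (A \<tau> (apply_bcontfun f \<tau>) + b \<tau>) - (A \<tau> (apply_bcontfun g \<tau>) + b \<tau>))"
      by (simp only: I_def add_diff_cancel_left integral_diff[OF int int])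
    also have "\<dots> = integral {\<alpha>..?t} (\<lambda>\<tau>. A \<tau> (apply_bcontfun f \<tau> - apply_bcontfun g \<tau>))"
      using sub by (intro integral_cong) (auto simp: linear_diff[OF lin])
    also have "norm \<dots> \<le> K * dist f g * (?t - \<alpha>)"
    proof (rule integral_bound[OF t(1)])
      show "continuous_on {\<alpha>..?t} (\<lambda>\<tau>. A \<tau> (apply_bcontfun f \<tau> - apply_bcontfun g \<tau>))"
        by (rule continuous_on_linear_family[OF _ continuous_on_subset[OF cA sub]])
          (use sub in \<open>auto intro!: lin continuous_intros\<close>)
      fix \<tau> assume "\<tau> \<in> {\<alpha>..?t}"
      then have "norm (A \<tau> (apply_bcontfun f \<tau> - apply_bcontfun g \<tau>)) \<le> K * norm (apply_bcontfun f \<tau> - apply_bcontfun g \<tau>)"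
        using K sub by blast
      also have "\<dots> \<le> K * dist f g" using dist_bounded[of f \<tau> g] K0 by (simp add: dist_norm mult_left_mono)
      finally show "norm (A \<tau> (apply_bcontfun f \<tau> - apply_bcontfun g \<tau>)) \<le> K * dist f g" .
    qed
    also have "\<dots> \<le> (K * (\<beta> - \<alpha>)) * dist f g"
      using mult_left_mono[of "?t - \<alpha>" "\<beta> - \<alpha>" "K * dist f g"] t K0 by (simp add: mult_ac)
    also have "\<dots> \<le> 1/2 * dist f g" using short by (intro mult_right_mono) auto
    finally show "dist (apply_bcontfun (T f) x) (apply_bcontfun (T g) x) \<le> 1/2 * dist f g"
      by (simp add: T dist_norm)
  qed
  then obtain f where f: "T f = f" using banach_fix_type[of "1/2" T] by auto
  have fI: "apply_bcontfun f t = I f t" if "t \<in> {\<alpha>..\<beta>}" for t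
    using T[of f t] that by (simp add: f clamp_cancel_cbox)
  show ?thesis
  proof (rule that[of "I f"])
    show "I f \<alpha> = z0" by (simp add: I_def)
    fix t assume t: "t \<in> {\<alpha>..\<beta>}"
    have "(I f has_vector_derivative A t (apply_bcontfun f t) + b t) (at t within {\<alpha>..\<beta>})"
      unfolding I_def
      using has_vector_derivative_add[OF has_vector_derivative_const[of z0]
          integral_has_vector_derivative[OF cg[OF continuous_on_apply_bcontfun] t]] by simp
    then show "(I f has_vector_derivative A t (I f t) + b t) (at t within {\<alpha>..\<beta>})"
      using fI[OF t] by simp
  qed
qed

text \<open>Gronwall without exponentials: at a point \<open>m\<close> where
  \<open>norm (e t)\<close> is largest, the mean value inequality bounds it by
  \<open>norm (e \<alpha>)\<close>, half of itself and the contribution of \<open>r\<close>.\<close>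

lemma linear_ode_short_estimate:
  fixes e :: "real \<Rightarrow> 'e::euclidean_space"
  assumes e: "\<And>t. t \<in> {\<alpha>..\<beta>} \<Longrightarrow> (e has_vector_derivative A t (e t) + r t) (at t within {\<alpha>..\<beta>})"
    and K: "\<And>t x. t \<in> {\<alpha>..\<beta>} \<Longrightarrow> norm (A t x) \<le> K * norm x" and K0: "0 \<le> K" and short: "K * (\<beta> - \<alpha>) \<le> 1/2"
    and r: "\<And>t. t \<in> {\<alpha>..\<beta>} \<Longrightarrow> norm (r t) \<le> C" and t: "t \<in> {\<alpha>..\<beta>}"
  shows "norm (e t) \<le> 2 * (norm (e \<alpha>) + C * (\<beta> - \<alpha>))"
proof -
  have "continuous_on {\<alpha>..\<beta>} e"
    using e by (meson has_vector_derivative_continuous continuous_on_eq_continuous_within)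
  then obtain m where m: "m \<in> {\<alpha>..\<beta>}" "\<And>t. t \<in> {\<alpha>..\<beta>} \<Longrightarrow> norm (e t) \<le> norm (e m)"
    using continuous_attains_sup[of "{\<alpha>..\<beta>}" "\<lambda>t. norm (e t)", OF _ _ continuous_on_norm] t by blast
  have "0 \<le> C" using r[OF t] norm_ge_zero order_trans by blast
  have "norm (A t (e t) + r t) \<le> K * norm (e m) + C" if "t \<in> {\<alpha>..\<beta>}" for t
    using norm_triangle_ineq[of "A t (e t)" "r t"] K[OF that, of "e t"] r[OF that]
      mult_left_mono[OF m(2)[OF that] K0] by linarith
  from vector_derivative_bound[OF e this m(1), of \<alpha>] m(1)
  have "norm (e m - e \<alpha>) \<le> (K * norm (e m) + C) * (m - \<alpha>)" by auto
  also have "\<dots> \<le> (K * norm (e m) + C) * (\<beta> - \<alpha>)"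
    using m(1) K0 \<open>0 \<le> C\<close> by (intro mult_left_mono) auto
  also have "\<dots> = K * (\<beta> - \<alpha>) * norm (e m) + C * (\<beta> - \<alpha>)" by (simp add: algebra_simps)
  also have "\<dots> \<le> 1/2 * norm (e m) + C * (\<beta> - \<alpha>)"
    using mult_right_mono[OF short norm_ge_zero[of "e m"]] by simp
  finally have "norm (e m) \<le> norm (e \<alpha>) + (1/2 * norm (e m) + C * (\<beta> - \<alpha>))"
    using norm_triangle_sub[of "e m" "e \<alpha>"] by linarith
  then show ?thesis using m(2)[OF t] by (simp add: field_simps)
qed

text \<open>Uniform continuity of \<open>F1\<close> on the compact product makes the first-order
  remainder in \<open>a\<close> small uniformly in \<open>t\<close>, as an error estimate over a
  whole time interval requires.\<close>

lemma uniform_linearization: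
  fixes F F1 :: "real \<Rightarrow> real \<Rightarrow> 'b::real_normed_vector"
  assumes N: "compact N" "convex N" "s \<in> N" and W: "compact W"
    and c: "continuous_on (N \<times> W) (\<lambda>(a, t). F1 a t)"
    and d: "\<And>a t. a \<in> N \<Longrightarrow> t \<in> W \<Longrightarrow> ((\<lambda>a. F a t) has_vector_derivative F1 a t) (at a within N)"
    and \<epsilon>: "0 < \<epsilon>"
  obtains \<delta> where "\<delta> > 0"
    "\<And>a t. a \<in> N \<Longrightarrow> \<bar>a - s\<bar> < \<delta> \<Longrightarrow> t \<in> W \<Longrightarrow> norm (F a t - F s t - (a - s) *\<^sub>R F1 s t) \<le> \<epsilon> * \<bar>a - s\<bar>"
proof -
  have "uniformly_continuous_on (N \<times> W) (\<lambda>(a, t). F1 a t)"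
    by (intro compact_uniformly_continuous c compact_Times N W)
  then obtain \<delta> where \<delta>: "\<delta> > 0" "\<And>p q. p \<in> N \<times> W \<Longrightarrow> q \<in> N \<times> W \<Longrightarrow> dist q p < \<delta> \<Longrightarrow>
      dist ((\<lambda>(a, t). F1 a t) q) ((\<lambda>(a, t). F1 a t) p) < \<epsilon>"
    unfolding uniformly_continuous_on_def using \<epsilon> by meson
  show ?thesis
  proof (rule that[OF \<delta>(1)])
    fix a t assume a: "a \<in> N" "\<bar>a - s\<bar> < \<delta>" and t: "t \<in> W"
    let ?S = "N \<inter> ball s \<delta>"
    have s: "s \<in> ?S" using N \<delta>(1) by simp
    have "convex ?S" using N by (intro convex_Int) auto
    moreover have "a \<in> ?S" using a by (auto simp: dist_real_def)
    ultimately have seg: "closed_segment s a \<subseteq> ?S" using s by (intro closed_segment_subset)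
    have "norm (F a t - F s t - (a - s) *\<^sub>R F1 s t) \<le> norm (a - s) * \<epsilon>"
    proof (rule vector_differentiable_bound_linearization[OF _ seg _ s])
      fix x assume x: "x \<in> ?S"
      then show "((\<lambda>a. F a t) has_vector_derivative F1 x t) (at x within ?S)"
        using d t by (auto intro: has_vector_derivative_within_subset)
      show "norm (F1 x t - F1 s t) \<le> \<epsilon>"
        using \<delta>(2)[of "(s, t)" "(x, t)"] x s t
        by (auto simp: dist_Pair_Pair dist_norm norm_minus_commute dist_commute abs_minus_commute)
    qed
    then show "norm (F a t - F s t - (a - s) *\<^sub>R F1 s t) \<le> \<epsilon> * \<bar>a - s\<bar>" by (simp add: mult.commute)
  qed
qed


text \<open>The error \<open>E = y a - y s - (a - s) z\<close> solves the equation of \<open>y a\<close> up to a term of order \<open>o(a - s)\<close>.\<close>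

lemma linear_ode_short_parameter_derivative:
  fixes A A1 :: "real \<Rightarrow> real \<Rightarrow> 'e::euclidean_space \<Rightarrow> 'e" and p q \<alpha> \<beta> :: real
  defines "N \<equiv> {p..q}" and "W \<equiv> {\<alpha>..\<beta>}"
  assumes ab: "\<alpha> \<le> \<beta>" and s: "s \<in> N"
    and lin: "\<And>a t. a \<in> N \<Longrightarrow> t \<in> W \<Longrightarrow> linear (A a t)"
    and lin1: "\<And>a t. a \<in> N \<Longrightarrow> t \<in> W \<Longrightarrow> linear (A1 a t)"
    and cA: "\<And>x. continuous_on W (\<lambda>t. A s t x)"
    and cA1: "\<And>x. continuous_on (N \<times> W) (\<lambda>(a, t). A1 a t x)"
    and dA: "\<And>a t x. a \<in> N \<Longrightarrow> t \<in> W \<Longrightarrow> ((\<lambda>a. A a t x) has_vector_derivative A1 a t x) (at a within N)"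
    and K: "\<And>a t x. a \<in> N \<Longrightarrow> t \<in> W \<Longrightarrow> norm (A a t x) \<le> K * norm x" and K0: "0 \<le> K"
    and short: "K * (\<beta> - \<alpha>) \<le> 1/2"
    and y: "\<And>a t. a \<in> N \<Longrightarrow> t \<in> W \<Longrightarrow> ((\<lambda>t. y a t) has_vector_derivative A a t (y a t)) (at t within W)"
    and y0: "((\<lambda>a. y a \<alpha>) has_vector_derivative z0) (at s within N)"
  obtains z where "z \<alpha> = z0"
    "\<And>t. t \<in> W \<Longrightarrow> (z has_vector_derivative A s t (z t) + A1 s t (y s t)) (at t within W)"
    "\<And>t. t \<in> W \<Longrightarrow> ((\<lambda>a. y a t) has_vector_derivative z t) (at s within N)"
proof -
  have cv: "continuous_on W (y s)"
    using y[OF s] by (meson has_vector_derivative_continuous continuous_on_eq_continuous_within)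
  have cv2: "continuous_on (N \<times> W) (\<lambda>x. f (snd x))" if "continuous_on W f" for f :: "real \<Rightarrow> 'e"
    by (rule continuous_on_compose2[OF that]) (auto intro: continuous_intros)
  have cF1: "continuous_on (N \<times> W) (\<lambda>(a, t). A1 a t (f t))" if "continuous_on W f" for f
    using continuous_on_linear_family[of "N \<times> W" "\<lambda>x. A1 (fst x) (snd x)" "\<lambda>x. f (snd x)"] lin1 cA1 cv2[OF that]
    by (auto simp: case_prod_beta')
  have cs: "continuous_on W (\<lambda>t. A1 s t (f t))" if "continuous_on W f" for f
    using continuous_on_compose2[OF cF1[OF that] continuous_on_Pair[OF continuous_on_const continuous_on_id], of s W] s by auto
  obtain z where z0: "z \<alpha> = z0" and
    z: "\<And>t. t \<in> W \<Longrightarrow> (z has_vector_derivative A s t (z t) + A1 s t (y s t)) (at t within W)"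
    using linear_ode_short[of \<alpha> \<beta> "A s" "\<lambda>t. A1 s t (y s t)" K z0] ab lin[OF s] cA cs[OF cv] K[OF s] K0 short
    unfolding W_def by blast
  have cz: "continuous_on W z"
    using z by (meson has_vector_derivative_continuous continuous_on_eq_continuous_within)
  have N: "compact N" "convex N" "s \<in> N" "compact W" using s by (auto simp: N_def W_def)
  have dF: "((\<lambda>a. A a t (f t)) has_vector_derivative A1 a t (f t)) (at a within N)" if "a \<in> N" "t \<in> W" for a t f
    using dA[OF that] .
  have "bounded ((\<lambda>t. A1 s t (z t)) ` W)"
    by (intro compact_imp_bounded compact_continuous_image cs cz N)
  then obtain C where C: "\<And>t. t \<in> W \<Longrightarrow> norm (A1 s t (z t)) \<le> C" "C > 0"
    unfolding bounded_pos by (metis imageI)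
  have "((\<lambda>a. y a t) has_vector_derivative z t) (at s within N)" if t: "t \<in> W" for t
    unfolding has_vector_derivative_def has_derivative_within_alt
  proof (intro conjI allI impI)
    show "bounded_linear (\<lambda>h. h *\<^sub>R z t)" by (rule bounded_linear_scaleR_left)
    fix e :: real assume e: "0 < e"
    \<comment> \<open>Chosen so that the final bound
      \<open>2 * (\<epsilon> + 2 * \<epsilon> * (\<beta> - \<alpha>))\<close> on the slope equals
      \<open>e\<close>.\<close>
    define \<epsilon> where "\<epsilon> = e / (2 * (1 + 2 * (\<beta> - \<alpha>)))"
    have \<epsilon>: "\<epsilon> > 0" using e ab by (auto simp: \<epsilon>_def)
    obtain d1 where d1: "d1 > 0" "\<And>a t. a \<in> N \<Longrightarrow> \<bar>a - s\<bar> < d1 \<Longrightarrow> t \<in> W \<Longrightarrow>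
        norm (A a t (y s t) - A s t (y s t) - (a - s) *\<^sub>R A1 s t (y s t)) \<le> \<epsilon> * \<bar>a - s\<bar>"
      using uniform_linearization[OF N cF1[OF cv] dF[of _ _ "y s"] \<epsilon>] by blast
    obtain d2 where d2: "d2 > 0" "\<And>a t. a \<in> N \<Longrightarrow> \<bar>a - s\<bar> < d2 \<Longrightarrow> t \<in> W \<Longrightarrow>
        norm (A a t (z t) - A s t (z t) - (a - s) *\<^sub>R A1 s t (z t)) \<le> 1 * \<bar>a - s\<bar>"
      using uniform_linearization[OF N cF1[OF cz] dF[of _ _ z] zero_less_one] by blast
    obtain d3 where d3: "d3 > 0" "\<And>a. a \<in> N \<Longrightarrow> \<bar>a - s\<bar> < d3 \<Longrightarrow>
        norm (y a \<alpha> - y s \<alpha> - (a - s) *\<^sub>R z0) \<le> \<epsilon> * \<bar>a - s\<bar>"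
      using y0 \<epsilon> unfolding has_vector_derivative_def has_derivative_within_alt by (auto simp: dist_norm)
    \<comment> \<open>With the last bound \<open>A a t (z t) - A s t (z t)\<close>, of size at most
      \<open>(1 + C) * \<bar>a - s\<bar>\<close>, drops to \<epsilon> or below, so its product with
      \<open>a - s\<close> is negligible too.\<close>
    let ?d = "Min {d1, d2, d3, \<epsilon> / (1 + C)}"
    show "\<exists>d>0. \<forall>a\<in>N. norm (a - s) < d \<longrightarrow> norm (y a t - y s t - (a - s) *\<^sub>R z t) \<le> e * norm (a - s)"
    proof (intro exI[of _ ?d] conjI ballI impI)
      show "0 < ?d" using d1 d2 d3 \<epsilon> C(2) by simp
      fix a assume a: "a \<in> N" and "norm (a - s) < ?d"
      then have ad: "\<bar>a - s\<bar> < d1" "\<bar>a - s\<bar> < d2" "\<bar>a - s\<bar> < d3" "\<bar>a - s\<bar> < \<epsilon> / (1 + C)" by auto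
      define E where "E t = y a t - y s t - (a - s) *\<^sub>R z t" for t
      \<comment> \<open>The defect of \<open>E\<close> in the equation of \<open>y a\<close>; both
        summands are bounded by \<open>\<epsilon> * \<bar>a - s\<bar>\<close>.\<close>
      define r where "r t = (A a t (y s t) - A s t (y s t) - (a - s) *\<^sub>R A1 s t (y s t))
          + (a - s) *\<^sub>R (A a t (z t) - A s t (z t))" for t
      have E': "(E has_vector_derivative A a t (E t) + r t) (at t within {\<alpha>..\<beta>})" if "t \<in> {\<alpha>..\<beta>}" for t
      proof -
        have t: "t \<in> W" using that by (simp add: W_def)
        have eq: "A a t (E t) + r t = A a t (y a t) - A s t (y s t) - (a - s) *\<^sub>R (A s t (z t) + A1 s t (y s t))"
          using lin[OF a t] by (simp add: E_def r_def linear_diff linear_cmul) (simp add: algebra_simps)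
        show ?thesis unfolding eq unfolding E_def W_def[symmetric]
          by (intro has_vector_derivative_diff y a s t
              bounded_linear.has_vector_derivative[OF bounded_linear_scaleR_right] z)
      qed
      have rb: "norm (r t) \<le> 2 * \<epsilon> * \<bar>a - s\<bar>" if "t \<in> {\<alpha>..\<beta>}" for t
      proof -
        have t: "t \<in> W" using that by (simp add: W_def)
        let ?g = "A a t (z t) - A s t (z t)"
        have "norm ?g \<le> norm (?g - (a - s) *\<^sub>R A1 s t (z t)) + norm ((a - s) *\<^sub>R A1 s t (z t))"
          by (metis diff_add_cancel norm_triangle_ineq)
        also have "\<dots> \<le> 1 * \<bar>a - s\<bar> + \<bar>a - s\<bar> * C"
          using d2(2)[OF a ad(2) t] C(1)[OF t] by (intro add_mono) (auto intro: mult_left_mono)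
        also have "\<dots> = \<bar>a - s\<bar> * (1 + C)" by (simp add: algebra_simps)
        also have "\<dots> \<le> \<epsilon>" using ad(4) C(2) by (simp add: field_simps)
        finally have "norm ((a - s) *\<^sub>R ?g) \<le> \<bar>a - s\<bar> * \<epsilon>" by (simp add: mult_left_mono)
        then have "norm ((a - s) *\<^sub>R ?g) \<le> \<epsilon> * \<bar>a - s\<bar>" by (simp only: mult.commute)
        from add_mono[OF d1(2)[OF a ad(1) t] this] show ?thesis
          unfolding r_def by (intro order_trans[OF norm_triangle_ineq]) simp
      qed
      have "norm (E t) \<le> 2 * (norm (E \<alpha>) + 2 * \<epsilon> * \<bar>a - s\<bar> * (\<beta> - \<alpha>))"
        by (rule linear_ode_short_estimate[OF E' K[OF a, unfolded W_def] K0 short rb t[unfolded W_def]])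
      also have "\<dots> \<le> 2 * (\<epsilon> * \<bar>a - s\<bar> + 2 * \<epsilon> * \<bar>a - s\<bar> * (\<beta> - \<alpha>))"
        using d3(2)[OF a ad(3)] by (simp add: E_def z0)
      also have "\<dots> = (2 * (1 + 2 * (\<beta> - \<alpha>)) * \<epsilon>) * \<bar>a - s\<bar>" by (simp add: algebra_simps)
      also have "2 * (1 + 2 * (\<beta> - \<alpha>)) * \<epsilon> = e" using ab by (simp add: \<epsilon>_def)
      finally show "norm (y a t - y s t - (a - s) *\<^sub>R z t) \<le> e * norm (a - s)" by (simp add: E_def)
    qed
  qed
  with z0 z show ?thesis by (rule that)
qed

section \<open>Symmetry of second derivatives up to the boundary\<close>

text \<open>Differentiation under the integral sign, rather than a mean value argument at interior points, because \<open>(s, t)\<close>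
  may lie on the boundary of the rectangle.\<close>

lemma mixed_partials_eq:
  fixes F :: "real \<Rightarrow> real \<Rightarrow> 'b::euclidean_space"
  assumes p: "p < q" "s \<in> {p..q}" and b: "b0 < b1" "t \<in> {b0..b1}"
    and F1: "\<And>\<tau>. \<tau> \<in> {b0..b1} \<Longrightarrow> ((\<lambda>a. F a \<tau>) has_vector_derivative F1 \<tau>) (at s within {p..q})"
    and F2: "\<And>a \<tau>. a \<in> {p..q} \<Longrightarrow> \<tau> \<in> {b0..b1} \<Longrightarrow> (F a has_vector_derivative F2 a \<tau>) (at \<tau> within {b0..b1})"
    and F21: "\<And>a \<tau>. a \<in> {p..q} \<Longrightarrow> \<tau> \<in> {b0..b1} \<Longrightarrow> ((\<lambda>a. F2 a \<tau>) has_vector_derivative F21 a \<tau>) (at a within {p..q})"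
    and cF2: "\<And>a. a \<in> {p..q} \<Longrightarrow> continuous_on {b0..b1} (F2 a)"
    and cF21: "continuous_on ({p..q} \<times> {b0..b1}) (\<lambda>(a, \<tau>). F21 a \<tau>)"
    and F12: "(F1 has_vector_derivative m) (at t within {b0..b1})"
  shows "m = F21 s t"
proof -
  have cs: "continuous_on {b0..b1} (F21 s)"
    using continuous_on_compose2[OF cF21 continuous_on_Pair[OF continuous_on_const continuous_on_id], of s "{b0..b1}"] p by (simp add: image_subset_iff)
  \<comment> \<open>So \<open>F1\<close> is an antiderivative of \<open>F21 s\<close>: the integral
    formula for \<open>F\<close> in its second variable is differentiated in \<open>a\<close> and
    compared with the given \<open>F1\<close>.\<close>
  have F1eq: "F1 \<tau> = F1 b0 + integral {b0..\<tau>} (F21 s)" if \<tau>: "\<tau> \<in> {b0..b1}" for \<tau>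
  proof -
    have sub: "{b0..\<tau>} \<subseteq> {b0..b1}" and b0: "b0 \<in> {b0..b1}" using \<tau> b by auto
    have eq: "F a \<tau> = F a b0 + integral (cbox b0 \<tau>) (F2 a)" if "a \<in> {p..q}" for a
    proof -
      have "(F2 a has_integral (F a \<tau> - F a b0)) {b0..\<tau>}"
        using \<tau> sub by (intro fundamental_theorem_of_calculus) (auto intro: has_vector_derivative_within_subset[OF F2[OF that]])
      then show ?thesis by (simp add: integral_unique)
    qed
    have "((\<lambda>a. integral (cbox b0 \<tau>) (F2 a)) has_vector_derivative integral (cbox b0 \<tau>) (F21 s)) (at s within {p..q})"
    proof (rule leibniz_rule_vector_derivative[OF _ _ _ p(2)])
      show "((\<lambda>a. F2 a \<sigma>) has_vector_derivative F21 a \<sigma>) (at a within {p..q})" if "a \<in> {p..q}" "\<sigma> \<in> cbox b0 \<tau>" for a \<sigma>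
        using F21 that sub by auto
      show "F2 a integrable_on cbox b0 \<tau>" if "a \<in> {p..q}" for a
        using continuous_on_subset[OF cF2[OF that] sub] by (simp add: integrable_continuous_real)
      show "continuous_on ({p..q} \<times> cbox b0 \<tau>) (\<lambda>(a, \<tau>). F21 a \<tau>)"
        by (rule continuous_on_subset[OF cF21]) (use sub in auto)
    qed auto
    from has_vector_derivative_add[OF F1[OF b0] this]
    have "((\<lambda>a. F a \<tau>) has_vector_derivative F1 b0 + integral (cbox b0 \<tau>) (F21 s)) (at s within {p..q})"
      by (rule has_vector_derivative_transform[OF p(2) eq, rotated])
    from vector_derivative_unique_within_closed_interval[OF p(1), of s, unfolded cbox_interval, OF p(2) F1[OF \<tau>] this]
    show ?thesis by simp
  qed
  have "((\<lambda>\<tau>. F1 b0 + integral {b0..\<tau>} (F21 s)) has_vector_derivative 0 + F21 s t) (at t within {b0..b1})"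
    by (intro has_vector_derivative_add has_vector_derivative_const integral_has_vector_derivative cs b)
  from has_vector_derivative_transform[OF b(2) F1eq this]
  show ?thesis using vector_derivative_unique_within_closed_interval[OF b(1), of t, unfolded cbox_interval, OF b(2) F12] by simp
qed

lemma Ck_on_line_derivative:
  assumes g: "Ck_on (Suc k) S g" and x: "x + t *\<^sub>R u \<in> S" and sub: "\<And>\<tau>. \<tau> \<in> T \<Longrightarrow> x + \<tau> *\<^sub>R u \<in> S"
  shows "((\<lambda>\<tau>. g (x + \<tau> *\<^sub>R u)) has_vector_derivative frechet_derivative g (at (x + t *\<^sub>R u) within S) u) (at t within T)"
proof -
  let ?G = "frechet_derivative g (at (x + t *\<^sub>R u) within S)"
  have G: "(g has_derivative ?G) (at (x + t *\<^sub>R u) within S)" by (rule Ck_on_has_derivative[OF g x])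
  have "((\<lambda>\<tau>. x + \<tau> *\<^sub>R u) has_derivative (\<lambda>h. h *\<^sub>R u)) (at t within T)"
    by (auto intro!: derivative_eq_intros)
  from has_derivative_in_compose[OF this has_derivative_subset[OF G]] sub
  have "((\<lambda>\<tau>. g (x + \<tau> *\<^sub>R u)) has_derivative (\<lambda>h. ?G (h *\<^sub>R u))) (at t within T)" by auto
  then show ?thesis using linear_cmul[OF has_derivative_linear[OF G]] by (simp add: has_vector_derivative_def)
qed

text \<open>0 may be an endpoint of either parameter interval, so \<open>x\<close> may lie on the
  boundary of \<open>S\<close>: a parallelogram on one side of \<open>x\<close> is enough for
  \<open>mixed_partials_eq\<close>.\<close>

lemma second_derivative_symmetric:
  fixes f :: "'a::euclidean_space \<Rightarrow> 'b::euclidean_space"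
  assumes f: "Ck_on (Suc (Suc k)) S f"
    and p: "p < q" "0 \<in> {p..q}" and b: "b0 < b1" "0 \<in> {b0..b1}"
    and sub: "\<And>a \<tau>. a \<in> {p..q} \<Longrightarrow> \<tau> \<in> {b0..b1} \<Longrightarrow> x + a *\<^sub>R u + \<tau> *\<^sub>R w \<in> S"
  shows "frechet_derivative (\<lambda>y. frechet_derivative f (at y within S) u) (at x within S) w =
    frechet_derivative (\<lambda>y. frechet_derivative f (at y within S) w) (at x within S) u"
proof -
  let ?D = "\<lambda>v y. frechet_derivative f (at y within S) v"
  let ?DD = "\<lambda>v w y. frechet_derivative (?D v) (at y within S) w"
  note D1 = Ck_on_frechet_derivative[OF f]
  have swap: "x + a *\<^sub>R u + \<tau> *\<^sub>R w = (x + \<tau> *\<^sub>R w) + a *\<^sub>R u" for a \<tau> by simp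
  have "?DD u w x = ?DD w u (x + 0 *\<^sub>R u + 0 *\<^sub>R w)"
  proof (rule mixed_partials_eq[OF p b, of "\<lambda>a \<tau>. f (x + a *\<^sub>R u + \<tau> *\<^sub>R w)" "\<lambda>\<tau>. ?D u (x + \<tau> *\<^sub>R w)"
        "\<lambda>a \<tau>. ?D w (x + a *\<^sub>R u + \<tau> *\<^sub>R w)" "\<lambda>a \<tau>. ?DD w u (x + a *\<^sub>R u + \<tau> *\<^sub>R w)"])
    show "((\<lambda>a. f (x + a *\<^sub>R u + \<tau> *\<^sub>R w)) has_vector_derivative ?D u (x + \<tau> *\<^sub>R w)) (at 0 within {p..q})"
      if "\<tau> \<in> {b0..b1}" for \<tau>
      using Ck_on_line_derivative[OF f, of "x + \<tau> *\<^sub>R w" 0 u "{p..q}"] sub[OF _ that] p(2)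
      unfolding swap by (force simp: swap)
    show "((\<lambda>\<tau>. f (x + a *\<^sub>R u + \<tau> *\<^sub>R w)) has_vector_derivative ?D w (x + a *\<^sub>R u + \<tau> *\<^sub>R w)) (at \<tau> within {b0..b1})"
      if "a \<in> {p..q}" "\<tau> \<in> {b0..b1}" for a \<tau>
      by (rule Ck_on_line_derivative[OF f]) (use sub that in auto)
    show "((\<lambda>a. ?D w (x + a *\<^sub>R u + \<tau> *\<^sub>R w)) has_vector_derivative ?DD w u (x + a *\<^sub>R u + \<tau> *\<^sub>R w)) (at a within {p..q})"
      if "a \<in> {p..q}" "\<tau> \<in> {b0..b1}" for a \<tau>
      unfolding swap by (rule Ck_on_line_derivative[OF D1]) (use sub that in \<open>auto simp: swap\<close>)
    show "continuous_on {b0..b1} (\<lambda>\<tau>. ?D w (x + a *\<^sub>R u + \<tau> *\<^sub>R w))" if "a \<in> {p..q}" for a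
      by (rule continuous_on_compose2[OF Ck_on_imp_continuous_on[OF D1]]) (use sub that in \<open>auto intro!: continuous_intros\<close>)
    show "continuous_on ({p..q} \<times> {b0..b1}) (\<lambda>(a, \<tau>). ?DD w u (x + a *\<^sub>R u + \<tau> *\<^sub>R w))"
      unfolding case_prod_beta'
      by (rule continuous_on_compose2[OF Ck_on_imp_continuous_on[OF Ck_on_frechet_derivative[OF D1]]])
        (use sub in \<open>auto intro!: continuous_intros\<close>)
    show "((\<lambda>\<tau>. ?D u (x + \<tau> *\<^sub>R w)) has_vector_derivative ?DD u w x) (at 0 within {b0..b1})"
      using Ck_on_line_derivative[OF D1, of x 0 w "{b0..b1}" u] sub[OF p(2)] b(2) by force
  qed
  then show ?thesis by simp
qed

lemma second_derivative_symmetric_open: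
  fixes f :: "'a::euclidean_space \<Rightarrow> 'b::euclidean_space"
  assumes f: "Ck_on (Suc (Suc k)) S f" and S: "open S" "x \<in> S"
  shows "frechet_derivative (\<lambda>y. frechet_derivative f (at y) u) (at x) w =
    frechet_derivative (\<lambda>y. frechet_derivative f (at y) w) (at x) u"
proof -
  obtain r where r: "r > 0" "ball x r \<subseteq> S" using S openE by blast
  \<comment> \<open>Keeps the parallelogram inside the ball; the summand 1 covers
    \<open>u = w = 0\<close>.\<close>
  define e where "e = r / (norm u + norm w + 1)"
  have e: "e > 0" using r(1) by (auto simp: e_def intro!: divide_pos_pos add_nonneg_pos)
  have "x + a *\<^sub>R u + \<tau> *\<^sub>R w \<in> S" if "a \<in> {0..e}" "\<tau> \<in> {0..e}" for a \<tau>
  proof -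
    have "norm (a *\<^sub>R u + \<tau> *\<^sub>R w) \<le> e * norm u + e * norm w"
      by (rule order_trans[OF norm_triangle_ineq]) (use that in \<open>auto intro!: add_mono mult_right_mono\<close>)
    also have "\<dots> < e * (norm u + norm w + 1)" using e by (simp add: algebra_simps)
    also have "norm u + norm w + 1 > 0" by (intro add_nonneg_pos) auto
    then have "e * (norm u + norm w + 1) = r" by (simp add: e_def)
    finally have "x + (a *\<^sub>R u + \<tau> *\<^sub>R w) \<in> ball x r"
      unfolding mem_ball dist_norm by (metis add_diff_cancel_left' norm_minus_commute)
    then show ?thesis using r by (auto simp: add.assoc)
  qed
  from second_derivative_symmetric[OF f e _ e _ this]
  have "frechet_derivative (\<lambda>y. frechet_derivative f (at y within S) u) (at x within S) w =
    frechet_derivative (\<lambda>y. frechet_derivative f (at y within S) w) (at x within S) u" using e by simp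
  moreover have "frechet_derivative (\<lambda>y. frechet_derivative f (at y within S) v) (at x within S) =
      frechet_derivative (\<lambda>y. frechet_derivative f (at y) v) (at x within S)" for v
    by (rule frechet_derivative_cong_on[OF _ S(2)]) (simp add: at_within_open[OF _ S(1)])
  ultimately show ?thesis by (simp add: at_within_open[OF S(2,1)])
qed

section \<open>Charts and Christoffel symbols\<close>

text \<open>The Euclidean Riesz representation. It recovers a vector from a form, both for lowering
  an index and for constructing the Christoffel symbols.\<close>

lemma linear_inner_basis_sum:
  fixes f :: "'e::euclidean_space \<Rightarrow> real"
  assumes "linear f" shows "inner (\<Sum>b\<in>Basis. f b *\<^sub>R b) w = f w"
  by (simp add: linear_basis_sum[OF assms, of w] inner_sum_left inner_sum_right mult.commute inner_commute)

locale riemannian =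
  fixes M :: "('m::{t2_space,second_countable_topology}, 'e::euclidean_space) riem_structure"
  assumes riemannian_manifold: "riemannian_manifold M"
begin

abbreviation transition :: "('m, 'e) chart \<Rightarrow> ('m, 'e) chart \<Rightarrow> 'e \<Rightarrow> 'e" where
  "transition \<kappa> \<mu> \<equiv> chart_map \<mu> \<circ> chart_inv \<kappa>"

definition overlap :: "('m, 'e) chart \<Rightarrow> ('m, 'e) chart \<Rightarrow> 'e set" where
  "overlap \<kappa> \<mu> = chart_map \<kappa> ` (chart_dom \<kappa> \<inter> chart_dom \<mu>)"

abbreviation g where "g \<equiv> metric_in_chart M"
abbreviation \<Gamma> where "\<Gamma> \<equiv> christoffel M"

lemma atlas: "smooth_atlas (Atlas M)"
  using riemannian_manifold by (simp add: riemannian_manifold_def)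

lemma open_chart_dom: "\<kappa> \<in> Atlas M \<Longrightarrow> open (chart_dom \<kappa>)"
  and open_chart_image: "\<kappa> \<in> Atlas M \<Longrightarrow> open (chart_image \<kappa>)"
  and chart_homeomorphism:
    "\<kappa> \<in> Atlas M \<Longrightarrow> homeomorphism (chart_dom \<kappa>) (chart_image \<kappa>) (chart_map \<kappa>) (chart_inv \<kappa>)"
  using atlas by (auto simp: smooth_atlas_def)

lemma chart_inv_map [simp]: "\<kappa> \<in> Atlas M \<Longrightarrow> p \<in> chart_dom \<kappa> \<Longrightarrow> chart_inv \<kappa> (chart_map \<kappa> p) = p"
  using chart_homeomorphism by (auto simp: homeomorphism_def)

lemma chart_map_in_image [simp]: "p \<in> chart_dom \<kappa> \<Longrightarrow> chart_map \<kappa> p \<in> chart_image \<kappa>"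
  by (simp add: chart_image_def)

lemma chart_map_inv [simp]: "\<kappa> \<in> Atlas M \<Longrightarrow> \<xi> \<in> chart_image \<kappa> \<Longrightarrow> chart_map \<kappa> (chart_inv \<kappa> \<xi>) = \<xi>"
  and chart_inv_in_dom [simp]: "\<kappa> \<in> Atlas M \<Longrightarrow> \<xi> \<in> chart_image \<kappa> \<Longrightarrow> chart_inv \<kappa> \<xi> \<in> chart_dom \<kappa>"
  by (auto simp: chart_image_def)

lemma chart_at: "chart_at M p \<in> Atlas M" "p \<in> chart_dom (chart_at M p)"
proof -
  have "p \<in> (\<Union>\<kappa>\<in>Atlas M. chart_dom \<kappa>)" using atlas unfolding smooth_atlas_def by simp
  then have "\<exists>\<kappa>. \<kappa> \<in> Atlas M \<and> p \<in> chart_dom \<kappa>" by blast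
  from someI_ex[OF this] show "chart_at M p \<in> Atlas M" "p \<in> chart_dom (chart_at M p)"
    by (auto simp: chart_at_def)
qed

lemma open_overlap: "\<kappa> \<in> Atlas M \<Longrightarrow> \<mu> \<in> Atlas M \<Longrightarrow> open (overlap \<kappa> \<mu>)"
proof -
  assume a: "\<kappa> \<in> Atlas M" "\<mu> \<in> Atlas M"
  have "openin (top_of_set (chart_dom \<kappa>)) (chart_dom \<kappa> \<inter> chart_dom \<mu>)"
    using open_chart_dom[OF a(2)] by (rule openin_open_Int)
  from homeomorphism_imp_open_map[OF chart_homeomorphism[OF a(1)] this]
  show ?thesis unfolding overlap_def using open_chart_image[OF a(1)] by (rule openin_open_trans)
qed

lemma overlapI: "p \<in> chart_dom \<kappa> \<Longrightarrow> p \<in> chart_dom \<mu> \<Longrightarrow> chart_map \<kappa> p \<in> overlap \<kappa> \<mu>"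
  by (auto simp: overlap_def)

lemma overlapD:
  "\<kappa> \<in> Atlas M \<Longrightarrow> \<xi> \<in> overlap \<kappa> \<mu> \<Longrightarrow> chart_inv \<kappa> \<xi> \<in> chart_dom \<kappa> \<and> chart_inv \<kappa> \<xi> \<in> chart_dom \<mu> \<and> chart_map \<kappa> (chart_inv \<kappa> \<xi>) = \<xi>"
  by (auto simp: overlap_def)

lemma Ck_on_transition: "\<kappa> \<in> Atlas M \<Longrightarrow> \<mu> \<in> Atlas M \<Longrightarrow> Ck_on k (overlap \<kappa> \<mu>) (transition \<kappa> \<mu>)"
  using atlas unfolding smooth_atlas_def overlap_def smooth_on_def by blast

lemma Ck_on_transition_derivative:
  assumes "\<kappa> \<in> Atlas M" "\<mu> \<in> Atlas M"
  shows "Ck_on k (overlap \<kappa> \<mu>) (\<lambda>\<xi>. frechet_derivative (transition \<kappa> \<mu>) (at \<xi>) v)"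
proof -
  have "Ck_on k (overlap \<kappa> \<mu>) (\<lambda>\<xi>. frechet_derivative (transition \<kappa> \<mu>) (at \<xi> within overlap \<kappa> \<mu>) v)"
    by (rule Ck_on_frechet_derivative[OF Ck_on_transition[OF assms]])
  then show ?thesis
    by (subst Ck_on_cong) (auto simp: at_within_open[OF _ open_overlap[OF assms]])
qed

lemma Ck_on_differentiable_at:
  assumes "Ck_on (Suc k) S f" "open S" "x \<in> S" shows "f differentiable at x"
  using Ck_on_has_derivative[OF assms(1,3)] assms by (metis at_within_open differentiableI)

lemma chart_change_has_derivative:
  assumes "\<kappa> \<in> Atlas M" "\<mu> \<in> Atlas M" "p \<in> chart_dom \<kappa>" "p \<in> chart_dom \<mu>"
  shows "(transition \<kappa> \<mu> has_derivative chart_change \<kappa> \<mu> p) (at (chart_map \<kappa> p))"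
  using Ck_on_differentiable_at[OF Ck_on_transition open_overlap overlapI] assms
  unfolding chart_change_def frechet_derivative_works by metis

lemma linear_chart_change:
  assumes "\<kappa> \<in> Atlas M" "\<mu> \<in> Atlas M" "p \<in> chart_dom \<kappa>" "p \<in> chart_dom \<mu>"
  shows "linear (chart_change \<kappa> \<mu> p)"
  using chart_change_has_derivative[OF assms] by (rule has_derivative_linear)

lemma chart_change_compose:
  assumes "\<kappa> \<in> Atlas M" "\<mu> \<in> Atlas M" "\<nu> \<in> Atlas M"
    and p: "p \<in> chart_dom \<kappa>" "p \<in> chart_dom \<mu>" "p \<in> chart_dom \<nu>"
  shows "chart_change \<mu> \<nu> p (chart_change \<kappa> \<mu> p v) = chart_change \<kappa> \<nu> p v"
proof -
  let ?x = "chart_map \<kappa> p"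
  have 1: "(transition \<kappa> \<mu> has_derivative chart_change \<kappa> \<mu> p) (at ?x)"
    and 3: "(transition \<kappa> \<nu> has_derivative chart_change \<kappa> \<nu> p) (at ?x)"
    using assms by (auto intro: chart_change_has_derivative)
  have 2: "(transition \<mu> \<nu> has_derivative chart_change \<mu> \<nu> p) (at (transition \<kappa> \<mu> ?x))"
    using assms chart_change_has_derivative[of \<mu> \<nu> p] by simp
  have "((\<lambda>x. transition \<mu> \<nu> (transition \<kappa> \<mu> x)) has_derivative (\<lambda>v. chart_change \<mu> \<nu> p (chart_change \<kappa> \<mu> p v))) (at ?x)"
    by (rule has_derivative_compose[OF 1 2])
  then have "(transition \<kappa> \<nu> has_derivative (\<lambda>v. chart_change \<mu> \<nu> p (chart_change \<kappa> \<mu> p v))) (at ?x)"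
  proof (rule has_derivative_transform_within_open[OF _ open_overlap overlapI])
    fix x assume x: "x \<in> overlap \<kappa> \<mu>"
    then show "transition \<mu> \<nu> (transition \<kappa> \<mu> x) = transition \<kappa> \<nu> x"
      using overlapD[OF assms(1) x] assms by simp
  qed (use assms in auto)
  from has_derivative_unique[OF this 3] show ?thesis by metis
qed

lemma chart_change_self:
  assumes "\<kappa> \<in> Atlas M" "p \<in> chart_dom \<kappa>" shows "chart_change \<kappa> \<kappa> p v = v"
proof -
  have "(transition \<kappa> \<kappa> has_derivative (\<lambda>v. v)) (at (chart_map \<kappa> p))"
    by (rule has_derivative_transform_within_open[OF has_derivative_ident open_chart_image[OF assms(1)]])
      (use assms in auto)
  from has_derivative_unique[OF this chart_change_has_derivative[of \<kappa> \<kappa> p]] assms show ?thesis by metis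
qed

lemma chart_change_inverse:
  assumes "\<kappa> \<in> Atlas M" "\<mu> \<in> Atlas M" "p \<in> chart_dom \<kappa>" "p \<in> chart_dom \<mu>"
  shows "chart_change \<mu> \<kappa> p (chart_change \<kappa> \<mu> p v) = v"
  using chart_change_compose[of \<kappa> \<mu> \<kappa> p v] chart_change_self assms by simp

lemma linear_to_chart: "\<kappa> \<in> Atlas M \<Longrightarrow> p \<in> chart_dom \<kappa> \<Longrightarrow> linear (to_chart M \<kappa> p)"
  using linear_chart_change[OF chart_at(1) _ chart_at(2)] by (simp add: to_chart_def[abs_def])

lemma linear_from_chart: "\<kappa> \<in> Atlas M \<Longrightarrow> p \<in> chart_dom \<kappa> \<Longrightarrow> linear (from_chart M \<kappa> p)"
  using linear_chart_change[OF _ chart_at(1) _ chart_at(2)] by (simp add: from_chart_def[abs_def])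

lemma from_to_chart [simp]: "\<kappa> \<in> Atlas M \<Longrightarrow> p \<in> chart_dom \<kappa> \<Longrightarrow> from_chart M \<kappa> p (to_chart M \<kappa> p v) = v"
  by (simp add: from_chart_def to_chart_def chart_change_inverse chart_at)

lemma to_from_chart [simp]: "\<kappa> \<in> Atlas M \<Longrightarrow> p \<in> chart_dom \<kappa> \<Longrightarrow> to_chart M \<kappa> p (from_chart M \<kappa> p v) = v"
  by (simp add: from_chart_def to_chart_def chart_change_inverse chart_at)

lemma to_chart_at [simp]: "to_chart M (chart_at M p) p v = v"
  by (simp add: to_chart_def chart_change_self chart_at)

lemma chart_change_to_chart:
  assumes "\<kappa> \<in> Atlas M" "\<mu> \<in> Atlas M" "p \<in> chart_dom \<kappa>" "p \<in> chart_dom \<mu>"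
  shows "chart_change \<kappa> \<mu> p (to_chart M \<kappa> p v) = to_chart M \<mu> p v"
  using assms by (simp add: to_chart_def chart_change_compose chart_at)

lemma from_chart_chart_change:
  assumes "\<kappa> \<in> Atlas M" "\<mu> \<in> Atlas M" "p \<in> chart_dom \<kappa>" "p \<in> chart_dom \<mu>"
  shows "from_chart M \<mu> p (chart_change \<kappa> \<mu> p v) = from_chart M \<kappa> p v"
  using assms by (simp add: from_chart_def chart_change_compose chart_at)

section \<open>The metric in coordinates\<close>

lemma bilinear_Metric: "bilinear (Metric M p)"
  and Metric_commute: "Metric M p u w = Metric M p w u"
  and Metric_pos: "u \<noteq> 0 \<Longrightarrow> Metric M p u u > 0"
  using riemannian_manifold by (auto simp: riemannian_manifold_def)

lemma Metric_nonneg: "Metric M p u u \<ge> 0"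
  using Metric_pos[of u p] bilinear_lzero[OF bilinear_Metric] by (cases "u = 0") auto

lemma Metric_eq_0: "Metric M p u u = 0 \<longleftrightarrow> u = 0"
  using Metric_pos[of u p] bilinear_lzero[OF bilinear_Metric, of p] by (cases "u = 0") auto

lemma Metric_eqI:
  assumes "\<And>w. Metric M p u w = Metric M p v w" shows "u = v"
proof -
  have "Metric M p (u - v) (u - v) = 0"
    using assms[of "u - v"] by (simp add: bilinear_lsub[OF bilinear_Metric])
  then show ?thesis by (simp add: Metric_eq_0)
qed

lemma g_eq_Metric:
  assumes "\<kappa> \<in> Atlas M" "p \<in> chart_dom \<kappa>"
  shows "g \<kappa> (chart_map \<kappa> p) u w = Metric M p (from_chart M \<kappa> p u) (from_chart M \<kappa> p w)"
  using assms by (simp add: metric_in_chart_def)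

lemma Metric_eq_g:
  assumes "\<kappa> \<in> Atlas M" "p \<in> chart_dom \<kappa>"
  shows "Metric M p u w = g \<kappa> (chart_map \<kappa> p) (to_chart M \<kappa> p u) (to_chart M \<kappa> p w)"
  using assms by (simp add: g_eq_Metric)

lemma g_chart_change:
  assumes "\<kappa> \<in> Atlas M" "\<mu> \<in> Atlas M" "p \<in> chart_dom \<kappa>" "p \<in> chart_dom \<mu>"
  shows "g \<mu> (chart_map \<mu> p) (chart_change \<kappa> \<mu> p u) (chart_change \<kappa> \<mu> p w) = g \<kappa> (chart_map \<kappa> p) u w"
  using assms by (simp add: g_eq_Metric from_chart_chart_change)

section \<open>Christoffel symbols in one chart\<close>

context
  fixes \<kappa> assumes \<kappa>: "\<kappa> \<in> Atlas M"
begin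

lemma bilinear_g: "\<xi> \<in> chart_image \<kappa> \<Longrightarrow> bilinear (g \<kappa> \<xi>)"
proof -
  assume "\<xi> \<in> chart_image \<kappa>"
  then obtain p where p: "p \<in> chart_dom \<kappa>" "\<xi> = chart_map \<kappa> p" by (auto simp: chart_image_def)
  have "linear (\<lambda>u. Metric M p (from_chart M \<kappa> p u) (from_chart M \<kappa> p w))"
    "linear (\<lambda>u. Metric M p (from_chart M \<kappa> p w) (from_chart M \<kappa> p u))" for w
    using linear_compose[OF linear_from_chart[OF \<kappa> p(1)], of "\<lambda>x. Metric M p x (from_chart M \<kappa> p w)"]
     linear_compose[OF linear_from_chart[OF \<kappa> p(1)], of "Metric M p (from_chart M \<kappa> p w)"]
     bilinear_Metric[of p] by (auto simp: bilinear_def o_def)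
  then show ?thesis by (simp add: bilinear_def p g_eq_Metric[OF \<kappa>])
qed

lemma g_commute: "g \<kappa> \<xi> u w = g \<kappa> \<xi> w u"
  by (simp add: metric_in_chart_def Metric_commute Let_def)

lemma g_eqI:
  assumes "\<xi> \<in> chart_image \<kappa>" "\<And>w. g \<kappa> \<xi> u w = g \<kappa> \<xi> v w" shows "u = v"
proof -
  obtain p where p: "p \<in> chart_dom \<kappa>" "\<xi> = chart_map \<kappa> p" using assms(1) by (auto simp: chart_image_def)
  have "from_chart M \<kappa> p u = from_chart M \<kappa> p v"
  proof (rule Metric_eqI)
    fix w show "Metric M p (from_chart M \<kappa> p u) w = Metric M p (from_chart M \<kappa> p v) w"
      using assms(2)[of "to_chart M \<kappa> p w"] \<kappa> p by (simp add: g_eq_Metric)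
  qed
  then show ?thesis using to_from_chart[OF \<kappa> p(1)] by metis
qed

lemma Ck_on_g: "Ck_on k (chart_image \<kappa>) (\<lambda>\<xi>. g \<kappa> \<xi> u w)"
  using riemannian_manifold \<kappa> by (simp add: riemannian_manifold_def smooth_on_def)

lemma g_differentiable: "\<xi> \<in> chart_image \<kappa> \<Longrightarrow> (\<lambda>\<zeta>. g \<kappa> \<zeta> u w) differentiable at \<xi>"
  by (rule Ck_on_differentiable_at[OF Ck_on_g open_chart_image[OF \<kappa>]])

definition Dg :: "'e \<Rightarrow> 'e \<Rightarrow> 'e \<Rightarrow> 'e \<Rightarrow> real" where
  "Dg \<xi> x u w = frechet_derivative (\<lambda>\<zeta>. g \<kappa> \<zeta> u w) (at \<xi>) x"

text \<open>The Koszul formula for fields with constant components, whose brackets vanish: this is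
  what \<open>g\<close> of \<open>\<Gamma> x u\<close> and \<open>w\<close> must be.\<close>

definition koszul :: "'e \<Rightarrow> 'e \<Rightarrow> 'e \<Rightarrow> 'e \<Rightarrow> real" where
  "koszul \<xi> x u w = (Dg \<xi> x u w + Dg \<xi> u x w - Dg \<xi> w x u) / 2"

lemma Ck_on_Dg: "Ck_on k (chart_image \<kappa>) (\<lambda>\<xi>. Dg \<xi> x u w)"
proof -
  have "Ck_on k (chart_image \<kappa>) (\<lambda>\<xi>. frechet_derivative (\<lambda>\<zeta>. g \<kappa> \<zeta> u w) (at \<xi> within chart_image \<kappa>) x)"
    by (rule Ck_on_frechet_derivative[OF Ck_on_g])
  then show ?thesis unfolding Dg_def
    by (subst Ck_on_cong) (auto simp: at_within_open[OF _ open_chart_image[OF \<kappa>]])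
qed

lemma linear_Dg1: "\<xi> \<in> chart_image \<kappa> \<Longrightarrow> linear (\<lambda>x. Dg \<xi> x u w)"
  unfolding Dg_def using g_differentiable frechet_derivative_works has_derivative_linear by (metis eta_contract_eq)

lemma linear_Dg2: "\<xi> \<in> chart_image \<kappa> \<Longrightarrow> linear (\<lambda>u. Dg \<xi> x u w)"
  unfolding Dg_def
  by (rule linear_frechet_derivative_family[OF open_chart_image[OF \<kappa>]])
    (use bilinear_g in \<open>auto simp: bilinear_def intro: g_differentiable\<close>)

lemma Dg_commute: "Dg \<xi> x u w = Dg \<xi> x w u"
  unfolding Dg_def by (subst g_commute) simp

lemma linear_Dg3: "\<xi> \<in> chart_image \<kappa> \<Longrightarrow> linear (Dg \<xi> x u)"
  using linear_Dg2[of \<xi> x u] by (subst (asm) Dg_commute) 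

lemma linear_koszul: "\<xi> \<in> chart_image \<kappa> \<Longrightarrow> linear (koszul \<xi> x u)"
  by (intro linearI) (simp_all add: koszul_def linear_add[OF linear_Dg1] linear_add[OF linear_Dg3]
      linear_cmul[OF linear_Dg1] linear_cmul[OF linear_Dg3] algebra_simps add_divide_distrib diff_divide_distrib)

lemma koszul_add_left: "\<xi> \<in> chart_image \<kappa> \<Longrightarrow> koszul \<xi> (x + y) u w = koszul \<xi> x u w + koszul \<xi> y u w"
  and koszul_scaleR_left: "\<xi> \<in> chart_image \<kappa> \<Longrightarrow> koszul \<xi> (c *\<^sub>R x) u w = c * koszul \<xi> x u w"
  using linear_add[OF linear_Dg1] linear_add[OF linear_Dg2] linear_cmul[OF linear_Dg1] linear_cmul[OF linear_Dg2]
  by (simp_all add: koszul_def algebra_simps add_divide_distrib diff_divide_distrib)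

lemma koszul_commute: "koszul \<xi> x u w = koszul \<xi> u x w"
  by (simp add: koszul_def Dg_commute)

text \<open>Lowering of an index, realised in \<open>'e\<close> through the Euclidean inner product.
  As an injective linear map it can be inverted, which turns equations between forms into linear
  systems.\<close>

definition flat :: "'e \<Rightarrow> 'e \<Rightarrow> 'e" where
  "flat \<xi> v = (\<Sum>b\<in>Basis. g \<kappa> \<xi> v b *\<^sub>R b)"

lemma inner_flat: "\<xi> \<in> chart_image \<kappa> \<Longrightarrow> inner (flat \<xi> v) w = g \<kappa> \<xi> v w"
  unfolding flat_def using bilinear_g[of \<xi>] by (intro linear_inner_basis_sum) (auto simp: bilinear_def)

lemma linear_flat: "\<xi> \<in> chart_image \<kappa> \<Longrightarrow> linear (flat \<xi>)"
  by (intro linearI; rule inner_commute[THEN trans] euclidean_eqI)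
    (simp_all add: inner_flat inner_add_left bilinear_ladd[OF bilinear_g] bilinear_lmul[OF bilinear_g])

lemma inj_flat: "\<xi> \<in> chart_image \<kappa> \<Longrightarrow> inj (flat \<xi>)"
  by (intro injI g_eqI[of \<xi>]) (auto simp: inner_flat[symmetric])

definition levi_civita :: "'e \<Rightarrow> ('e \<Rightarrow> 'e \<Rightarrow> 'e) \<Rightarrow> bool" where
  "levi_civita \<xi> G \<longleftrightarrow> bilinear G \<and> (\<forall>u w. G u w = G w u) \<and>
    (\<forall>x u w. Dg \<xi> x u w = g \<kappa> \<xi> (G x u) w + g \<kappa> \<xi> u (G x w))"

lemma christoffel_eq_The: "\<Gamma> \<kappa> \<xi> = (THE G. levi_civita \<xi> G)"
  by (simp add: christoffel_def levi_civita_def Dg_def)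

text \<open>The three metric conditions in \<open>koszul\<close> give six terms; by symmetry of
  \<open>G\<close> four of them cancel in pairs and the other two are equal.\<close>

lemma levi_civita_koszul:
  assumes "levi_civita \<xi> G"
  shows "g \<kappa> \<xi> (G x u) w = koszul \<xi> x u w"
proof -
  define a where "a x u w = g \<kappa> \<xi> (G x u) w" for x u w
  have D: "Dg \<xi> x u w = a x u w + a x w u" for x u w
    using assms g_commute[of \<xi> u "G x w"] by (simp add: levi_civita_def a_def)
  have sym: "a x u w = a u x w" for x u w using assms by (metis a_def levi_civita_def)
  have "koszul \<xi> x u w = a x u w"
    unfolding koszul_def D using sym[of u x w] sym[of w x u] sym[of w u x] by simp
  then show ?thesis by (simp add: a_def)
qed

text \<open>Justifies the definite description in \<open>christoffel\<close>: nondegeneracy of the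
  metric makes \<open>flat\<close> surjective, so the Koszul form determines a unique
  \<open>G\<close>, whose symmetry and linearity are read off from the form.\<close>

lemma levi_civita_ex1:
  assumes \<xi>: "\<xi> \<in> chart_image \<kappa>"
  shows "\<exists>!G. levi_civita \<xi> G"
proof (rule ex_ex1I)
  have "surj (flat \<xi>)" by (rule linear_inj_imp_surj[OF linear_flat[OF \<xi>] inj_flat[OF \<xi>]])
  define G where "G x u = inv (flat \<xi>) (\<Sum>b\<in>Basis. koszul \<xi> x u b *\<^sub>R b)" for x u
  have G: "flat \<xi> (G x u) = (\<Sum>b\<in>Basis. koszul \<xi> x u b *\<^sub>R b)" for x u
    by (simp only: G_def surj_f_inv_f[OF \<open>surj (flat \<xi>)\<close>])
  have gG: "g \<kappa> \<xi> (G x u) w = koszul \<xi> x u w" for x u w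
    using linear_inner_basis_sum[OF linear_koszul[OF \<xi>]] by (simp add: inner_flat[OF \<xi>, symmetric] G)
  have com: "G x u = G u x" for x u
    by (rule g_eqI[OF \<xi>]) (use koszul_commute gG in auto)
  have lin: "linear (\<lambda>x. G x u)" for u
  proof (rule linearI)
    fix x y show "G (x + y) u = G x u + G y u"
      by (rule g_eqI[OF \<xi>]) (simp add: gG bilinear_ladd[OF bilinear_g[OF \<xi>]] koszul_add_left[OF \<xi>])
    fix c show "G (c *\<^sub>R x) u = c *\<^sub>R G x u"
      by (rule g_eqI[OF \<xi>]) (simp add: gG bilinear_lmul[OF bilinear_g[OF \<xi>]] koszul_scaleR_left[OF \<xi>])
  qed
  moreover have "linear (G u)" for u using lin[of u] by (subst (asm) com)
  ultimately have "bilinear G" by (simp add: bilinear_def)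
  moreover have "Dg \<xi> x u w = g \<kappa> \<xi> (G x u) w + g \<kappa> \<xi> u (G x w)" for x u w
    using Dg_commute[of \<xi> x u w] by (simp add: g_commute[of \<xi> u] gG koszul_def field_simps)
  ultimately show "\<exists>G. levi_civita \<xi> G" using com unfolding levi_civita_def by blast
next
  fix G H assume "levi_civita \<xi> G" "levi_civita \<xi> H"
  then show "G = H" by (intro ext g_eqI[OF \<xi>]) (simp add: levi_civita_koszul)
qed

lemma
  assumes \<xi>: "\<xi> \<in> chart_image \<kappa>"
  shows bilinear_christoffel: "bilinear (\<Gamma> \<kappa> \<xi>)"
    and christoffel_commute: "\<Gamma> \<kappa> \<xi> u w = \<Gamma> \<kappa> \<xi> w u"
    and christoffel_metric: "frechet_derivative (\<lambda>\<zeta>. g \<kappa> \<zeta> u w) (at \<xi>) x = g \<kappa> \<xi> (\<Gamma> \<kappa> \<xi> x u) w + g \<kappa> \<xi> u (\<Gamma> \<kappa> \<xi> x w)"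
    and g_christoffel: "g \<kappa> \<xi> (\<Gamma> \<kappa> \<xi> x u) w = koszul \<xi> x u w"
proof -
  have *: "levi_civita \<xi> (\<Gamma> \<kappa> \<xi>)" unfolding christoffel_eq_The by (rule theI'[OF levi_civita_ex1[OF \<xi>]])
  show "bilinear (\<Gamma> \<kappa> \<xi>)" "\<Gamma> \<kappa> \<xi> u w = \<Gamma> \<kappa> \<xi> w u"
    "frechet_derivative (\<lambda>\<zeta>. g \<kappa> \<zeta> u w) (at \<xi>) x = g \<kappa> \<xi> (\<Gamma> \<kappa> \<xi> x u) w + g \<kappa> \<xi> u (\<Gamma> \<kappa> \<xi> x w)"
    using * unfolding levi_civita_def Dg_def by blast+
  show "g \<kappa> \<xi> (\<Gamma> \<kappa> \<xi> x u) w = koszul \<xi> x u w" by (rule levi_civita_koszul[OF *])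
qed

lemma christoffel_eqI: "\<xi> \<in> chart_image \<kappa> \<Longrightarrow> levi_civita \<xi> G \<Longrightarrow> \<Gamma> \<kappa> \<xi> = G"
  unfolding christoffel_eq_The by (rule the1_equality[OF levi_civita_ex1])

text \<open>\<Gamma> solves a linear system with matrix \<open>flat\<close> and smooth right-hand
  side, so \<open>Ck_on_linear_solve\<close> applies and no inverse matrix has to be
  differentiated.\<close>

lemma Ck_on_christoffel: "Ck_on k (chart_image \<kappa>) (\<lambda>\<xi>. \<Gamma> \<kappa> \<xi> x u)"
proof (rule Ck_on_linear_solve[where H = flat])
  show S: "udiff (chart_image \<kappa>)" by (rule udiff_open[OF open_chart_image[OF \<kappa>]])
  show "linear (flat \<xi>)" "inj (flat \<xi>)" if "\<xi> \<in> chart_image \<kappa>" for \<xi>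
    using linear_flat inj_flat that by auto
  show "Ck_on k (chart_image \<kappa>) (\<lambda>\<xi>. flat \<xi> b)" for b
    unfolding flat_def by (intro Ck_on_sum Ck_on_scaleR Ck_on_g Ck_on_const S)
  show "Ck_on k (chart_image \<kappa>) (\<lambda>\<xi>. \<Sum>b\<in>Basis. ((1/2) *\<^sub>R (Dg \<xi> x u b + Dg \<xi> u x b - Dg \<xi> b x u)) *\<^sub>R b)"
    by (intro Ck_on_sum Ck_on_scaleR Ck_on_Dg Ck_on_const S Ck_on_add Ck_on_diff)
  show "flat \<xi> (\<Gamma> \<kappa> \<xi> x u) = (\<Sum>b\<in>Basis. ((1/2) *\<^sub>R (Dg \<xi> x u b + Dg \<xi> u x b - Dg \<xi> b x u)) *\<^sub>R b)"
    if "\<xi> \<in> chart_image \<kappa>" for \<xi>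
    unfolding flat_def by (simp add: g_christoffel[OF that] koszul_def)
qed

lemma christoffel_differentiable: "\<xi> \<in> chart_image \<kappa> \<Longrightarrow> (\<lambda>\<zeta>. \<Gamma> \<kappa> \<zeta> u w) differentiable at \<xi>"
  by (rule Ck_on_differentiable_at[OF Ck_on_christoffel open_chart_image[OF \<kappa>]])

end

section \<open>Change of charts\<close>

lemma linear_transition_derivative:
  assumes "\<kappa> \<in> Atlas M" "\<mu> \<in> Atlas M" "\<xi> \<in> overlap \<kappa> \<mu>"
  shows "linear (frechet_derivative (transition \<kappa> \<mu>) (at \<xi>))"
  using Ck_on_differentiable_at[OF Ck_on_transition[OF assms(1,2)] open_overlap[OF assms(1,2)] assms(3)]
  unfolding frechet_derivative_works by (rule has_derivative_linear)

lemma transition_derivative_differentiable: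
  assumes "\<kappa> \<in> Atlas M" "\<mu> \<in> Atlas M" "\<xi> \<in> overlap \<kappa> \<mu>"
  shows "(\<lambda>\<zeta>. frechet_derivative (transition \<kappa> \<mu>) (at \<zeta>) v) differentiable at \<xi>"
  by (rule Ck_on_differentiable_at[OF Ck_on_transition_derivative[OF assms(1,2)] open_overlap[OF assms(1,2)] assms(3)])

text \<open>Instead of transforming the Koszul formula, the connection of \<mu> is pulled back to
  \<kappa>. The result \<open>G\<close> is symmetric and metric, and uniqueness identifies it with
  the Christoffel symbols of \<kappa>. Symmetry of \<open>G\<close> rests on the symmetry of the
  second derivative of the transition map.\<close>

lemma christoffel_chart_change:
  assumes \<kappa>: "\<kappa> \<in> Atlas M" and \<mu>: "\<mu> \<in> Atlas M" and p: "p \<in> chart_dom \<kappa>" "p \<in> chart_dom \<mu>"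
  shows "chart_change \<kappa> \<mu> p (\<Gamma> \<kappa> (chart_map \<kappa> p) u w) =
    \<Gamma> \<mu> (chart_map \<mu> p) (chart_change \<kappa> \<mu> p u) (chart_change \<kappa> \<mu> p w)
     + frechet_derivative (\<lambda>\<zeta>. frechet_derivative (transition \<kappa> \<mu>) (at \<zeta>) w) (at (chart_map \<kappa> p)) u"
proof -
  let ?\<phi> = "transition \<kappa> \<mu>" and ?\<xi> = "chart_map \<kappa> p" and ?\<eta> = "chart_map \<mu> p" and ?c = "chart_change \<kappa> \<mu> p"
  let ?D = "\<lambda>\<zeta>. frechet_derivative ?\<phi> (at \<zeta>)"
  define D2 where "D2 u w = frechet_derivative (\<lambda>\<zeta>. ?D \<zeta> w) (at ?\<xi>) u" for u w
  define G where "G u w = chart_change \<mu> \<kappa> p (\<Gamma> \<mu> ?\<eta> (?c u) (?c w) + D2 u w)" for u w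
  note ov = open_overlap[OF \<kappa> \<mu>] and \<xi>ov = overlapI[OF p]
  have \<eta>: "?\<eta> \<in> chart_image \<mu>" and \<xi>: "?\<xi> \<in> chart_image \<kappa>" using p by auto
  have \<phi>\<xi>: "?\<phi> ?\<xi> = ?\<eta>" using p \<kappa> by simp
  have D\<xi>: "?D ?\<xi> = ?c" by (simp add: chart_change_def[abs_def])
  have linc: "linear ?c" by (rule linear_chart_change[OF \<kappa> \<mu> p])
  have lini: "linear (chart_change \<mu> \<kappa> p)" by (rule linear_chart_change[OF \<mu> \<kappa> p(2,1)])
  have D2r: "linear (D2 u)" for u
    unfolding D2_def by (rule linear_frechet_derivative_family[OF ov \<xi>ov linear_transition_derivative[OF \<kappa> \<mu>]
        transition_derivative_differentiable[OF \<kappa> \<mu> \<xi>ov]])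
  have D2l: "linear (\<lambda>u. D2 u w)" for w
    unfolding D2_def using transition_derivative_differentiable[OF \<kappa> \<mu> \<xi>ov, of w]
    unfolding frechet_derivative_works by (rule has_derivative_linear)
  have D2c: "D2 u w = D2 w u" for u w
    unfolding D2_def by (rule second_derivative_symmetric_open[OF Ck_on_transition[OF \<kappa> \<mu>] ov \<xi>ov])
  note bl\<mu> = bilinear_christoffel[OF \<mu> \<eta>]
  have cG: "?c (G u w) = \<Gamma> \<mu> ?\<eta> (?c u) (?c w) + D2 u w" for u w
    by (simp add: G_def chart_change_inverse[OF \<mu> \<kappa> p(2,1)])
  have "\<Gamma> \<kappa> ?\<xi> = G"
  proof (rule christoffel_eqI[OF \<kappa> \<xi>], unfold levi_civita_def[OF \<kappa>] Dg_def[OF \<kappa>], intro conjI allI)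
    show "G u w = G w u" for u w
      unfolding G_def using christoffel_commute[OF \<mu> \<eta>] D2c by metis
    show "bilinear G" unfolding bilinear_def G_def
      by (intro conjI allI linearI)
       (simp_all add: linear_add[OF linc] linear_cmul[OF linc] linear_add[OF D2r] linear_cmul[OF D2r]
          linear_add[OF D2l] linear_cmul[OF D2l] bilinear_ladd[OF bl\<mu>] bilinear_radd[OF bl\<mu>]
          bilinear_lmul[OF bl\<mu>] bilinear_rmul[OF bl\<mu>] linear_add[OF lini] linear_cmul[OF lini] algebra_simps
          flip: scaleR_add_right)
    fix x u w
    \<comment> \<open>The metric condition is checked on the straight line through
      \<open>chart_map \<kappa> p\<close> in direction \<open>x\<close>: there the metric in
      \<kappa> is the metric in \<mu> applied to moving vectors, whose derivatives are the
      \<open>D2\<close> terms.\<close>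
    let ?l = "\<lambda>t. ?\<xi> + t *\<^sub>R x"
    have l: "(?l has_vector_derivative x) (at 0)" by (auto intro!: derivative_eq_intros)
    have dD: "((\<lambda>t. ?D (?l t) v) has_vector_derivative D2 x v) (at 0)" for v
      unfolding D2_def using has_vector_derivative_compose_frechet[OF l, of "\<lambda>\<zeta>. ?D \<zeta> v"]
        transition_derivative_differentiable[OF \<kappa> \<mu> \<xi>ov] by simp
    have d\<phi>: "((\<lambda>t. ?\<phi> (?l t)) has_vector_derivative ?c x) (at 0)"
      using has_vector_derivative_compose_frechet[OF l, of ?\<phi>]
        Ck_on_differentiable_at[OF Ck_on_transition[OF \<kappa> \<mu>] ov \<xi>ov] by (simp add: D\<xi>)
    have "((\<lambda>t. g \<mu> (?\<phi> (?l t)) (?D (?l t) u) (?D (?l t) w)) has_vector_derivative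
        frechet_derivative (\<lambda>\<zeta>. g \<mu> \<zeta> (?D (?l 0) u) (?D (?l 0) w)) (at (?\<phi> (?l 0))) (?c x)
        + g \<mu> (?\<phi> (?l 0)) (D2 x u) (?D (?l 0) w) + g \<mu> (?\<phi> (?l 0)) (?D (?l 0) u) (D2 x w)) (at 0)"
      by (rule has_vector_derivative_bilinear_family[OF open_chart_image[OF \<mu>] _ bilinear_g[OF \<mu>] g_differentiable[OF \<mu>] d\<phi> _ dD dD])
        (use \<eta> \<phi>\<xi> in auto)
    then have *: "((\<lambda>t. g \<mu> (?\<phi> (?l t)) (?D (?l t) u) (?D (?l t) w)) has_vector_derivative
        g \<kappa> ?\<xi> (G x u) w + g \<kappa> ?\<xi> u (G x w)) (at 0)"
      using \<phi>\<xi> by (simp add: D\<xi> christoffel_metric[OF \<mu> \<eta>] g_chart_change[OF \<kappa> \<mu> p, symmetric] cG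
          bilinear_ladd[OF bilinear_g[OF \<mu> \<eta>]] bilinear_radd[OF bilinear_g[OF \<mu> \<eta>]] algebra_simps)
    have "open (?l -` overlap \<kappa> \<mu>)"
      by (intro open_vimage ov continuous_intros)
    then have "((\<lambda>t. g \<kappa> (?l t) u w) has_vector_derivative g \<kappa> ?\<xi> (G x u) w + g \<kappa> ?\<xi> u (G x w)) (at 0)"
    proof (rule has_vector_derivative_transform_within_open[OF *])
      show "0 \<in> ?l -` overlap \<kappa> \<mu>" using \<xi>ov by simp
      fix t assume "t \<in> ?l -` overlap \<kappa> \<mu>"
      then have "?l t \<in> overlap \<kappa> \<mu>" by simp
      from overlapD[OF \<kappa> this] g_chart_change[OF \<kappa> \<mu>, of "chart_inv \<kappa> (?l t)" u w]
      show "g \<mu> (?\<phi> (?l t)) (?D (?l t) u) (?D (?l t) w) = g \<kappa> (?l t) u w"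
        by (simp add: chart_change_def)
    qed
    moreover have "((\<lambda>t. g \<kappa> (?l t) u w) has_vector_derivative frechet_derivative (\<lambda>\<zeta>. g \<kappa> \<zeta> u w) (at ?\<xi>) x) (at 0)"
      using has_vector_derivative_compose_frechet[OF l, of "\<lambda>\<zeta>. g \<kappa> \<zeta> u w"] g_differentiable[OF \<kappa> \<xi>] by simp
    ultimately show "frechet_derivative (\<lambda>\<zeta>. g \<kappa> \<zeta> u w) (at ?\<xi>) x = g \<kappa> ?\<xi> (G x u) w + g \<kappa> ?\<xi> u (G x w)"
      using vector_derivative_unique_at by blast
  qed
  then show ?thesis using cG by (simp add: D2_def)
qed

end

section \<open>Covariant derivatives and parallel transport along curves\<close>

lemma at_within_openin_eq:
  assumes "openin (top_of_set T) S" "x \<in> S"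
  shows "at x within S = at x within T"
proof -
  obtain U where "open U" "S = T \<inter> U" using assms(1) by (auto simp: openin_open)
  then show ?thesis using assms(2) by (intro at_within_nhd[of x U]) auto
qed

lemma has_vector_derivative_Un:
  assumes "(f has_vector_derivative f') (at x within S)" "(f has_vector_derivative f') (at x within T)"
  shows "(f has_vector_derivative f') (at x within (S \<union> T))"
  using assms unfolding has_vector_derivative_def has_derivative_within
  by (auto simp: at_within_union intro: filterlim_sup)

lemma linear_family_bound:
  fixes A :: "'a::topological_space \<Rightarrow> 'b::euclidean_space \<Rightarrow> 'c::real_normed_vector"
  assumes "compact S" "\<And>x. x \<in> S \<Longrightarrow> linear (A x)" "\<And>b. continuous_on S (\<lambda>x. A x b)"
  obtains K where "K > 0" "\<And>x v. x \<in> S \<Longrightarrow> norm (A x v) \<le> K * norm v"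
proof -
  have "\<exists>C. \<forall>x\<in>S. norm (A x b) \<le> C" for b
    using compact_imp_bounded[OF compact_continuous_image[OF assms(3,1), of b]]
    by (auto simp: bounded_iff)
  then obtain C where C: "\<And>b x. x \<in> S \<Longrightarrow> norm (A x b) \<le> C b" by metis
  show ?thesis
  proof (rule that[of "(\<Sum>b\<in>Basis. \<bar>C b\<bar>) + 1"])
    show "0 < (\<Sum>b\<in>Basis. \<bar>C b\<bar>) + 1" by (simp add: add_nonneg_pos sum_nonneg)
    fix x v assume x: "x \<in> S"
    have "norm (A x v) \<le> (\<Sum>b\<in>Basis. norm v * \<bar>C b\<bar>)"
      unfolding linear_basis_sum[OF assms(2)[OF x], of v]
      by (intro sum_norm_le) (auto intro!: mult_mono Basis_le_norm order_trans[OF C[OF x] abs_ge_self])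
    also have "\<dots> \<le> ((\<Sum>b\<in>Basis. \<bar>C b\<bar>) + 1) * norm v"
      by (simp add: sum_distrib_left[symmetric] algebra_simps)
    finally show "norm (A x v) \<le> ((\<Sum>b\<in>Basis. \<bar>C b\<bar>) + 1) * norm v" .
  qed
qed

context riemannian
begin

section \<open>Curves and fields along them in charts\<close>

abbreviation smooth_curve :: "(real \<Rightarrow> 'm) \<Rightarrow> bool" where
  "smooth_curve \<gamma> \<equiv> smooth_map_on M {0..1} \<gamma>"

definition curve_dom :: "('m, 'e) chart \<Rightarrow> (real \<Rightarrow> 'm) \<Rightarrow> real set" where
  "curve_dom \<kappa> \<gamma> = {0..1} \<inter> \<gamma> -` chart_dom \<kappa>"

definition vel :: "('m, 'e) chart \<Rightarrow> (real \<Rightarrow> 'm) \<Rightarrow> real \<Rightarrow> 'e" where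
  "vel \<kappa> \<gamma> t = vector_derivative (\<lambda>\<tau>. chart_map \<kappa> (\<gamma> \<tau>)) (at t within {0..1})"

abbreviation coords :: "('m, 'e) chart \<Rightarrow> (real \<Rightarrow> 'm) \<Rightarrow> (real \<Rightarrow> 'e) \<Rightarrow> real \<Rightarrow> 'e" where
  "coords \<kappa> \<gamma> X \<equiv> \<lambda>t. to_chart M \<kappa> (\<gamma> t) (X t)"

lemma openin_curve_dom:
  assumes "smooth_curve \<gamma>" "\<kappa> \<in> Atlas M"
  shows "openin (top_of_set {0..1}) (curve_dom \<kappa> \<gamma>)"
  using assms unfolding curve_dom_def smooth_map_on_def by (intro continuous_openin_preimage_gen open_chart_dom) auto

lemma udiff_curve_dom: "smooth_curve \<gamma> \<Longrightarrow> \<kappa> \<in> Atlas M \<Longrightarrow> udiff (curve_dom \<kappa> \<gamma>)"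
  using udiff_openin[OF udiff_Icc openin_curve_dom] by simp

lemma Ck_on_curve: "smooth_curve \<gamma> \<Longrightarrow> \<kappa> \<in> Atlas M \<Longrightarrow> Ck_on k (curve_dom \<kappa> \<gamma>) (\<lambda>t. chart_map \<kappa> (\<gamma> t))"
  by (simp add: smooth_map_on_def smooth_on_def curve_dom_def)

lemma at_within_curve_dom:
  "smooth_curve \<gamma> \<Longrightarrow> \<kappa> \<in> Atlas M \<Longrightarrow> t \<in> curve_dom \<kappa> \<gamma> \<Longrightarrow> at t within curve_dom \<kappa> \<gamma> = at t within {0..1}"
  by (rule at_within_openin_eq[OF openin_curve_dom])

lemma curve_nbhd:
  assumes "smooth_curve \<gamma>" "\<kappa> \<in> Atlas M" "t \<in> {0..1}" "\<gamma> t \<in> chart_dom \<kappa>"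
  obtains d where "d > 0" "\<And>\<tau>. \<tau> \<in> {0..1} \<Longrightarrow> dist \<tau> t < d \<Longrightarrow> \<gamma> \<tau> \<in> chart_dom \<kappa>"
proof -
  have "t \<in> curve_dom \<kappa> \<gamma>" using assms by (simp add: curve_dom_def)
  then show ?thesis
    using openin_curve_dom[OF assms(1,2)] that unfolding openin_euclidean_subtopology_iff curve_dom_def by blast
qed

lemma has_vel:
  assumes "smooth_curve \<gamma>" "\<kappa> \<in> Atlas M" "t \<in> {0..1}" "\<gamma> t \<in> chart_dom \<kappa>"
  shows "((\<lambda>\<tau>. chart_map \<kappa> (\<gamma> \<tau>)) has_vector_derivative vel \<kappa> \<gamma> t) (at t within {0..1})"
proof -
  have t: "t \<in> curve_dom \<kappa> \<gamma>" using assms by (simp add: curve_dom_def)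
  have "(\<lambda>\<tau>. chart_map \<kappa> (\<gamma> \<tau>)) differentiable (at t within {0..1})"
    using Ck_on_has_derivative[OF Ck_on_curve[OF assms(1,2)] t] at_within_curve_dom[OF assms(1,2) t]
    by (metis differentiableI)
  then show ?thesis by (simp add: vel_def vector_derivative_works)
qed

lemma at_within_unit_neq_bot: "t \<in> {0..1::real} \<Longrightarrow> at t within {0..1} \<noteq> bot"
  by (auto simp: trivial_limit_within intro!: islimpt_closure_open[where s="{0 <..< 1}"])

lemma vector_derivative_unit:
  "t \<in> {0..1::real} \<Longrightarrow> (f has_vector_derivative f') (at t within {0..1}) \<Longrightarrow> vector_derivative f (at t within {0..1}) = f'"
  by (rule vector_derivative_within[OF at_within_unit_neq_bot])

lemma vel_eqI:
  "t \<in> {0..1} \<Longrightarrow> ((\<lambda>\<tau>. chart_map \<kappa> (\<gamma> \<tau>)) has_vector_derivative u) (at t within {0..1}) \<Longrightarrow> vel \<kappa> \<gamma> t = u"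
  unfolding vel_def by (rule vector_derivative_unit)

lemma vel_chart_change:
  assumes \<gamma>: "smooth_curve \<gamma>" and \<kappa>: "\<kappa> \<in> Atlas M" "\<mu> \<in> Atlas M" and t: "t \<in> {0..1}" "\<gamma> t \<in> chart_dom \<kappa>" "\<gamma> t \<in> chart_dom \<mu>"
  shows "vel \<mu> \<gamma> t = chart_change \<kappa> \<mu> (\<gamma> t) (vel \<kappa> \<gamma> t)"
proof (rule vel_eqI[OF t(1)])
  obtain d where d: "d > 0" "\<And>\<tau>. \<tau> \<in> {0..1} \<Longrightarrow> dist \<tau> t < d \<Longrightarrow> \<gamma> \<tau> \<in> chart_dom \<kappa>"
    using curve_nbhd[OF \<gamma> \<kappa>(1) t(1,2)] by blast
  have "((\<lambda>\<tau>. transition \<kappa> \<mu> (chart_map \<kappa> (\<gamma> \<tau>))) has_vector_derivative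
      frechet_derivative (transition \<kappa> \<mu>) (at (chart_map \<kappa> (\<gamma> t))) (vel \<kappa> \<gamma> t)) (at t within {0..1})"
    by (rule has_vector_derivative_compose_frechet[OF has_vel[OF \<gamma> \<kappa>(1) t(1,2)]
        Ck_on_differentiable_at[OF Ck_on_transition[OF \<kappa>] open_overlap[OF \<kappa>] overlapI[OF t(2,3)]]])
  then show "((\<lambda>\<tau>. chart_map \<mu> (\<gamma> \<tau>)) has_vector_derivative chart_change \<kappa> \<mu> (\<gamma> t) (vel \<kappa> \<gamma> t)) (at t within {0..1})"
    unfolding chart_change_def
    by (rule has_vector_derivative_transform_within[OF _ d(1) t(1)]) (use d \<kappa> in auto)
qed

lemma to_chart_velocity:
  assumes "smooth_curve \<gamma>" "\<kappa> \<in> Atlas M" "t \<in> {0..1}" "\<gamma> t \<in> chart_dom \<kappa>"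
  shows "to_chart M \<kappa> (\<gamma> t) (velocity M \<gamma> t) = vel \<kappa> \<gamma> t"
  using vel_chart_change[OF assms(1) chart_at(1) assms(2,3) chart_at(2) assms(4)]
  by (simp add: to_chart_def velocity_def vel_def)

text \<open>\<open>D\<close> is the covariant derivative of \<open>X\<close> along \<open>\<gamma>\<close> at \<open>t\<close>. The set \<open>S\<close> only restricts the derivative of \<open>X\<close>, which
  allows solutions on adjacent intervals to be glued; one chart is enough by \<open>has_cov_in_chart\<close> below.\<close>

definition has_cov :: "(real \<Rightarrow> 'm) \<Rightarrow> (real \<Rightarrow> 'e) \<Rightarrow> 'e \<Rightarrow> real \<Rightarrow> real set \<Rightarrow> bool" where
  "has_cov \<gamma> X D t S \<longleftrightarrow> (\<exists>\<kappa>\<in>Atlas M. \<gamma> t \<in> chart_dom \<kappa> \<and>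
     (coords \<kappa> \<gamma> X has_vector_derivative
       to_chart M \<kappa> (\<gamma> t) D - \<Gamma> \<kappa> (chart_map \<kappa> (\<gamma> t)) (vel \<kappa> \<gamma> t) (coords \<kappa> \<gamma> X t)) (at t within S))"

lemma has_covI:
  assumes "\<kappa> \<in> Atlas M" "\<gamma> t \<in> chart_dom \<kappa>" "(coords \<kappa> \<gamma> X has_vector_derivative d) (at t within S)"
    and "d = to_chart M \<kappa> (\<gamma> t) D - \<Gamma> \<kappa> (chart_map \<kappa> (\<gamma> t)) (vel \<kappa> \<gamma> t) (coords \<kappa> \<gamma> X t)"
  shows "has_cov \<gamma> X D t S"
  using assms unfolding has_cov_def by blast

text \<open>The product rule for the components after the change of chart yields a second derivative
  of the transition map, which is exactly the inhomogeneous term in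
  \<open>christoffel_chart_change\<close>; the two cancel.\<close>

lemma has_cov_in_chart:
  assumes \<gamma>: "smooth_curve \<gamma>" and t: "t \<in> S" "S \<subseteq> {0..1}" and h: "has_cov \<gamma> X D t S"
    and \<mu>: "\<mu> \<in> Atlas M" "\<gamma> t \<in> chart_dom \<mu>"
  shows "(coords \<mu> \<gamma> X has_vector_derivative
       to_chart M \<mu> (\<gamma> t) D - \<Gamma> \<mu> (chart_map \<mu> (\<gamma> t)) (vel \<mu> \<gamma> t) (coords \<mu> \<gamma> X t)) (at t within S)"
proof -
  obtain \<kappa> where \<kappa>: "\<kappa> \<in> Atlas M" "\<gamma> t \<in> chart_dom \<kappa>" and
    X: "(coords \<kappa> \<gamma> X has_vector_derivative
       to_chart M \<kappa> (\<gamma> t) D - \<Gamma> \<kappa> (chart_map \<kappa> (\<gamma> t)) (vel \<kappa> \<gamma> t) (coords \<kappa> \<gamma> X t)) (at t within S)"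
    using h unfolding has_cov_def by blast
  have t01: "t \<in> {0..1}" using t by auto
  obtain d1 where d1: "d1 > 0" "\<And>\<tau>. \<tau> \<in> {0..1} \<Longrightarrow> dist \<tau> t < d1 \<Longrightarrow> \<gamma> \<tau> \<in> chart_dom \<kappa>"
    using curve_nbhd[OF \<gamma> \<kappa>(1) t01 \<kappa>(2)] by blast
  obtain d2 where d2: "d2 > 0" "\<And>\<tau>. \<tau> \<in> {0..1} \<Longrightarrow> dist \<tau> t < d2 \<Longrightarrow> \<gamma> \<tau> \<in> chart_dom \<mu>"
    using curve_nbhd[OF \<gamma> \<mu>(1) t01 \<mu>(2)] by blast
  let ?D = "\<lambda>\<zeta>. frechet_derivative (transition \<kappa> \<mu>) (at \<zeta>)"
  let ?\<xi> = "\<lambda>\<tau>. chart_map \<kappa> (\<gamma> \<tau>)" and ?c = "chart_change \<kappa> \<mu> (\<gamma> t)"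
  note ov = overlapI[OF \<kappa>(2) \<mu>(2)]
  have linc: "linear ?c" by (rule linear_chart_change[OF \<kappa>(1) \<mu>(1) \<kappa>(2) \<mu>(2)])
  have "((\<lambda>\<tau>. ?D (?\<xi> \<tau>) (coords \<kappa> \<gamma> X \<tau>)) has_vector_derivative
      frechet_derivative (\<lambda>\<zeta>. ?D \<zeta> (coords \<kappa> \<gamma> X t)) (at (?\<xi> t)) (vel \<kappa> \<gamma> t)
      + ?D (?\<xi> t) (to_chart M \<kappa> (\<gamma> t) D - \<Gamma> \<kappa> (?\<xi> t) (vel \<kappa> \<gamma> t) (coords \<kappa> \<gamma> X t))) (at t within S)"
    by (rule has_vector_derivative_linear_family[OF open_overlap[OF \<kappa>(1) \<mu>(1)] ov
         linear_transition_derivative[OF \<kappa>(1) \<mu>(1)] transition_derivative_differentiable[OF \<kappa>(1) \<mu>(1) ov]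
         has_vector_derivative_within_subset[OF has_vel[OF \<gamma> \<kappa>(1) t01 \<kappa>(2)] t(2)] t(1) X])
  also have "?D (?\<xi> t) = ?c" by (simp add: chart_change_def[abs_def])
  also have "frechet_derivative (\<lambda>\<zeta>. ?D \<zeta> (coords \<kappa> \<gamma> X t)) (at (?\<xi> t)) (vel \<kappa> \<gamma> t)
      + ?c (to_chart M \<kappa> (\<gamma> t) D - \<Gamma> \<kappa> (?\<xi> t) (vel \<kappa> \<gamma> t) (coords \<kappa> \<gamma> X t))
      = to_chart M \<mu> (\<gamma> t) D - \<Gamma> \<mu> (chart_map \<mu> (\<gamma> t)) (vel \<mu> \<gamma> t) (coords \<mu> \<gamma> X t)"
    using \<kappa> \<mu> by (simp add: linear_diff[OF linc] christoffel_chart_change chart_change_to_chart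
      vel_chart_change[OF \<gamma> \<kappa>(1) \<mu>(1) t01 \<kappa>(2) \<mu>(2)])
  finally show ?thesis
  proof (rule has_vector_derivative_transform_within[of _ _ _ _ "min d1 d2"])
    fix \<tau> assume \<tau>: "\<tau> \<in> S" "dist \<tau> t < min d1 d2"
    then have "\<gamma> \<tau> \<in> chart_dom \<kappa>" "\<gamma> \<tau> \<in> chart_dom \<mu>" using d1 d2 t by auto
    then show "?D (?\<xi> \<tau>) (coords \<kappa> \<gamma> X \<tau>) = coords \<mu> \<gamma> X \<tau>"
      using chart_change_to_chart[OF \<kappa>(1) \<mu>(1), of "\<gamma> \<tau>" "X \<tau>"] by (simp add: chart_change_def[of \<kappa> \<mu>])
  qed (use d1 d2 t in auto)
qed

lemma has_cov_transform:
  assumes h: "has_cov \<gamma> X D t S" and d: "0 < d" "t \<in> S" "\<And>\<tau>. \<tau> \<in> S \<Longrightarrow> dist \<tau> t < d \<Longrightarrow> X \<tau> = Y \<tau>"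
  shows "has_cov \<gamma> Y D t S"
proof -
  obtain \<kappa> where \<kappa>: "\<kappa> \<in> Atlas M" "\<gamma> t \<in> chart_dom \<kappa>" and
    X: "(coords \<kappa> \<gamma> X has_vector_derivative
       to_chart M \<kappa> (\<gamma> t) D - \<Gamma> \<kappa> (chart_map \<kappa> (\<gamma> t)) (vel \<kappa> \<gamma> t) (coords \<kappa> \<gamma> X t)) (at t within S)"
    using h unfolding has_cov_def by blast
  have "X t = Y t" using d by simp
  with has_vector_derivative_transform_within[OF X d(1,2), of "coords \<kappa> \<gamma> Y"] d(3) \<kappa> show ?thesis
    unfolding has_cov_def by auto
qed

lemma has_cov_Un:
  assumes \<gamma>: "smooth_curve \<gamma>" and t: "t \<in> S" "t \<in> T" "S \<subseteq> {0..1}" "T \<subseteq> {0..1}"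
    and "has_cov \<gamma> X D t S" "has_cov \<gamma> X D t T"
  shows "has_cov \<gamma> X D t (S \<union> T)"
  unfolding has_cov_def
  using has_vector_derivative_Un[OF has_cov_in_chart[OF \<gamma> t(1,3) assms(6) chart_at] has_cov_in_chart[OF \<gamma> t(2,4) assms(7) chart_at]]
    chart_at by blast

context
  fixes \<gamma> and t :: real and S assumes \<gamma>: "smooth_curve \<gamma>" and t: "t \<in> S" and S: "S \<subseteq> {0..1}"
begin

lemma has_cov_add:
  assumes "has_cov \<gamma> X D t S" "has_cov \<gamma> Y E t S" shows "has_cov \<gamma> (\<lambda>\<tau>. X \<tau> + Y \<tau>) (D + E) t S"
proof -
  let ?k = "chart_at M (\<gamma> t)"
  let ?d = "to_chart M ?k (\<gamma> t) (D + E) - \<Gamma> ?k (chart_map ?k (\<gamma> t)) (vel ?k \<gamma> t) (coords ?k \<gamma> (\<lambda>\<tau>. X \<tau> + Y \<tau>) t)"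
  obtain d where d: "d > 0" "\<And>\<tau>. \<tau> \<in> {0..1} \<Longrightarrow> dist \<tau> t < d \<Longrightarrow> \<gamma> \<tau> \<in> chart_dom ?k"
    using curve_nbhd[OF \<gamma> chart_at(1) _ chart_at(2)] t S by blast
  note bl = bilinear_christoffel[OF chart_at(1) chart_map_in_image[OF chart_at(2)]]
  have "((\<lambda>\<tau>. coords ?k \<gamma> X \<tau> + coords ?k \<gamma> Y \<tau>) has_vector_derivative ?d) (at t within S)"
    using has_vector_derivative_add[OF has_cov_in_chart[OF \<gamma> t S assms(1) chart_at] has_cov_in_chart[OF \<gamma> t S assms(2) chart_at]]
    by (simp add: bilinear_radd[OF bl] algebra_simps)
  then have "(coords ?k \<gamma> (\<lambda>\<tau>. X \<tau> + Y \<tau>) has_vector_derivative ?d) (at t within S)"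
    by (rule has_vector_derivative_transform_within[OF _ d(1) t]) (use d S in \<open>auto simp: linear_add[OF linear_to_chart] chart_at\<close>)
  then show ?thesis unfolding has_cov_def using chart_at by blast
qed

lemma has_cov_scaleR:
  assumes "(f has_field_derivative f') (at t within S)" "has_cov \<gamma> X D t S"
  shows "has_cov \<gamma> (\<lambda>\<tau>. f \<tau> *\<^sub>R X \<tau>) (f t *\<^sub>R D + f' *\<^sub>R X t) t S"
proof -
  let ?k = "chart_at M (\<gamma> t)"
  let ?d = "to_chart M ?k (\<gamma> t) (f t *\<^sub>R D + f' *\<^sub>R X t) - \<Gamma> ?k (chart_map ?k (\<gamma> t)) (vel ?k \<gamma> t) (coords ?k \<gamma> (\<lambda>\<tau>. f \<tau> *\<^sub>R X \<tau>) t)"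
  obtain d where d: "d > 0" "\<And>\<tau>. \<tau> \<in> {0..1} \<Longrightarrow> dist \<tau> t < d \<Longrightarrow> \<gamma> \<tau> \<in> chart_dom ?k"
    using curve_nbhd[OF \<gamma> chart_at(1) _ chart_at(2)] t S by blast
  note bl = bilinear_christoffel[OF chart_at(1) chart_map_in_image[OF chart_at(2)]]
  have "((\<lambda>\<tau>. f \<tau> *\<^sub>R coords ?k \<gamma> X \<tau>) has_vector_derivative ?d) (at t within S)"
    using has_vector_derivative_scaleR[OF assms(1) has_cov_in_chart[OF \<gamma> t S assms(2) chart_at]]
    by (simp add: bilinear_rmul[OF bl] algebra_simps)
  then have "(coords ?k \<gamma> (\<lambda>\<tau>. f \<tau> *\<^sub>R X \<tau>) has_vector_derivative ?d) (at t within S)"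
    by (rule has_vector_derivative_transform_within[OF _ d(1) t]) (use d S in \<open>auto simp: linear_cmul[OF linear_to_chart] chart_at\<close>)
  then show ?thesis unfolding has_cov_def using chart_at by blast
qed

text \<open>Metric compatibility: the derivative of the coefficients of \<open>g\<close> is given by
  \<open>christoffel_metric\<close> and cancels the \<Gamma> terms in the coordinate derivatives of
  \<open>V\<close> and \<open>W\<close>.\<close>

lemma has_cov_Metric:
  assumes "has_cov \<gamma> V D t S" "has_cov \<gamma> W E t S"
  shows "((\<lambda>\<tau>. Metric M (\<gamma> \<tau>) (V \<tau>) (W \<tau>)) has_vector_derivative
     (Metric M (\<gamma> t) D (W t) + Metric M (\<gamma> t) (V t) E)) (at t within S)"
proof -
  let ?k = "chart_at M (\<gamma> t)"
  obtain d where d: "d > 0" "\<And>\<tau>. \<tau> \<in> {0..1} \<Longrightarrow> dist \<tau> t < d \<Longrightarrow> \<gamma> \<tau> \<in> chart_dom ?k"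
    using curve_nbhd[OF \<gamma> chart_at(1) _ chart_at(2)] t S by blast
  have t01: "t \<in> {0..1}" using t S by auto
  let ?x = "\<lambda>\<tau>. chart_map ?k (\<gamma> \<tau>)" and ?V = "coords ?k \<gamma> V" and ?W = "coords ?k \<gamma> W" and ?u = "vel ?k \<gamma> t"
  note im = chart_map_in_image[OF chart_at(2)[of "\<gamma> t"]]
  note bl = bilinear_g[OF chart_at(1) im]
  have "((\<lambda>\<tau>. g ?k (?x \<tau>) (?V \<tau>) (?W \<tau>)) has_vector_derivative
      frechet_derivative (\<lambda>\<zeta>. g ?k \<zeta> (?V t) (?W t)) (at (?x t)) ?u
      + g ?k (?x t) (to_chart M ?k (\<gamma> t) D - \<Gamma> ?k (?x t) ?u (?V t)) (?W t)
      + g ?k (?x t) (?V t) (to_chart M ?k (\<gamma> t) E - \<Gamma> ?k (?x t) ?u (?W t))) (at t within S)"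
    by (rule has_vector_derivative_bilinear_family[OF open_chart_image[OF chart_at(1)] im bilinear_g[OF chart_at(1)]
        g_differentiable[OF chart_at(1) im] has_vector_derivative_within_subset[OF has_vel[OF \<gamma> chart_at(1) t01 chart_at(2)] S] t
        has_cov_in_chart[OF \<gamma> t S assms(1) chart_at] has_cov_in_chart[OF \<gamma> t S assms(2) chart_at]])
  then have "((\<lambda>\<tau>. g ?k (?x \<tau>) (?V \<tau>) (?W \<tau>)) has_vector_derivative
      (Metric M (\<gamma> t) D (W t) + Metric M (\<gamma> t) (V t) E)) (at t within S)"
    using Metric_eq_g[OF chart_at(1) chart_at(2), of "\<gamma> t"]
    by (simp add: christoffel_metric[OF chart_at(1) im] bilinear_lsub[OF bl] bilinear_rsub[OF bl])
  then show ?thesis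
  proof (rule has_vector_derivative_transform_within[OF _ d(1) t])
    fix \<tau> assume "\<tau> \<in> S" "dist \<tau> t < d"
    then have "\<gamma> \<tau> \<in> chart_dom ?k" using d S by blast
    from Metric_eq_g[OF chart_at(1) this, of "V \<tau>" "W \<tau>"]
    show "g ?k (?x \<tau>) (?V \<tau>) (?W \<tau>) = Metric M (\<gamma> \<tau>) (V \<tau>) (W \<tau>)" by simp
  qed
qed

end

lemma has_cov_cov_deriv:
  assumes "smooth_curve \<gamma>" "t \<in> {0..1}" "has_cov \<gamma> X D t {0..1}"
  shows "cov_deriv M \<gamma> X t = D"
  using vector_derivative_unit[OF assms(2) has_cov_in_chart[OF assms(1,2) subset_refl assms(3) chart_at]]
  by (simp add: cov_deriv_def velocity_def vel_def)

section \<open>Parallel fields along a curve\<close>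

definition parallel :: "(real \<Rightarrow> 'm) \<Rightarrow> (real \<Rightarrow> 'e) \<Rightarrow> bool" where
  "parallel \<gamma> X \<longleftrightarrow> (\<forall>t\<in>{0..1}. has_cov \<gamma> X 0 t {0..1})"

lemma Ck_on_vel:
  assumes "smooth_curve \<gamma>" "\<kappa> \<in> Atlas M" shows "Ck_on k (curve_dom \<kappa> \<gamma>) (vel \<kappa> \<gamma>)"
proof -
  have "Ck_on k (curve_dom \<kappa> \<gamma>) (\<lambda>t. frechet_derivative (\<lambda>t. chart_map \<kappa> (\<gamma> t)) (at t within curve_dom \<kappa> \<gamma>) 1)"
    by (rule Ck_on_frechet_derivative[OF Ck_on_curve[OF assms]])
  moreover have "frechet_derivative (\<lambda>t. chart_map \<kappa> (\<gamma> t)) (at t within curve_dom \<kappa> \<gamma>) 1 = vel \<kappa> \<gamma> t"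
    if t: "t \<in> curve_dom \<kappa> \<gamma>" for t
  proof -
    have "((\<lambda>t. chart_map \<kappa> (\<gamma> t)) has_derivative (\<lambda>h. h *\<^sub>R vel \<kappa> \<gamma> t)) (at t within curve_dom \<kappa> \<gamma>)"
      using has_vel[OF assms, of t] t at_within_curve_dom[OF assms t]
      by (auto simp: has_vector_derivative_def curve_dom_def)
    from udiff_frechet_derivative[OF udiff_curve_dom[OF assms] t this] show ?thesis by simp
  qed
  ultimately show ?thesis by (subst Ck_on_cong[symmetric]) auto
qed

lemma Ck_on_christoffel_curve:
  assumes "smooth_curve \<gamma>" "\<kappa> \<in> Atlas M" "Ck_on k (curve_dom \<kappa> \<gamma>) X"
  shows "Ck_on k (curve_dom \<kappa> \<gamma>) (\<lambda>t. - \<Gamma> \<kappa> (chart_map \<kappa> (\<gamma> t)) (vel \<kappa> \<gamma> t) (X t))"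
proof -
  have "(\<lambda>t. chart_map \<kappa> (\<gamma> t)) ` curve_dom \<kappa> \<gamma> \<subseteq> chart_image \<kappa>" by (auto simp: curve_dom_def)
  then have B: "Ck_on k (curve_dom \<kappa> \<gamma>) (\<lambda>t. \<Gamma> \<kappa> (chart_map \<kappa> (\<gamma> t)) b c)" for b c
    by (rule Ck_on_compose[OF udiff_curve_dom[OF assms(1,2)] _ Ck_on_christoffel[OF assms(2)] Ck_on_curve[OF assms(1,2)]])
  have "Ck_on k (curve_dom \<kappa> \<gamma>) (\<lambda>t. \<Gamma> \<kappa> (chart_map \<kappa> (\<gamma> t)) (vel \<kappa> \<gamma> t) (X t))"
    by (rule Ck_on_bilinear_family[where B = "\<lambda>t. \<Gamma> \<kappa> (chart_map \<kappa> (\<gamma> t))",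
        OF udiff_curve_dom[OF assms(1,2)] bilinear_christoffel[OF assms(2)] B Ck_on_vel[OF assms(1,2)] assms(3)])
      (auto simp: curve_dom_def)
  then show ?thesis by (rule Ck_on_uminus[OF udiff_curve_dom[OF assms(1,2)]])
qed

text \<open>\<open>parallel\<close> asks for one derivative only; smoothness is a bootstrap, since
  the equation expresses the derivative of the components through the components themselves and
  smooth coefficients.\<close>

lemma parallel_along_iff:
  assumes \<gamma>: "smooth_curve \<gamma>"
  shows "parallel_along M \<gamma> X \<longleftrightarrow> parallel \<gamma> X"
proof
  assume "parallel_along M \<gamma> X"
  then have sm: "smooth_field_along M {0..1} \<gamma> X" and z: "\<And>t. t \<in> {0..1} \<Longrightarrow> cov_deriv M \<gamma> X t = 0"
    by (auto simp: parallel_along_def)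
  show "parallel \<gamma> X" unfolding parallel_def
  proof
    fix t :: real assume t: "t \<in> {0..1}"
    let ?k = "chart_at M (\<gamma> t)"
    have td: "t \<in> curve_dom ?k \<gamma>" using t chart_at by (simp add: curve_dom_def)
    have "Ck_on (Suc 0) (curve_dom ?k \<gamma>) (coords ?k \<gamma> X)"
      using sm chart_at(1) unfolding smooth_field_along_def smooth_on_def curve_dom_def by blast
    from Ck_on_has_derivative[OF this td] have "coords ?k \<gamma> X differentiable (at t within {0..1})"
      unfolding at_within_curve_dom[OF \<gamma> chart_at(1) td] by (rule differentiableI)
    then have "(coords ?k \<gamma> X has_vector_derivative vector_derivative (coords ?k \<gamma> X) (at t within {0..1})) (at t within {0..1})"
      by (simp add: vector_derivative_works)
    moreover have "vector_derivative (coords ?k \<gamma> X) (at t within {0..1}) = 0 - \<Gamma> ?k (chart_map ?k (\<gamma> t)) (vel ?k \<gamma> t) (coords ?k \<gamma> X t)"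
      using z[OF t] by (simp add: cov_deriv_def velocity_def vel_def Let_def eq_neg_iff_add_eq_0)
    ultimately show "has_cov \<gamma> X 0 t {0..1}" unfolding has_cov_def using chart_at by (auto intro!: bexI[of _ ?k])
  qed
next
  assume p: "parallel \<gamma> X"
  have "Ck_on k (curve_dom \<kappa> \<gamma>) (coords \<kappa> \<gamma> X)" if \<kappa>: "\<kappa> \<in> Atlas M" for k \<kappa>
  proof -
    have d: "(coords \<kappa> \<gamma> X has_vector_derivative - \<Gamma> \<kappa> (chart_map \<kappa> (\<gamma> t)) (vel \<kappa> \<gamma> t) (coords \<kappa> \<gamma> X t)) (at t within curve_dom \<kappa> \<gamma>)"
      if t: "t \<in> curve_dom \<kappa> \<gamma>" for t
      using has_cov_in_chart[OF \<gamma> _ subset_refl _ \<kappa>, of t X 0] p t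
      unfolding at_within_curve_dom[OF \<gamma> \<kappa> t] by (auto simp: parallel_def curve_dom_def linear_0[OF linear_to_chart[OF \<kappa>]])
    show ?thesis
    proof (induction k)
      case 0
      show ?case using d by (auto simp: continuous_on_eq_continuous_within intro: has_vector_derivative_continuous)
    next
      case (Suc k)
      show ?case
      proof (rule Ck_on_SucI[OF udiff_curve_dom[OF \<gamma> \<kappa>]])
        show "(coords \<kappa> \<gamma> X has_derivative (\<lambda>h. h *\<^sub>R - \<Gamma> \<kappa> (chart_map \<kappa> (\<gamma> t)) (vel \<kappa> \<gamma> t) (coords \<kappa> \<gamma> X t)))
            (at t within curve_dom \<kappa> \<gamma>)" if "t \<in> curve_dom \<kappa> \<gamma>" for t
          using d[OF that] by (simp add: has_vector_derivative_def)
        show "Ck_on k (curve_dom \<kappa> \<gamma>) (\<lambda>t. h *\<^sub>R - \<Gamma> \<kappa> (chart_map \<kappa> (\<gamma> t)) (vel \<kappa> \<gamma> t) (coords \<kappa> \<gamma> X t))" for h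
          by (intro Ck_on_scaleR Ck_on_const udiff_curve_dom[OF \<gamma> \<kappa>] Ck_on_christoffel_curve[OF \<gamma> \<kappa> Suc])
      qed
    qed
  qed
  then show "parallel_along M \<gamma> X"
    using has_cov_cov_deriv[OF \<gamma>] p
    by (simp add: parallel_along_def smooth_field_along_def smooth_on_def parallel_def curve_dom_def)
qed

lemma parallel_Metric_const:
  assumes \<gamma>: "smooth_curve \<gamma>" and "parallel \<gamma> X" "parallel \<gamma> Y" and t: "t \<in> {0..1}" "t' \<in> {0..1}"
  shows "Metric M (\<gamma> t) (X t) (Y t) = Metric M (\<gamma> t') (X t') (Y t')"
proof -
  have "((\<lambda>\<tau>. Metric M (\<gamma> \<tau>) (X \<tau>) (Y \<tau>)) has_vector_derivative 0) (at \<tau> within {0..1})" if "\<tau> \<in> {0..1}" for \<tau>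
    using has_cov_Metric[OF \<gamma> that subset_refl, of X 0 Y 0] assms(2,3) that
    by (simp add: parallel_def bilinear_lzero[OF bilinear_Metric] bilinear_rzero[OF bilinear_Metric])
  then obtain c where "\<And>\<tau>. \<tau> \<in> {0..1} \<Longrightarrow> Metric M (\<gamma> \<tau>) (X \<tau>) (Y \<tau>) = c"
    using has_vector_derivative_zero_constant[of "{0..1}"] by blast
  then show ?thesis using t by simp
qed

lemma parallel_add: "smooth_curve \<gamma> \<Longrightarrow> parallel \<gamma> X \<Longrightarrow> parallel \<gamma> Y \<Longrightarrow> parallel \<gamma> (\<lambda>t. X t + Y t)"
  unfolding parallel_def using has_cov_add[where D = 0 and E = 0] by auto

lemma parallel_scaleR: "smooth_curve \<gamma> \<Longrightarrow> parallel \<gamma> X \<Longrightarrow> parallel \<gamma> (\<lambda>t. r *\<^sub>R X t)"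
  unfolding parallel_def using has_cov_scaleR[where f = "\<lambda>_. r" and f' = 0 and D = 0] by auto

text \<open>The difference is again parallel, so its norm is constant along \<gamma> and therefore
  zero; this replaces an estimate for the differential equation.\<close>

lemma parallel_unique:
  assumes \<gamma>: "smooth_curve \<gamma>" and X: "parallel \<gamma> X" "parallel \<gamma> Y" and t: "t \<in> {0..1}" "t' \<in> {0..1}" and eq: "X t = Y t"
  shows "X t' = Y t'"
proof -
  have "parallel \<gamma> (\<lambda>t. X t + (-1) *\<^sub>R Y t)" by (intro parallel_add parallel_scaleR \<gamma> X)
  from parallel_Metric_const[OF \<gamma> this this t] eq
  have "Metric M (\<gamma> t') (X t' + (-1) *\<^sub>R Y t') (X t' + (-1) *\<^sub>R Y t') = 0"
    by (simp add: bilinear_lzero[OF bilinear_Metric])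
  then show ?thesis unfolding Metric_eq_0 by simp
qed

text \<open>Only \<open>b\<close> needs care: there both pieces have the same value, so the equation
  forces equal one-sided derivatives, and these combine to a derivative on the union.\<close>

lemma has_cov_zero_glue:
  assumes \<gamma>: "smooth_curve \<gamma>" and ab: "0 \<le> a" "a < b" "b < c" "c \<le> 1"
    and X: "\<And>t. t \<in> {a..b} \<Longrightarrow> has_cov \<gamma> X 0 t {a..b}" and Y: "\<And>t. t \<in> {b..c} \<Longrightarrow> has_cov \<gamma> Y 0 t {b..c}"
    and eq: "X b = Y b" and t: "t \<in> {a..c}"
  shows "has_cov \<gamma> (\<lambda>t. if t \<le> b then X t else Y t) 0 t {a..c}"
proof -
  let ?Z = "\<lambda>t. if t \<le> b then X t else Y t"
  have ZX: "has_cov \<gamma> ?Z 0 t {a..b}" if "t \<in> {a..b}" for t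
    by (rule has_cov_transform[OF X[OF that] zero_less_one that]) auto
  have ZY: "has_cov \<gamma> ?Z 0 t {b..c}" if "t \<in> {b..c}" for t
    by (rule has_cov_transform[OF Y[OF that] zero_less_one that]) (use eq in \<open>auto simp: not_le\<close>)
  have un: "{a..c} = {a..b} \<union> {b..c}" using ab by auto
  consider "t < b" | "t = b" | "t > b" by linarith
  then show ?thesis
  proof cases
    case 1
    have "at t within {a..c} = at t within {a..b}"
      by (rule at_within_nhd[of t "{..<b}"]) (use 1 ab in auto)
    then show ?thesis using ZX[of t] 1 t by (simp add: has_cov_def)
  next
    case 2
    then show ?thesis unfolding un using ab by (intro has_cov_Un \<gamma> ZX ZY) auto
  next
    case 3
    have "at t within {a..c} = at t within {b..c}"
      by (rule at_within_nhd[of t "{b<..}"]) (use 3 ab in auto)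
    then show ?thesis using ZY[of t] 3 t by (simp add: has_cov_def)
  qed
qed

text \<open>Bisection: solvability on \<open>[a, b]\<close> for every initial vector at
  \<open>a\<close> passes to unions of adjacent intervals, and on short intervals around any point
  it follows from \<open>linear_ode_short\<close> in a single chart.\<close>

lemma parallel_exists_from_0:
  assumes \<gamma>: "smooth_curve \<gamma>"
  shows "\<exists>X. parallel \<gamma> X \<and> X 0 = w"
proof -
  define P where "P a b \<longleftrightarrow> (0 \<le> a \<and> a < b \<and> b \<le> 1 \<longrightarrow>
    (\<forall>w. \<exists>X. X a = w \<and> (\<forall>t\<in>{a..b}. has_cov \<gamma> X 0 t {a..b})))" for a b
  have "P 0 1"
  proof (rule Bolzano)
    fix a b c :: real assume P: "P a b" "P b c" and ab: "a \<le> b" "b \<le> c"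
    show "P a c"
    proof (cases "a = b \<or> b = c")
      case True then show ?thesis using P by auto
    next
      case False
      with ab have ab': "a < b" "b < c" by auto
      show ?thesis unfolding P_def
      proof (intro impI allI)
        fix w assume ac: "0 \<le> a \<and> a < c \<and> c \<le> 1"
        then obtain X where X: "X a = w" "\<And>t. t \<in> {a..b} \<Longrightarrow> has_cov \<gamma> X 0 t {a..b}"
          using P(1) ab' unfolding P_def by force
        obtain Y where Y: "Y b = X b" "\<And>t. t \<in> {b..c} \<Longrightarrow> has_cov \<gamma> Y 0 t {b..c}"
          using P(2) ab' ac unfolding P_def by force
        let ?Z = "\<lambda>t. if t \<le> b then X t else Y t"
        have "\<forall>t\<in>{a..c}. has_cov \<gamma> ?Z 0 t {a..c}"
          using has_cov_zero_glue[OF \<gamma> _ ab' _ X(2) Y(2)] Y(1) ac by auto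
        then show "\<exists>X. X a = w \<and> (\<forall>t\<in>{a..c}. has_cov \<gamma> X 0 t {a..c})"
          using X(1) ab by (intro exI[of _ ?Z]) auto
      qed
    qed
  next
    fix x :: real assume x: "0 \<le> x" "x \<le> 1"
    let ?k = "chart_at M (\<gamma> x)"
    obtain d1 where d1: "d1 > 0" "\<And>\<tau>. \<tau> \<in> {0..1} \<Longrightarrow> dist \<tau> x < d1 \<Longrightarrow> \<gamma> \<tau> \<in> chart_dom ?k"
      using curve_nbhd[OF \<gamma> chart_at(1) _ chart_at(2)] x by (metis atLeastAtMost_iff)
    let ?A = "\<lambda>t v. - \<Gamma> ?k (chart_map ?k (\<gamma> t)) (vel ?k \<gamma> t) v"
    \<comment> \<open>Half the radius gives a compact neighbourhood inside the chart, on which the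
      coefficients are bounded.\<close>
    let ?C = "{0..1} \<inter> cball x (d1/2)"
    have sub: "?C \<subseteq> curve_dom ?k \<gamma>" using d1 by (auto simp: curve_dom_def dist_commute)
    have cA: "continuous_on ?C (\<lambda>t. ?A t b)" for b
      by (rule continuous_on_subset[OF Ck_on_imp_continuous_on[OF Ck_on_christoffel_curve[OF \<gamma> chart_at(1)
         Ck_on_const[OF udiff_curve_dom[OF \<gamma> chart_at(1)]], where k=0]] sub])
    have lA: "linear (?A t)" if "t \<in> ?C" for t
      using bilinear_christoffel[OF chart_at(1), of "chart_map ?k (\<gamma> t)" "\<gamma> x"] sub that
      by (auto simp: bilinear_def curve_dom_def intro!: linear_compose_neg)
    obtain K where K: "K > 0" "\<And>t v. t \<in> ?C \<Longrightarrow> norm (?A t v) \<le> K * norm v"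
      using linear_family_bound[of ?C ?A, OF _ lA cA] by auto
    show "\<exists>d>0. \<forall>a b. a \<le> x \<and> x \<le> b \<and> b - a < d \<longrightarrow> P a b"
    \<comment> \<open>The first bound keeps \<open>[a, b]\<close> in that neighbourhood, the second
      is the shortness condition of \<open>linear_ode_short\<close>.\<close>
    proof (intro exI[of _ "min (d1/2) (1/(2*K))"] conjI allI impI)
      show "0 < min (d1/2) (1/(2*K))" using d1 K by simp
      fix a b assume ab: "a \<le> x \<and> x \<le> b \<and> b - a < min (d1/2) (1/(2*K))"
      show "P a b" unfolding P_def
      proof (intro impI allI)
        fix w assume ab': "0 \<le> a \<and> a < b \<and> b \<le> 1"
        have abC: "{a..b} \<subseteq> ?C" using ab ab' by (auto simp: dist_real_def abs_if)
        have short: "K * (b - a) \<le> 1/2" using ab K by (simp add: field_simps)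
        obtain z where z: "z a = to_chart M ?k (\<gamma> a) w"
          "\<And>t. t \<in> {a..b} \<Longrightarrow> (z has_vector_derivative ?A t (z t) + 0) (at t within {a..b})"
        proof (rule linear_ode_short[of a b ?A "\<lambda>_. 0" K "to_chart M ?k (\<gamma> a) w"])
          show "a \<le> b" "0 \<le> K" "K * (b - a) \<le> 1/2" using ab' K short by auto
          show "linear (?A t)" "norm (?A t v) \<le> K * norm v" if "t \<in> {a..b}" for t v
            using lA K(2) abC that by blast+
          show "continuous_on {a..b} (\<lambda>t. ?A t v)" for v by (rule continuous_on_subset[OF cA abC])
        qed auto
        have dom: "\<gamma> t \<in> chart_dom ?k" if "t \<in> {a..b}" for t
        proof -
          have "t \<in> curve_dom ?k \<gamma>" using that abC sub by blast
          then show ?thesis by (simp add: curve_dom_def)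
        qed
        define X where "X t = from_chart M ?k (\<gamma> t) (z t)" for t
        have Xz: "coords ?k \<gamma> X t = z t" if "t \<in> {a..b}" for t
          using dom[OF that] chart_at(1) by (simp add: X_def)
        have "has_cov \<gamma> X 0 t {a..b}" if t: "t \<in> {a..b}" for t
        proof -
          have "(coords ?k \<gamma> X has_vector_derivative ?A t (coords ?k \<gamma> X t)) (at t within {a..b})"
            using has_vector_derivative_transform[OF t Xz z(2)[OF t]] Xz[OF t] by simp
          then show ?thesis unfolding has_cov_def using chart_at(1) dom[OF t]
            by (intro bexI[of _ ?k]) (auto simp: linear_0[OF linear_to_chart])
        qed
        moreover have "X a = w" using z(1) dom[of a] ab' chart_at(1) by (simp add: X_def)
        ultimately show "\<exists>X. X a = w \<and> (\<forall>t\<in>{a..b}. has_cov \<gamma> X 0 t {a..b})" by blast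
      qed
    qed
  qed simp
  then show ?thesis unfolding P_def parallel_def by auto
qed

text \<open>Passes from the initial time 0 to any \<open>t\<close> without solving backwards: the
  solution map is linear, and injective by \<open>parallel_unique\<close>, hence surjective in
  finite dimension.\<close>

lemma parallel_exists:
  assumes \<gamma>: "smooth_curve \<gamma>" and t: "t \<in> {0..1}"
  shows "\<exists>X. parallel \<gamma> X \<and> X t = w"
proof -
  obtain F where F: "\<And>w. parallel \<gamma> (F w)" "\<And>w. F w 0 = w" using parallel_exists_from_0[OF \<gamma>] by metis
  have 0: "(0::real) \<in> {0..1}" by simp
  have "linear (\<lambda>w. F w t)"
  proof (rule linearI)
    fix u v show "F (u + v) t = F u t + F v t"
      by (rule parallel_unique[OF \<gamma> F(1) parallel_add[OF \<gamma> F(1) F(1)] 0 t]) (simp add: F)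
    fix r show "F (r *\<^sub>R u) t = r *\<^sub>R F u t"
      by (rule parallel_unique[OF \<gamma> F(1) parallel_scaleR[OF \<gamma> F(1)] 0 t]) (simp add: F)
  qed
  moreover have "inj (\<lambda>w. F w t)"
  proof (rule injI)
    fix u v assume "F u t = F v t"
    from parallel_unique[OF \<gamma> F(1) F(1) t 0 this] show "u = v" by (simp add: F)
  qed
  ultimately have "surj (\<lambda>w. F w t)" by (rule linear_inj_imp_surj)
  then obtain v where "F v t = w" by (metis surjD)
  then show ?thesis using F(1) by blast
qed

section \<open>Parallel transport\<close>

abbreviation PT where "PT \<equiv> parallel_transport M"

context
  fixes \<gamma> assumes \<gamma>: "smooth_curve \<gamma>"
begin

text \<open>Evaluates the definite description in \<open>parallel_transport\<close> on any parallel
  field at hand; \<open>parallel_unique\<close> excludes a second value.\<close>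

lemma parallel_transport_eq:
  assumes "parallel \<gamma> X" "t \<in> {0..1}" "t' \<in> {0..1}"
  shows "PT \<gamma> t t' (X t) = X t'"
  unfolding parallel_transport_def parallel_along_iff[OF \<gamma>]
proof (rule the_equality)
  show "\<exists>Y. parallel \<gamma> Y \<and> Y t = X t \<and> Y t' = X t'" using assms(1) by blast
  show "u = X t'" if "\<exists>Y. parallel \<gamma> Y \<and> Y t = X t \<and> Y t' = u" for u
    using that parallel_unique[OF \<gamma> _ assms] by blast
qed

lemma parallel_transport_parallel:
  assumes t: "t \<in> {0..1}"
  shows "parallel \<gamma> (\<lambda>\<tau>. PT \<gamma> t \<tau> w)"
proof -
  obtain X where X: "parallel \<gamma> X" "X t = w" using parallel_exists[OF \<gamma> t] by blast
  show ?thesis unfolding parallel_def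
  proof
    fix \<tau> :: real assume \<tau>: "\<tau> \<in> {0..1}"
    have eq: "X \<sigma> = PT \<gamma> t \<sigma> w" if "\<sigma> \<in> {0..1}" for \<sigma>
      using parallel_transport_eq[OF X(1) t that] X(2) by simp
    have h: "has_cov \<gamma> X 0 \<tau> {0..1}" using X(1) \<tau> by (simp add: parallel_def)
    show "has_cov \<gamma> (\<lambda>\<tau>. PT \<gamma> t \<tau> w) 0 \<tau> {0..1}"
      by (rule has_cov_transform[OF h zero_less_one \<tau> eq])
  qed
qed

lemma parallel_transport_self:
  assumes t: "t \<in> {0..1}" shows "PT \<gamma> t t w = w"
proof -
  obtain X where X: "parallel \<gamma> X" "X t = w" using parallel_exists[OF \<gamma> t] by blast
  show ?thesis using parallel_transport_eq[OF X(1) t t] by (simp only: X(2))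
qed

lemma parallel_transport_compose:
  assumes "t1 \<in> {0..1}" "t2 \<in> {0..1}" "t3 \<in> {0..1}"
  shows "PT \<gamma> t2 t3 (PT \<gamma> t1 t2 w) = PT \<gamma> t1 t3 w"
  using parallel_transport_eq[OF parallel_transport_parallel[OF assms(1)] assms(2,3)] .

lemma parallel_transport_isometry:
  assumes "t \<in> {0..1}" "t' \<in> {0..1}"
  shows "Metric M (\<gamma> t') (PT \<gamma> t t' u) (PT \<gamma> t t' w) = Metric M (\<gamma> t) u w"
  using parallel_Metric_const[OF \<gamma> parallel_transport_parallel[OF assms(1)] parallel_transport_parallel[OF assms(1)] assms(2,1)]
  by (simp add: parallel_transport_self[OF assms(1)])

lemma parallel_transport_adjoint:
  assumes "t \<in> {0..1}" "t' \<in> {0..1}"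
  shows "Metric M (\<gamma> t') (PT \<gamma> t t' u) w = Metric M (\<gamma> t) u (PT \<gamma> t' t w)"
  using parallel_transport_isometry[OF assms, of u "PT \<gamma> t' t w"]
  by (simp only: parallel_transport_compose[OF assms(2,1,2)] parallel_transport_self[OF assms(2)])

lemma has_cov_parallel_transport:
  "t \<in> {0..1} \<Longrightarrow> \<tau> \<in> {0..1} \<Longrightarrow> has_cov \<gamma> (\<lambda>\<tau>. PT \<gamma> t \<tau> w) 0 \<tau> {0..1}"
  using parallel_transport_parallel by (simp add: parallel_def)

end

text \<open>The pairings with the basis vectors make up the image under the injective linear map
  \<open>flat\<close>; a left inverse recovers the vector and its derivative.\<close>

lemma has_vector_derivative_MetricI:
  assumes "\<And>e. ((\<lambda>\<tau>. Metric M p (f \<tau>) e) has_vector_derivative Metric M p f' e) (at t within S)"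
  shows "(f has_vector_derivative f') (at t within S)"
proof -
  let ?k = "chart_at M p"
  have m: "Metric M p u w = g ?k (chart_map ?k p) u w" for u w
    using Metric_eq_g[OF chart_at, of p u w] by simp
  note im = chart_map_in_image[OF chart_at(2)[of p]]
  let ?F = "flat ?k (chart_map ?k p)"
  have lin: "linear ?F" and inj: "inj ?F" using linear_flat inj_flat chart_at im by auto
  obtain L where L: "linear L" "\<And>v. L (?F v) = v"
    using linear_injective_left_inverse[OF lin inj] by (metis comp_apply id_apply)
  have "((\<lambda>\<tau>. \<Sum>b\<in>Basis. Metric M p (f \<tau>) b *\<^sub>R b) has_vector_derivative (\<Sum>b\<in>Basis. Metric M p f' b *\<^sub>R b)) (at t within S)"
    by (intro has_vector_derivative_sum bounded_linear.has_vector_derivative[OF bounded_linear_scaleR_left] assms)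
  then have "((\<lambda>\<tau>. ?F (f \<tau>)) has_vector_derivative ?F f') (at t within S)"
    by (simp add: flat_def[OF chart_at(1)] m)
  from bounded_linear.has_vector_derivative[OF linear_conv_bounded_linear[THEN iffD1, OF L(1)] this]
  show ?thesis by (simp add: L)
qed

text \<open>By adjointness the transport is moved onto the test vector, where it gives a parallel
  field; the metric product rule then leaves only the term with \<open>D\<close>.\<close>

lemma has_vector_derivative_parallel_transport:
  assumes \<gamma>: "smooth_curve \<gamma>" and t: "t \<in> {0..1}" "t0 \<in> {0..1}" and V: "has_cov \<gamma> V D t {0..1}"
  shows "((\<lambda>\<tau>. PT \<gamma> \<tau> t0 (V \<tau>)) has_vector_derivative PT \<gamma> t t0 D) (at t within {0..1})"
proof (rule has_vector_derivative_MetricI[of "\<gamma> t0"])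
  fix e
  have "((\<lambda>\<tau>. Metric M (\<gamma> \<tau>) (V \<tau>) (PT \<gamma> t0 \<tau> e)) has_vector_derivative
      Metric M (\<gamma> t) D (PT \<gamma> t0 t e)) (at t within {0..1})"
    using has_cov_Metric[OF \<gamma> t(1) subset_refl V has_cov_parallel_transport[OF \<gamma> t(2,1), of e]]
    by (simp add: bilinear_rzero[OF bilinear_Metric])
  then have "((\<lambda>\<tau>. Metric M (\<gamma> t0) (PT \<gamma> \<tau> t0 (V \<tau>)) e) has_vector_derivative
      Metric M (\<gamma> t) D (PT \<gamma> t0 t e)) (at t within {0..1})"
    by (rule has_vector_derivative_transform[OF t(1), rotated]) (simp add: parallel_transport_adjoint[OF \<gamma> _ t(2)])
  then show "((\<lambda>\<tau>. Metric M (\<gamma> t0) (PT \<gamma> \<tau> t0 (V \<tau>)) e) has_vector_derivative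
      Metric M (\<gamma> t0) (PT \<gamma> t t0 D) e) (at t within {0..1})"
    by (simp add: parallel_transport_adjoint[OF \<gamma> t])
qed

end

section \<open>Families of curves\<close>

context riemannian
begin

text \<open>The constant extensions commute, so the bracket term vanishes, and what remains is the
  usual coordinate formula.\<close>

lemma curvature_eq:
  fixes p x y z
  defines "\<kappa> \<equiv> chart_at M p" and "\<xi> \<equiv> chart_map (chart_at M p) p"
  shows "curvature M p x y z =
     frechet_derivative (\<lambda>\<zeta>. \<Gamma> \<kappa> \<zeta> y z) (at \<xi>) x - frechet_derivative (\<lambda>\<zeta>. \<Gamma> \<kappa> \<zeta> x z) (at \<xi>) y
     + \<Gamma> \<kappa> \<xi> x (\<Gamma> \<kappa> \<xi> y z) - \<Gamma> \<kappa> \<xi> y (\<Gamma> \<kappa> \<xi> x z)"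
  using bilinear_lzero[OF bilinear_christoffel[OF chart_at(1) chart_map_in_image[OF chart_at(2)]], of p]
  by (simp add: curvature_def Let_def curvature_of_fields_def nabla_def[abs_def] lie_bracket_def \<kappa>_def \<xi>_def)

end

section \<open>Smooth two-parameter families in charts\<close>

locale curve_family = riemannian M
  for M :: "('m::{t2_space,second_countable_topology}, 'e::euclidean_space) riem_structure" +
  fixes c :: "real \<Rightarrow> real \<Rightarrow> 'm"
  assumes smooth_family: "smooth_map_on M ({0..1} \<times> {0..1}) (\<lambda>(s, t). c s t)"
begin

definition fdom :: "('m, 'e) chart \<Rightarrow> (real \<times> real) set" where
  "fdom \<kappa> = ({0..1} \<times> {0..1}) \<inter> (\<lambda>(s, t). c s t) -` chart_dom \<kappa>"

definition C :: "('m, 'e) chart \<Rightarrow> real \<times> real \<Rightarrow> 'e" where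
  "C \<kappa> p = chart_map \<kappa> (c (fst p) (snd p))"

lemma mem_fdom: "(s, t) \<in> fdom \<kappa> \<longleftrightarrow> s \<in> {0..1} \<and> t \<in> {0..1} \<and> c s t \<in> chart_dom \<kappa>"
  by (auto simp: fdom_def)

lemma continuous_on_family: "continuous_on ({0..1} \<times> {0..1}) (\<lambda>(s, t). c s t)"
  using smooth_family by (simp add: smooth_map_on_def)

lemma openin_fdom: "\<kappa> \<in> Atlas M \<Longrightarrow> openin (top_of_set ({0..1} \<times> {0..1})) (fdom \<kappa>)"
  unfolding fdom_def by (intro continuous_openin_preimage_gen open_chart_dom continuous_on_family)

lemma udiff_fdom: "\<kappa> \<in> Atlas M \<Longrightarrow> udiff (fdom \<kappa>)"
  by (rule udiff_openin[OF udiff_rect openin_fdom]) auto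

lemma Ck_on_C: "\<kappa> \<in> Atlas M \<Longrightarrow> Ck_on k (fdom \<kappa>) (C \<kappa>)"
  using smooth_family by (simp add: smooth_map_on_def smooth_on_def fdom_def C_def[abs_def] case_prod_beta' )

lemma fdom_rect:
  assumes "\<kappa> \<in> Atlas M" "(s, t) \<in> fdom \<kappa>"
  obtains d where "d > 0"
    "\<And>a \<tau>. a \<in> {0..1} \<Longrightarrow> \<tau> \<in> {0..1} \<Longrightarrow> \<bar>a - s\<bar> \<le> d \<Longrightarrow> \<bar>\<tau> - t\<bar> \<le> d \<Longrightarrow> (a, \<tau>) \<in> fdom \<kappa>"
proof -
  obtain e where e: "e > 0" "\<And>p. p \<in> {0..1} \<times> {0..1} \<Longrightarrow> dist p (s, t) < e \<Longrightarrow> p \<in> fdom \<kappa>"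
    using openin_fdom[OF assms(1)] assms(2) unfolding openin_euclidean_subtopology_iff by blast
  \<comment> \<open>Two deviations of at most \<open>e/3\<close> add up to less than
    \<open>e\<close>.\<close>
  show ?thesis
  proof (rule that[of "e/3"])
    fix a \<tau> assume *: "a \<in> {0..1}" "\<tau> \<in> {0..1}" "\<bar>a - s\<bar> \<le> e/3" "\<bar>\<tau> - t\<bar> \<le> e/3"
    have "dist (a, \<tau>) (s, t) \<le> \<bar>a - s\<bar> + \<bar>\<tau> - t\<bar>"
      unfolding dist_Pair_Pair dist_real_def by (rule sqrt_sum_squares_le_sum) auto
    then show "(a, \<tau>) \<in> fdom \<kappa>" using * e by (intro e(2)) auto
  qed (use e in simp)
qed

lemma smooth_curve_line:
  fixes l :: "real \<Rightarrow> real \<times> real"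
  assumes l: "l ` {0..1} \<subseteq> {0..1} \<times> {0..1}" and lC: "\<And>k S. udiff S \<Longrightarrow> Ck_on k S l"
  shows "smooth_curve (\<lambda>t. c (fst (l t)) (snd (l t)))"
proof -
  have cl: "continuous_on {0..1} l" using lC[OF udiff_Icc, of 0 1 0] by simp
  have cont: "continuous_on {0..1} (\<lambda>t. c (fst (l t)) (snd (l t)))"
    using continuous_on_compose2[OF continuous_on_family cl l] by (simp add: case_prod_beta')
  show ?thesis
    unfolding smooth_map_on_def smooth_on_def
  proof (intro conjI ballI allI cont)
    fix \<kappa> k assume \<kappa>: "\<kappa> \<in> Atlas M"
    let ?S = "{0..1} \<inter> (\<lambda>t. c (fst (l t)) (snd (l t))) -` chart_dom \<kappa>"
    have "openin (top_of_set {0..1}) ?S" by (intro continuous_openin_preimage_gen open_chart_dom cont \<kappa>)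
    then have u: "udiff ?S" by (rule udiff_openin[OF udiff_Icc, rotated]) simp
    have "l ` ?S \<subseteq> fdom \<kappa>" using l by (auto simp: fdom_def case_prod_beta')
    from Ck_on_compose[OF u this Ck_on_C[OF \<kappa>] lC[OF u]]
    show "Ck_on k ?S (\<lambda>t. chart_map \<kappa> (c (fst (l t)) (snd (l t))))" by (simp add: C_def)
  qed
qed

lemma Ck_on_Pair_right: "udiff S \<Longrightarrow> Ck_on k S (\<lambda>t. (s, t :: real))"
  and Ck_on_Pair_left: "udiff S \<Longrightarrow> Ck_on k S (\<lambda>t. (t :: real, s))" for s :: real
proof -
  assume S: "udiff S"
  have l: "bounded_linear (\<lambda>t::real. (0::real, t))" "bounded_linear (\<lambda>t::real. (t, 0::real))"
    by (auto intro: bounded_linear_Pair bounded_linear_zero bounded_linear_ident)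
  have "Ck_on k S (\<lambda>t. (s, 0) + (0, t))" "Ck_on k S (\<lambda>t. (0, s) + (t, 0))"
    by (intro Ck_on_add S Ck_on_const Ck_on_linear l)+
  then show "Ck_on k S (\<lambda>t. (s, t))" "Ck_on k S (\<lambda>t. (t, s))" by (simp_all del: Ck_on.simps)
qed

lemma smooth_t: "s \<in> {0..1} \<Longrightarrow> smooth_curve (c s)"
  using smooth_curve_line[of "\<lambda>t. (s, t)"] Ck_on_Pair_right by (simp add: image_subset_iff)

lemma smooth_s: "t \<in> {0..1} \<Longrightarrow> smooth_curve (\<lambda>a. c a t)"
  using smooth_curve_line[of "\<lambda>a. (a, t)"] Ck_on_Pair_left by (simp add: image_subset_iff)

lemma partial_s:
  assumes \<kappa>: "\<kappa> \<in> Atlas M" and f: "Ck_on (Suc k) (fdom \<kappa>) f" and p: "(s, t) \<in> fdom \<kappa>"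
  shows "((\<lambda>a. f (a, t)) has_vector_derivative frechet_derivative f (at (s, t) within fdom \<kappa>) (1, 0)) (at s within {0..1})"
proof -
  have t: "t \<in> {0..1}" using p by (simp add: mem_fdom)
  have s: "s \<in> curve_dom \<kappa> (\<lambda>a. c a t)" using p by (simp add: mem_fdom curve_dom_def)
  show ?thesis
    using Ck_on_line_derivative[OF f, of "(0, t)" s "(1, 0)" "curve_dom \<kappa> (\<lambda>a. c a t)"] p t
    unfolding at_within_curve_dom[OF smooth_s[OF t] \<kappa> s] by (auto simp: mem_fdom curve_dom_def)
qed

lemma partial_t:
  assumes \<kappa>: "\<kappa> \<in> Atlas M" and f: "Ck_on (Suc k) (fdom \<kappa>) f" and p: "(s, t) \<in> fdom \<kappa>"
  shows "((\<lambda>\<tau>. f (s, \<tau>)) has_vector_derivative frechet_derivative f (at (s, t) within fdom \<kappa>) (0, 1)) (at t within {0..1})"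
proof -
  have s: "s \<in> {0..1}" using p by (simp add: mem_fdom)
  have t: "t \<in> curve_dom \<kappa> (c s)" using p by (simp add: mem_fdom curve_dom_def)
  show ?thesis
    using Ck_on_line_derivative[OF f, of "(s, 0)" t "(0, 1)" "curve_dom \<kappa> (c s)"] p s
    unfolding at_within_curve_dom[OF smooth_t[OF s] \<kappa> t] by (auto simp: mem_fdom curve_dom_def)
qed

definition Cs :: "('m, 'e) chart \<Rightarrow> real \<times> real \<Rightarrow> 'e" where
  "Cs \<kappa> p = frechet_derivative (C \<kappa>) (at p within fdom \<kappa>) (1, 0)"
definition Ct :: "('m, 'e) chart \<Rightarrow> real \<times> real \<Rightarrow> 'e" where
  "Ct \<kappa> p = frechet_derivative (C \<kappa>) (at p within fdom \<kappa>) (0, 1)"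
definition Cst :: "('m, 'e) chart \<Rightarrow> real \<times> real \<Rightarrow> 'e" where
  "Cst \<kappa> p = frechet_derivative (Ct \<kappa>) (at p within fdom \<kappa>) (1, 0)"

lemma Ck_on_Cs: "\<kappa> \<in> Atlas M \<Longrightarrow> Ck_on k (fdom \<kappa>) (Cs \<kappa>)"
  and Ck_on_Ct: "\<kappa> \<in> Atlas M \<Longrightarrow> Ck_on k (fdom \<kappa>) (Ct \<kappa>)"
  unfolding Cs_def[abs_def] Ct_def[abs_def] by (rule Ck_on_frechet_derivative[OF Ck_on_C]; assumption)+

context
  fixes \<kappa> s t assumes \<kappa>: "\<kappa> \<in> Atlas M" and p: "(s, t) \<in> fdom \<kappa>"
begin

lemma C_s: "((\<lambda>a. C \<kappa> (a, t)) has_vector_derivative Cs \<kappa> (s, t)) (at s within {0..1})"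
  unfolding Cs_def by (rule partial_s[OF \<kappa> Ck_on_C[OF \<kappa>] p])

lemma C_t: "((\<lambda>\<tau>. C \<kappa> (s, \<tau>)) has_vector_derivative Ct \<kappa> (s, t)) (at t within {0..1})"
  unfolding Ct_def by (rule partial_t[OF \<kappa> Ck_on_C[OF \<kappa>] p])

lemma Ct_s: "((\<lambda>a. Ct \<kappa> (a, t)) has_vector_derivative Cst \<kappa> (s, t)) (at s within {0..1})"
  unfolding Cst_def by (rule partial_s[OF \<kappa> Ck_on_Ct[OF \<kappa>] p])

text \<open>Equality of mixed partials is what lets \<open>Cst\<close>, defined by differentiating
  in one order, serve for both.\<close>

lemma Cs_t: "((\<lambda>\<tau>. Cs \<kappa> (s, \<tau>)) has_vector_derivative Cst \<kappa> (s, t)) (at t within {0..1})"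
proof -
  obtain d where d: "d > 0"
    "\<And>a \<tau>. a \<in> {0..1} \<Longrightarrow> \<tau> \<in> {0..1} \<Longrightarrow> \<bar>a - s\<bar> \<le> d \<Longrightarrow> \<bar>\<tau> - t\<bar> \<le> d \<Longrightarrow> (a, \<tau>) \<in> fdom \<kappa>"
    using fdom_rect[OF \<kappa> p] by blast
  have st: "0 \<le> s" "s \<le> 1" "0 \<le> t" "t \<le> 1" using p by (auto simp: mem_fdom)
  have "frechet_derivative (Cs \<kappa>) (at (s, t) within fdom \<kappa>) (0, 1) = Cst \<kappa> (s, t)"
    unfolding Cst_def Ct_def[abs_def] Cs_def[abs_def]
  \<comment> \<open>Offsets from \<open>(s, t)\<close> that stay in the unit square and within
    distance \<open>d\<close> in each variable; some bound is 0 when \<open>(s, t)\<close> lies on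
    an edge.\<close>
  proof (rule second_derivative_symmetric[OF Ck_on_C[OF \<kappa>], of "max (-s) (-d)" "min (1-s) d" "max (-t) (-d)" "min (1-t) d"])
    show "(s, t) + a *\<^sub>R (1, 0) + \<tau> *\<^sub>R (0, 1) \<in> fdom \<kappa>"
      if "a \<in> {max (-s) (-d)..min (1-s) d}" "\<tau> \<in> {max (-t) (-d)..min (1-t) d}" for a \<tau>
      using d(2)[of "s + a" "t + \<tau>"] that by (auto simp: abs_le_iff)
  qed (use st d in auto)
  then show ?thesis using partial_t[OF \<kappa> Ck_on_Cs[OF \<kappa>] p] by simp
qed

lemma vel_s: "vel \<kappa> (\<lambda>a. c a t) s = Cs \<kappa> (s, t)"
  using vel_eqI[of s \<kappa> "\<lambda>a. c a t"] C_s p by (simp add: C_def mem_fdom)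

lemma vel_t: "vel \<kappa> (c s) t = Ct \<kappa> (s, t)"
  using vel_eqI[of t \<kappa> "c s"] C_t p by (simp add: C_def mem_fdom)

lemma to_chart_path_ds: "to_chart M \<kappa> (c s t) (path_ds M c s t) = Cs \<kappa> (s, t)"
  using to_chart_velocity[OF smooth_s \<kappa>, of t s] p by (simp add: path_ds_def vel_s mem_fdom)

lemma to_chart_path_dt: "to_chart M \<kappa> (c s t) (path_dt M c s t) = Ct \<kappa> (s, t)"
  using to_chart_velocity[OF smooth_t \<kappa>, of s t] p by (simp add: path_dt_def vel_t mem_fdom)

lemma C_in_image: "C \<kappa> (s, t) \<in> chart_image \<kappa>"
  using p by (simp add: C_def mem_fdom)

end

text \<open>Absence of torsion: in coordinates both derivatives are the mixed partial plus \<Gamma>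
  applied to the two velocities, and \<Gamma> is symmetric.\<close>

lemma cov_deriv_commute:
  assumes s: "s \<in> {0..1}" and t: "t \<in> {0..1}"
  obtains D where "has_cov (\<lambda>a. c a t) (\<lambda>a. path_dt M c a t) D s {0..1}"
    "has_cov (c s) (path_ds M c s) D t {0..1}"
proof -
  let ?k = "chart_at M (c s t)"
  have k: "?k \<in> Atlas M" and p: "(s, t) \<in> fdom ?k" using s t chart_at by (auto simp: mem_fdom)
  define D where "D = Cst ?k (s, t) + \<Gamma> ?k (C ?k (s, t)) (Cs ?k (s, t)) (Ct ?k (s, t))"
  obtain d where d: "d > 0"
    "\<And>a \<tau>. a \<in> {0..1} \<Longrightarrow> \<tau> \<in> {0..1} \<Longrightarrow> \<bar>a - s\<bar> \<le> d \<Longrightarrow> \<bar>\<tau> - t\<bar> \<le> d \<Longrightarrow> (a, \<tau>) \<in> fdom ?k"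
    using fdom_rect[OF k p] by blast
  have "(coords ?k (\<lambda>a. c a t) (\<lambda>a. path_dt M c a t) has_vector_derivative Cst ?k (s, t)) (at s within {0..1})"
    by (rule has_vector_derivative_transform_within[OF Ct_s[OF k p] d(1) s])
      (use d(2) t in \<open>auto simp: to_chart_path_dt[OF k] dist_real_def\<close>)
  moreover have "Cst ?k (s, t) = to_chart M ?k (c s t) D - \<Gamma> ?k (chart_map ?k (c s t)) (vel ?k (\<lambda>a. c a t) s)
      (to_chart M ?k (c s t) (path_dt M c s t))"
    unfolding vel_s[OF k p] to_chart_path_dt[OF k p] by (simp add: D_def C_def)
  ultimately have 1: "has_cov (\<lambda>a. c a t) (\<lambda>a. path_dt M c a t) D s {0..1}"
    using has_covI[OF k, of "\<lambda>a. c a t" s "\<lambda>a. path_dt M c a t"] chart_at(2) by blast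
  have "(coords ?k (c s) (path_ds M c s) has_vector_derivative Cst ?k (s, t)) (at t within {0..1})"
    by (rule has_vector_derivative_transform_within[OF Cs_t[OF k p] d(1) t])
      (use d(2) s in \<open>auto simp: to_chart_path_ds[OF k] dist_real_def\<close>)
  moreover have "Cst ?k (s, t) = to_chart M ?k (c s t) D - \<Gamma> ?k (chart_map ?k (c s t)) (vel ?k (c s) t)
      (to_chart M ?k (c s t) (path_ds M c s t))"
    unfolding vel_t[OF k p] to_chart_path_ds[OF k p]
    using christoffel_commute[OF k C_in_image[OF k p]] by (simp add: D_def C_def)
  ultimately have "has_cov (c s) (path_ds M c s) D t {0..1}"
    using has_covI[OF k, of "c s" t "path_ds M c s"] chart_at(2) by blast
  with 1 show ?thesis by (rule that)
qed

section \<open>Dependence of parallel fields on the parameter\<close>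

text \<open>In the chart \<open>\<kappa>\<close>, fields that are parallel along the curves \<open>c a\<close> solve \<open>y\<^sub>\<tau> = coeff y\<close>, and \<open>coeff_s\<close> is the
  derivative of \<open>coeff\<close> in \<open>a\<close>.\<close>

definition coeff :: "('m, 'e) chart \<Rightarrow> real \<times> real \<Rightarrow> 'e \<Rightarrow> 'e" where
  "coeff \<kappa> p x = - \<Gamma> \<kappa> (C \<kappa> p) (Ct \<kappa> p) x"
definition coeff_s :: "('m, 'e) chart \<Rightarrow> real \<times> real \<Rightarrow> 'e \<Rightarrow> 'e" where
  "coeff_s \<kappa> p x = - (frechet_derivative (\<lambda>\<zeta>. \<Gamma> \<kappa> \<zeta> (Ct \<kappa> p) x) (at (C \<kappa> p)) (Cs \<kappa> p) + \<Gamma> \<kappa> (C \<kappa> p) (Cst \<kappa> p) x)"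

lemma C_image: "C \<kappa> ` fdom \<kappa> \<subseteq> chart_image \<kappa>"
  by (auto simp: fdom_def C_def)

context
  fixes \<kappa> assumes \<kappa>: "\<kappa> \<in> Atlas M"
begin

lemma Ck_on_coeff: "Ck_on k (fdom \<kappa>) (\<lambda>p. coeff \<kappa> p x)"
proof -
  have B: "Ck_on k (fdom \<kappa>) (\<lambda>p. \<Gamma> \<kappa> (C \<kappa> p) u w)" for u w
    by (rule Ck_on_compose[OF udiff_fdom[OF \<kappa>] C_image Ck_on_christoffel[OF \<kappa>] Ck_on_C[OF \<kappa>]])
  have "Ck_on k (fdom \<kappa>) (\<lambda>p. \<Gamma> \<kappa> (C \<kappa> p) (Ct \<kappa> p) x)"
    by (rule Ck_on_bilinear_family[where B = "\<lambda>p. \<Gamma> \<kappa> (C \<kappa> p)", OF udiff_fdom[OF \<kappa>] bilinear_christoffel[OF \<kappa>] B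
        Ck_on_Ct[OF \<kappa>] Ck_on_const[OF udiff_fdom[OF \<kappa>]]]) (use C_image in blast)
  then show ?thesis unfolding coeff_def by (rule Ck_on_uminus[OF udiff_fdom[OF \<kappa>]])
qed

lemma linear_coeff: "p \<in> fdom \<kappa> \<Longrightarrow> linear (coeff \<kappa> p)"
  using bilinear_christoffel[OF \<kappa>, of "C \<kappa> p"] C_image
  unfolding coeff_def[abs_def] bilinear_def by (intro linear_compose_neg) blast

lemma linear_coeff_s: "p \<in> fdom \<kappa> \<Longrightarrow> linear (coeff_s \<kappa> p)"
proof -
  assume "p \<in> fdom \<kappa>"
  then have im: "C \<kappa> p \<in> chart_image \<kappa>" using C_image by blast
  have "linear (\<lambda>x. frechet_derivative (\<lambda>\<zeta>. \<Gamma> \<kappa> \<zeta> (Ct \<kappa> p) x) (at (C \<kappa> p)) (Cs \<kappa> p))"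
    using bilinear_christoffel[OF \<kappa>] unfolding bilinear_def
    by (intro linear_frechet_derivative_family[OF open_chart_image[OF \<kappa>] im _ christoffel_differentiable[OF \<kappa> im]]) blast
  moreover have "linear (\<Gamma> \<kappa> (C \<kappa> p) (Cst \<kappa> p))"
    using bilinear_christoffel[OF \<kappa> im] unfolding bilinear_def by blast
  ultimately show ?thesis
    unfolding coeff_s_def[abs_def] by (intro linear_compose_neg linear_compose_add)
qed

lemma coeff_derivative_s:
  assumes p: "(s, t) \<in> fdom \<kappa>"
  shows "((\<lambda>a. coeff \<kappa> (a, t) x) has_vector_derivative coeff_s \<kappa> (s, t) x) (at s within {0..1})"
proof -
  have s: "s \<in> {0..1}" using p by (simp add: mem_fdom)
  note im = C_in_image[OF \<kappa> p]
  have "((\<lambda>a. \<Gamma> \<kappa> (C \<kappa> (a, t)) (Ct \<kappa> (a, t)) x) has_vector_derivative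
      frechet_derivative (\<lambda>\<zeta>. \<Gamma> \<kappa> \<zeta> (Ct \<kappa> (s, t)) x) (at (C \<kappa> (s, t))) (Cs \<kappa> (s, t))
      + \<Gamma> \<kappa> (C \<kappa> (s, t)) (Cst \<kappa> (s, t)) x + \<Gamma> \<kappa> (C \<kappa> (s, t)) (Ct \<kappa> (s, t)) 0) (at s within {0..1})"
    by (rule has_vector_derivative_bilinear_family[OF open_chart_image[OF \<kappa>] im bilinear_christoffel[OF \<kappa>]
        christoffel_differentiable[OF \<kappa> im] C_s[OF \<kappa> p] s Ct_s[OF \<kappa> p] has_vector_derivative_const])
  from has_vector_derivative_minus[OF this] show ?thesis
    unfolding coeff_def coeff_s_def by (simp add: bilinear_rzero[OF bilinear_christoffel[OF \<kappa> im]])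
qed

text \<open>The formula involves a derivative of \<Gamma> with varying arguments; its continuity is
  easier to obtain by recognising it as a partial derivative of the smooth
  \<open>coeff\<close>.\<close>

lemma continuous_on_coeff_s: "continuous_on (fdom \<kappa>) (\<lambda>p. coeff_s \<kappa> p x)"
proof -
  have eq: "coeff_s \<kappa> p x = frechet_derivative (\<lambda>p. coeff \<kappa> p x) (at p within fdom \<kappa>) (1, 0)" if p: "p \<in> fdom \<kappa>" for p
  proof -
    obtain s t where st: "p = (s, t)" by force
    have "s \<in> {0..1}" using p st by (simp add: mem_fdom)
    from vector_derivative_unique_within[OF at_within_unit_neq_bot[OF this] coeff_derivative_s partial_s[OF \<kappa> Ck_on_coeff]] p st
    show ?thesis by metis
  qed
  show ?thesis
    by (rule continuous_on_eq[OF Ck_on_imp_continuous_on[OF Ck_on_frechet_derivative[OF Ck_on_coeff]]])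
      (simp add: eq)
qed

end

text \<open>The linearised equation in one chart: \<open>z\<close> is the plain derivative of the
  components in \<open>a\<close>, not yet the covariant one.\<close>

definition variation :: "('m, 'e) chart \<Rightarrow> (real \<Rightarrow> real \<Rightarrow> 'e) \<Rightarrow> real \<Rightarrow> real \<Rightarrow> real \<Rightarrow> (real \<Rightarrow> 'e) \<Rightarrow> bool" where
  "variation \<kappa> y s \<alpha> \<beta> z \<longleftrightarrow> (\<forall>\<tau>\<in>{\<alpha>..\<beta>}. (s, \<tau>) \<in> fdom \<kappa> \<and> ((\<lambda>a. y a \<tau>) has_vector_derivative z \<tau>) (at s within {0..1}) \<and>
         (z has_vector_derivative coeff \<kappa> (s, \<tau>) (z \<tau>) + coeff_s \<kappa> (s, \<tau>) (y s \<tau>)) (at \<tau> within {\<alpha>..\<beta>}))"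

text \<open>The fields \<open>Y a\<close> are given separately for each \<open>a\<close>. A
  covariant derivative in \<open>a\<close> at the single time \<alpha> is the initial value from
  which the linear equation carries differentiability over the interval. The bound \<open>d\<close>
  is the same for all intervals containing \<open>\<tau>0\<close>, as bisection requires.\<close>

lemma parameter_derivative_local:
  assumes \<kappa>: "\<kappa> \<in> Atlas M" and p: "(s, \<tau>0) \<in> fdom \<kappa>"
    and Y: "\<And>a. a \<in> {0..1} \<Longrightarrow> parallel (c a) (Y a)"
  defines "y \<equiv> \<lambda>a \<tau>. to_chart M \<kappa> (c a \<tau>) (Y a \<tau>)"
  obtains d where "d > 0"
    "\<And>\<alpha> \<beta> D. 0 \<le> \<alpha> \<Longrightarrow> \<alpha> < \<beta> \<Longrightarrow> \<beta> \<le> 1 \<Longrightarrow> \<alpha> \<le> \<tau>0 \<Longrightarrow> \<tau>0 \<le> \<beta> \<Longrightarrow> \<beta> - \<alpha> < d \<Longrightarrow>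
       has_cov (\<lambda>a. c a \<alpha>) (\<lambda>a. Y a \<alpha>) D s {0..1} \<Longrightarrow>
       \<exists>z. variation \<kappa> y s \<alpha> \<beta> z"
proof -
  obtain d0 where d0: "d0 > 0"
    "\<And>a \<tau>. a \<in> {0..1} \<Longrightarrow> \<tau> \<in> {0..1} \<Longrightarrow> \<bar>a - s\<bar> \<le> d0 \<Longrightarrow> \<bar>\<tau> - \<tau>0\<bar> \<le> d0 \<Longrightarrow> (a, \<tau>) \<in> fdom \<kappa>"
    using fdom_rect[OF \<kappa> p] by blast
  have s: "0 \<le> s" "s \<le> 1" and \<tau>0: "0 \<le> \<tau>0" "\<tau>0 \<le> 1" using p by (auto simp: mem_fdom)
  let ?p = "max 0 (s - d0)" and ?q = "min 1 (s + d0)"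
  let ?W = "{max 0 (\<tau>0 - d0)..min 1 (\<tau>0 + d0)}"
  have NW: "{?p..?q} \<times> ?W \<subseteq> fdom \<kappa>" using d0 by (auto intro!: d0(2) simp: abs_le_iff)
  have N01: "{?p..?q} \<subseteq> {0..1}" and sN: "s \<in> {?p..?q}" using s d0 by auto
  \<comment> \<open>Cutting the parameter interval down to a neighbourhood of \<open>s\<close> does
    not change derivatives at \<open>s\<close>.\<close>
  have at_s: "at s within {?p..?q} = at s within {0..1}"
    by (rule at_within_nhd[of s "ball s d0"]) (use d0 in \<open>auto simp: dist_real_def abs_less_iff\<close>)
  obtain K where K: "K > 0" "\<And>p x. p \<in> {?p..?q} \<times> ?W \<Longrightarrow> norm (coeff \<kappa> p x) \<le> K * norm x"
    using linear_family_bound[of "{?p..?q} \<times> ?W" "coeff \<kappa>"] linear_coeff[OF \<kappa>] NW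
      continuous_on_subset[OF Ck_on_imp_continuous_on[OF Ck_on_coeff[OF \<kappa>, where k = 0]] NW] compact_Times[OF compact_Icc compact_Icc] by blast
  show ?thesis
  proof (rule that[of "min d0 (1/(2*K))"])
    show "0 < min d0 (1/(2*K))" using d0 K by simp
    fix \<alpha> \<beta> D assume ab: "0 \<le> \<alpha>" "\<alpha> < \<beta>" "\<beta> \<le> 1" "\<alpha> \<le> \<tau>0" "\<tau>0 \<le> \<beta>" and sm: "\<beta> - \<alpha> < min d0 (1/(2*K))"
      and good: "has_cov (\<lambda>a. c a \<alpha>) (\<lambda>a. Y a \<alpha>) D s {0..1}"
    have WW: "{\<alpha>..\<beta>} \<subseteq> ?W" using ab sm by auto
    have sub: "{?p..?q} \<times> {\<alpha>..\<beta>} \<subseteq> fdom \<kappa>" using NW WW by blast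
    have mem: "(a, \<tau>) \<in> fdom \<kappa>" if "a \<in> {?p..?q}" "\<tau> \<in> {\<alpha>..\<beta>}" for a \<tau>
      using sub that by blast
    have short: "K * (\<beta> - \<alpha>) \<le> 1/2" using sm K by (simp add: field_simps)
    have ya: "(y a has_vector_derivative coeff \<kappa> (a, \<tau>) (y a \<tau>)) (at \<tau> within {\<alpha>..\<beta>})"
      if "a \<in> {?p..?q}" "\<tau> \<in> {\<alpha>..\<beta>}" for a \<tau>
    proof -
      note m = mem[OF that]
      have a: "a \<in> {0..1}" and \<tau>: "\<tau> \<in> {0..1}" and dom: "c a \<tau> \<in> chart_dom \<kappa>" using m by (auto simp: mem_fdom)
      have "has_cov (c a) (Y a) 0 \<tau> {0..1}" using Y[OF a] \<tau> by (simp add: parallel_def)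
      from has_cov_in_chart[OF smooth_t[OF a] \<tau> subset_refl this \<kappa> dom]
      have "(y a has_vector_derivative coeff \<kappa> (a, \<tau>) (y a \<tau>)) (at \<tau> within {0..1})"
        by (simp add: y_def coeff_def vel_t[OF \<kappa> m] C_def linear_0[OF linear_to_chart[OF \<kappa> dom]])
      then show ?thesis by (rule has_vector_derivative_within_subset) (use ab in auto)
    qed
    have \<alpha>m: "(s, \<alpha>) \<in> fdom \<kappa>" using mem[OF sN] ab by auto
    have "((\<lambda>a. y a \<alpha>) has_vector_derivative to_chart M \<kappa> (c s \<alpha>) D - \<Gamma> \<kappa> (chart_map \<kappa> (c s \<alpha>)) (vel \<kappa> (\<lambda>a. c a \<alpha>) s) (y s \<alpha>)) (at s within {0..1})"
      unfolding y_def using has_cov_in_chart[OF smooth_s _ subset_refl good \<kappa>] \<alpha>m by (simp add: mem_fdom)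
    then obtain z0 where z0: "((\<lambda>a. y a \<alpha>) has_vector_derivative z0) (at s within {?p..?q})"
      using has_vector_derivative_within_subset[OF _ N01] by blast
    obtain z where "z \<alpha> = z0"
      "\<And>\<tau>. \<tau> \<in> {\<alpha>..\<beta>} \<Longrightarrow> (z has_vector_derivative coeff \<kappa> (s, \<tau>) (z \<tau>) + coeff_s \<kappa> (s, \<tau>) (y s \<tau>)) (at \<tau> within {\<alpha>..\<beta>})"
      "\<And>\<tau>. \<tau> \<in> {\<alpha>..\<beta>} \<Longrightarrow> ((\<lambda>a. y a \<tau>) has_vector_derivative z \<tau>) (at s within {?p..?q})"
    proof (rule linear_ode_short_parameter_derivative[where A = "\<lambda>a \<tau>. coeff \<kappa> (a, \<tau>)" and ?A1.0 = "\<lambda>a \<tau>. coeff_s \<kappa> (a, \<tau>)"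
        and y = y and K = K, OF less_imp_le[OF ab(2)] sN])
      show "linear (coeff \<kappa> (a, \<tau>))" "linear (coeff_s \<kappa> (a, \<tau>))"
        "norm (coeff \<kappa> (a, \<tau>) x) \<le> K * norm x"
        "((\<lambda>a. coeff \<kappa> (a, \<tau>) x) has_vector_derivative coeff_s \<kappa> (a, \<tau>) x) (at a within {?p..?q})"
        if "a \<in> {?p..?q}" "\<tau> \<in> {\<alpha>..\<beta>}" for a \<tau> x
        using linear_coeff[OF \<kappa> mem[OF that]] linear_coeff_s[OF \<kappa> mem[OF that]] K(2)[of "(a, \<tau>)" x] that WW
          has_vector_derivative_within_subset[OF coeff_derivative_s[OF \<kappa> mem[OF that]] N01] by blast+
      show "continuous_on {\<alpha>..\<beta>} (\<lambda>\<tau>. coeff \<kappa> (s, \<tau>) x)" for x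
        by (rule continuous_on_compose2[OF Ck_on_imp_continuous_on[OF Ck_on_coeff[OF \<kappa>, where k = 0]]])
          (use mem[OF sN] in \<open>auto intro!: continuous_intros\<close>)
      show "continuous_on ({?p..?q} \<times> {\<alpha>..\<beta>}) (\<lambda>(a, \<tau>). coeff_s \<kappa> (a, \<tau>) x)" for x
        using continuous_on_subset[OF continuous_on_coeff_s[OF \<kappa>] sub] by (simp add: case_prod_beta')
    qed (use K short ya z0 in auto)
    then show "\<exists>z. variation \<kappa> y s \<alpha> \<beta> z"
      using mem[OF sN] unfolding at_s variation_def by blast
  qed
qed

end

context curve_family
begin

context
  fixes s :: real and Y assumes s: "s \<in> {0..1}" and Y: "\<And>a. a \<in> {0..1} \<Longrightarrow> parallel (c a) (Y a)"
begin

lemma has_cov_sI: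
  assumes \<kappa>: "\<kappa> \<in> Atlas M" and p: "(s, \<tau>) \<in> fdom \<kappa>"
    and z: "((\<lambda>a. to_chart M \<kappa> (c a \<tau>) (Y a \<tau>)) has_vector_derivative z) (at s within {0..1})"
  shows "has_cov (\<lambda>a. c a \<tau>) (\<lambda>a. Y a \<tau>)
    (from_chart M \<kappa> (c s \<tau>) (z + \<Gamma> \<kappa> (C \<kappa> (s, \<tau>)) (Cs \<kappa> (s, \<tau>)) (to_chart M \<kappa> (c s \<tau>) (Y s \<tau>)))) s {0..1}"
proof (rule has_covI[OF \<kappa> _ z])
  show "c s \<tau> \<in> chart_dom \<kappa>" using p by (simp add: mem_fdom)
  then show "z = to_chart M \<kappa> (c s \<tau>) (from_chart M \<kappa> (c s \<tau>) (z + \<Gamma> \<kappa> (C \<kappa> (s, \<tau>)) (Cs \<kappa> (s, \<tau>)) (to_chart M \<kappa> (c s \<tau>) (Y s \<tau>))))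
     - \<Gamma> \<kappa> (chart_map \<kappa> (c s \<tau>)) (vel \<kappa> (\<lambda>a. c a \<tau>) s) (to_chart M \<kappa> (c s \<tau>) (Y s \<tau>))"
    unfolding vel_s[OF \<kappa> p] using \<kappa> by (simp add: C_def)
qed

text \<open>Bisection once more: \<open>good\<close> at the left end of a short interval propagates
  to all of it by \<open>parameter_derivative_local\<close>, and the end of one piece is the start
  of the next.\<close>

lemma parameter_derivative_exists:
  assumes 0: "has_cov (\<lambda>a. c a 0) (\<lambda>a. Y a 0) D0 s {0..1}" and \<tau>: "\<tau> \<in> {0..1}"
  shows "\<exists>D. has_cov (\<lambda>a. c a \<tau>) (\<lambda>a. Y a \<tau>) D s {0..1}"
proof -
  define good where "good \<tau> \<longleftrightarrow> (\<exists>D. has_cov (\<lambda>a. c a \<tau>) (\<lambda>a. Y a \<tau>) D s {0..1})" for \<tau>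
  define P where "P \<alpha> \<beta> \<longleftrightarrow> (0 \<le> \<alpha> \<and> \<alpha> < \<beta> \<and> \<beta> \<le> 1 \<and> good \<alpha> \<longrightarrow> (\<forall>\<tau>\<in>{\<alpha>..\<beta>}. good \<tau>))" for \<alpha> \<beta>
  have "P 0 1"
  proof (rule Bolzano)
    fix a b c :: real assume P: "P a b" "P b c" "a \<le> b" "b \<le> c"
    show "P a c" unfolding P_def
    proof (intro impI ballI)
      fix \<tau> assume *: "0 \<le> a \<and> a < c \<and> c \<le> 1 \<and> good a" and \<tau>: "\<tau> \<in> {a..c}"
      have left: "good \<sigma>" if "\<sigma> \<in> {a..b}" for \<sigma>
      proof (cases "a = b")
        case True then show ?thesis using that * by simp
      next
        case False then show ?thesis using that P(1,3,4) * unfolding P_def by simp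
      qed
      show "good \<tau>"
      proof (cases "\<tau> \<le> b")
        case True then show ?thesis using left \<tau> by simp
      next
        case False
        then have "b < c" "\<tau> \<in> {b..c}" using \<tau> by auto
        then show ?thesis using left[of b] P(2,3) * unfolding P_def by simp
      qed
    qed
  next
    fix x :: real assume x: "0 \<le> x" "x \<le> 1"
    let ?k = "chart_at M (c s x)"
    have k: "?k \<in> Atlas M" and p: "(s, x) \<in> fdom ?k" using s x chart_at by (auto simp: mem_fdom)
    obtain d where d: "d > 0" "\<And>\<alpha> \<beta> D. 0 \<le> \<alpha> \<Longrightarrow> \<alpha> < \<beta> \<Longrightarrow> \<beta> \<le> 1 \<Longrightarrow> \<alpha> \<le> x \<Longrightarrow> x \<le> \<beta> \<Longrightarrow> \<beta> - \<alpha> < d \<Longrightarrow>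
       has_cov (\<lambda>a. c a \<alpha>) (\<lambda>a. Y a \<alpha>) D s {0..1} \<Longrightarrow>
       \<exists>z. variation ?k (\<lambda>a \<tau>. to_chart M ?k (c a \<tau>) (Y a \<tau>)) s \<alpha> \<beta> z"
      using parameter_derivative_local[OF k p Y] by blast
    show "\<exists>d>0. \<forall>a b. a \<le> x \<and> x \<le> b \<and> b - a < d \<longrightarrow> P a b"
    proof (intro exI[of _ d] conjI allI impI d(1))
      fix a b assume ab: "a \<le> x \<and> x \<le> b \<and> b - a < d"
      show "P a b" unfolding P_def
      proof (intro impI ballI)
        fix \<tau> assume *: "0 \<le> a \<and> a < b \<and> b \<le> 1 \<and> good a" and \<tau>: "\<tau> \<in> {a..b}"
        from * obtain D where "has_cov (\<lambda>a'. c a' a) (\<lambda>a'. Y a' a) D s {0..1}" unfolding good_def by blast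
        from d(2)[OF _ _ _ _ _ _ this, of b] * ab obtain z where
          "(s, \<tau>) \<in> fdom ?k" "((\<lambda>a. to_chart M ?k (c a \<tau>) (Y a \<tau>)) has_vector_derivative z) (at s within {0..1})"
          using \<tau> unfolding variation_def by blast
        from has_cov_sI[OF k this] show "good \<tau>" unfolding good_def by blast
      qed
    qed
  qed simp
  then show ?thesis using 0 \<tau> unfolding P_def good_def by auto
qed

text \<open>\<open>Z\<close> is chosen pointwise; near each time it agrees with a solution of the
  linearised equation, which supplies its regularity in \<tau>.\<close>

lemma parameter_derivative:
  assumes 0: "has_cov (\<lambda>a. c a 0) (\<lambda>a. Y a 0) D0 s {0..1}"
  obtains Z where
    "\<And>\<tau>. \<tau> \<in> {0..1} \<Longrightarrow> has_cov (\<lambda>a. c a \<tau>) (\<lambda>a. Y a \<tau>) (Z \<tau>) s {0..1}"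
    "\<And>\<tau>. \<tau> \<in> {0..1} \<Longrightarrow> has_cov (c s) Z (curvature M (c s \<tau>) (path_dt M c s \<tau>) (path_ds M c s \<tau>) (Y s \<tau>)) \<tau> {0..1}"
proof -
  obtain Z where Z: "\<And>\<tau>. \<tau> \<in> {0..1} \<Longrightarrow> has_cov (\<lambda>a. c a \<tau>) (\<lambda>a. Y a \<tau>) (Z \<tau>) s {0..1}"
    using parameter_derivative_exists[OF 0] by metis
  have "has_cov (c s) Z (curvature M (c s x) (path_dt M c s x) (path_ds M c s x) (Y s x)) x {0..1}" if x: "x \<in> {0..1}" for x
  proof -
    let ?k = "chart_at M (c s x)"
    have k: "?k \<in> Atlas M" and p: "(s, x) \<in> fdom ?k" and cd: "c s x \<in> chart_dom ?k" using s x chart_at by (auto simp: mem_fdom)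
    let ?y = "\<lambda>\<tau>. to_chart M ?k (c s \<tau>) (Y s \<tau>)"
    obtain d where d: "d > 0" "\<And>\<alpha> \<beta> D. 0 \<le> \<alpha> \<Longrightarrow> \<alpha> < \<beta> \<Longrightarrow> \<beta> \<le> 1 \<Longrightarrow> \<alpha> \<le> x \<Longrightarrow> x \<le> \<beta> \<Longrightarrow> \<beta> - \<alpha> < d \<Longrightarrow>
       has_cov (\<lambda>a. c a \<alpha>) (\<lambda>a. Y a \<alpha>) D s {0..1} \<Longrightarrow>
       \<exists>z. variation ?k (\<lambda>a \<tau>. to_chart M ?k (c a \<tau>) (Y a \<tau>)) s \<alpha> \<beta> z"
      using parameter_derivative_local[OF k p Y] by blast
    \<comment> \<open>The length is at most \<open>2 * d / 3\<close>, below \<open>d\<close>; near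
      \<open>x\<close> this interval coincides with the unit interval, so derivatives at
      \<open>x\<close> agree.\<close>
    let ?a = "max 0 (x - d/3)" and ?b = "min 1 (x + d/3)"
    have ab: "0 \<le> ?a" "?a < ?b" "?b \<le> 1" "?a \<le> x" "x \<le> ?b" "?b - ?a < d" using x d(1) by auto
    then have sub: "{?a..?b} \<subseteq> {0..1}" and xab: "x \<in> {?a..?b}" by auto
    have at_x: "at x within {?a..?b} = at x within {0..1}"
      by (rule at_within_nhd[of x "ball x (d/3)"]) (use d(1) in \<open>auto simp: dist_real_def abs_if split: if_splits\<close>)
    obtain z where z: "\<And>\<tau>. \<tau> \<in> {?a..?b} \<Longrightarrow> (s, \<tau>) \<in> fdom ?k"
      "\<And>\<tau>. \<tau> \<in> {?a..?b} \<Longrightarrow> ((\<lambda>a. to_chart M ?k (c a \<tau>) (Y a \<tau>)) has_vector_derivative z \<tau>) (at s within {0..1})"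
      "\<And>\<tau>. \<tau> \<in> {?a..?b} \<Longrightarrow> (z has_vector_derivative coeff ?k (s, \<tau>) (z \<tau>) + coeff_s ?k (s, \<tau>) (?y \<tau>)) (at \<tau> within {?a..?b})"
    proof -
      have "?a \<in> {0..1}" using ab by simp
      from d(2)[OF ab Z[OF this]] that show thesis unfolding variation_def by blast
    qed
    \<comment> \<open>Uniqueness of the covariant derivative identifies the chosen \<open>Z\<close>
      with the local solution; the \<Gamma> term converts the plain derivative into the covariant
      one.\<close>
    have Zz: "to_chart M ?k (c s \<tau>) (Z \<tau>) = z \<tau> + \<Gamma> ?k (C ?k (s, \<tau>)) (Cs ?k (s, \<tau>)) (?y \<tau>)" if \<tau>: "\<tau> \<in> {?a..?b}" for \<tau>
    proof -
      have t01: "\<tau> \<in> {0..1}" using \<tau> sub by blast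
      have "cov_deriv M (\<lambda>a. c a \<tau>) (\<lambda>a. Y a \<tau>) s = Z \<tau>"
        by (rule has_cov_cov_deriv[OF smooth_s[OF t01] s Z[OF t01]])
      moreover have "cov_deriv M (\<lambda>a. c a \<tau>) (\<lambda>a. Y a \<tau>) s = from_chart M ?k (c s \<tau>) (z \<tau> + \<Gamma> ?k (C ?k (s, \<tau>)) (Cs ?k (s, \<tau>)) (?y \<tau>))"
        by (rule has_cov_cov_deriv[OF smooth_s[OF t01] s has_cov_sI[OF k z(1,2)[OF \<tau>]]])
      ultimately have "Z \<tau> = from_chart M ?k (c s \<tau>) (z \<tau> + \<Gamma> ?k (C ?k (s, \<tau>)) (Cs ?k (s, \<tau>)) (?y \<tau>))" by simp
      then show ?thesis using z(1)[OF \<tau>] k by (simp add: mem_fdom)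
    qed
    note im = C_in_image[OF k p]
    note bl = bilinear_christoffel[OF k im]
    have "has_cov (c s) (Y s) 0 x {0..1}" using Y[OF s] x by (simp add: parallel_def)
    from has_cov_in_chart[OF smooth_t[OF s] x subset_refl this k cd]
    have y': "(?y has_vector_derivative coeff ?k (s, x) (?y x)) (at x within {0..1})"
      unfolding vel_t[OF k p] by (simp add: coeff_def C_def)
    have z': "(z has_vector_derivative coeff ?k (s, x) (z x) + coeff_s ?k (s, x) (?y x)) (at x within {0..1})"
      using z(3)[OF xab] unfolding at_x .
    let ?xi = "C ?k (s, x)" and ?S = "Cs ?k (s, x)" and ?T = "Ct ?k (s, x)"
    let ?R = "curvature M (c s x) (path_dt M c s x) (path_ds M c s x) (Y s x)"
    have yx: "?y x = Y s x" by simp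
    have "((\<lambda>\<tau>. z \<tau> + \<Gamma> ?k (C ?k (s, \<tau>)) (Cs ?k (s, \<tau>)) (?y \<tau>)) has_vector_derivative
        (coeff ?k (s, x) (z x) + coeff_s ?k (s, x) (?y x)) +
        (frechet_derivative (\<lambda>\<zeta>. \<Gamma> ?k \<zeta> ?S (?y x)) (at ?xi) ?T + \<Gamma> ?k ?xi (Cst ?k (s, x)) (?y x)
          + \<Gamma> ?k ?xi ?S (coeff ?k (s, x) (?y x)))) (at x within {0..1})"
      by (intro has_vector_derivative_add z' has_vector_derivative_bilinear_family[OF open_chart_image[OF k] im
         bilinear_christoffel[OF k] christoffel_differentiable[OF k im] C_t[OF k p] x Cs_t[OF k p] y'])
    \<comment> \<open>The \<open>Cst\<close> terms cancel. The derivative of \<Gamma> in direction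
      \<open>?T\<close> comes from the product rule, that in direction \<open>?S\<close> from
      \<open>coeff_s\<close>, and the quadratic terms from substituting for \<open>z x\<close> and
      for the derivative of \<open>?y\<close>: together they are the coordinate formula of the
      curvature.\<close>
    also have "(coeff ?k (s, x) (z x) + coeff_s ?k (s, x) (?y x)) +
        (frechet_derivative (\<lambda>\<zeta>. \<Gamma> ?k \<zeta> ?S (?y x)) (at ?xi) ?T + \<Gamma> ?k ?xi (Cst ?k (s, x)) (?y x)
          + \<Gamma> ?k ?xi ?S (coeff ?k (s, x) (?y x)))
        = ?R - \<Gamma> ?k ?xi ?T (Z x)"
    proof -
      have zx: "z x = Z x - \<Gamma> ?k ?xi ?S (Y s x)" using Zz[OF xab] by simp
      have T: "path_dt M c s x = ?T" "path_ds M c s x = ?S"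
        using to_chart_path_dt[OF k p] to_chart_path_ds[OF k p] by simp_all
      show ?thesis
        unfolding yx zx T curvature_eq coeff_def coeff_s_def C_def[of ?k "(s, x)", symmetric, unfolded fst_conv snd_conv]
        by (simp add: C_def bilinear_rsub[OF bl[unfolded C_def fst_conv snd_conv]] bilinear_rneg[OF bl[unfolded C_def fst_conv snd_conv]])
    qed
    finally have "((\<lambda>\<tau>. to_chart M ?k (c s \<tau>) (Z \<tau>)) has_vector_derivative ?R - \<Gamma> ?k ?xi ?T (Z x)) (at x within {?a..?b})"
      unfolding at_x[symmetric] by (rule has_vector_derivative_transform[OF xab Zz, rotated])
    then have der: "((\<lambda>\<tau>. to_chart M ?k (c s \<tau>) (Z \<tau>)) has_vector_derivative ?R - \<Gamma> ?k ?xi ?T (Z x)) (at x within {0..1})"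
      unfolding at_x .
    show ?thesis
      by (rule has_covI[OF k cd der]) (simp add: vel_t[OF k p] C_def)
  qed
  with Z show ?thesis by (rule that)
qed

end

section \<open>Transport to the origin and its inverse\<close>

text \<open>\<open>frame \<cdot> a \<tau>\<close> is the inverse of \<open>transport_to_origin M c a \<tau>\<close>, and \<open>omega_field M c s t a \<tau>\<close> is \<open>frame (srv_tilde M c s t) a \<tau>\<close>.\<close>

definition frame :: "'e \<Rightarrow> real \<Rightarrow> real \<Rightarrow> 'e" where
  "frame e a \<tau> = PT (c a) 0 \<tau> (PT (\<lambda>a. c a 0) 0 a e)"

abbreviation P0 where "P0 \<equiv> PT (\<lambda>a. c a 0)"

lemma unit0: "(0::real) \<in> {0..1}" by simp

lemma parallel_frame: "a \<in> {0..1} \<Longrightarrow> parallel (c a) (frame e a)"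
  unfolding frame_def[abs_def] by (rule parallel_transport_parallel[OF smooth_t unit0])

lemma frame_0: "a \<in> {0..1} \<Longrightarrow> frame e a 0 = P0 0 a e"
  unfolding frame_def by (rule parallel_transport_self[OF smooth_t unit0])

text \<open>At time 0 the frame is transported along the base curve itself, hence covariantly
  constant: this is the initial condition of the curvature equation.\<close>

lemma has_cov_frame_0: "s \<in> {0..1} \<Longrightarrow> has_cov (\<lambda>a. c a 0) (\<lambda>a. frame e a 0) 0 s {0..1}"
  by (rule has_cov_transform[OF has_cov_parallel_transport[OF smooth_s[OF unit0] unit0] zero_less_one])
    (auto simp: frame_0)

lemma Metric_frame:
  assumes "a \<in> {0..1}" "\<tau> \<in> {0..1}"
  shows "Metric M (c a \<tau>) (frame e a \<tau>) (frame f a \<tau>) = Metric M (c 0 0) e f"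
  unfolding frame_def
  using parallel_transport_isometry[OF smooth_t[OF assms(1)] unit0 assms(2)]
    parallel_transport_isometry[OF smooth_s[OF unit0] unit0 assms(1)] by simp

lemma frame_transport_to_origin:
  assumes "a \<in> {0..1}" "\<tau> \<in> {0..1}"
  shows "frame (transport_to_origin M c a \<tau> w) a \<tau> = w"
  unfolding frame_def transport_to_origin_def
  by (simp only: o_def parallel_transport_compose[OF smooth_s[OF unit0] assms(1) unit0 assms(1)]
      parallel_transport_self[OF smooth_s[OF unit0] assms(1)] 
      parallel_transport_compose[OF smooth_t[OF assms(1)] assms(2) unit0 assms(2)]
      parallel_transport_self[OF smooth_t[OF assms(1)] assms(2)])

text \<open>All transports are isometries, so \<open>transport_to_origin\<close> is adjoint to
  \<open>frame\<close>. Pairings at the origin become pairings at \<open>c a \<tau>\<close>, where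
  the fields can be differentiated.\<close>

lemma Metric_transport_to_origin:
  assumes "a \<in> {0..1}" "\<tau> \<in> {0..1}"
  shows "Metric M (c 0 0) (transport_to_origin M c a \<tau> w) e = Metric M (c a \<tau>) w (frame e a \<tau>)"
  using Metric_frame[OF assms, of "transport_to_origin M c a \<tau> w" e] frame_transport_to_origin[OF assms] by simp

lemma Metric_transport_to_origin_isometry:
  assumes "a \<in> {0..1}" "\<tau> \<in> {0..1}"
  shows "Metric M (c 0 0) (transport_to_origin M c a \<tau> w) (transport_to_origin M c a \<tau> w) = Metric M (c a \<tau>) w w"
  using Metric_transport_to_origin[OF assms, of w "transport_to_origin M c a \<tau> w"] frame_transport_to_origin[OF assms] by simp

lemma omega_field_eq_frame:
  assumes "s \<in> {0..1}" "t \<in> {0..1}" "a \<in> {0..1}"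
  shows "omega_field M c s t a \<tau> = frame (srv_tilde M c s t) a \<tau>"
  unfolding omega_field_def frame_def srv_tilde_def transport_to_origin_def
  by (simp only: o_def parallel_transport_compose[OF smooth_s[OF unit0] assms(1) unit0 assms(3)])

section \<open>The correction term and the derivative of the transported field\<close>

context
  fixes s t :: real assumes s: "s \<in> {0..1}" and t: "t \<in> {0..1}"
begin

lemma Omega_eq:
  assumes Z: "has_cov (\<lambda>a. c a t) (\<lambda>a. frame (srv_tilde M c s t) a t) Z s {0..1}"
  shows "Omega M c s t = transport_to_origin M c s t Z"
proof -
  have "has_cov (\<lambda>a. c a t) (\<lambda>a. omega_field M c s t a t) Z s {0..1}"
    by (rule has_cov_transform[OF Z zero_less_one s]) (simp add: omega_field_eq_frame[OF s t])
  then show ?thesis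
    unfolding Omega_def using has_cov_cov_deriv[OF smooth_s[OF t] s] by simp
qed

lemma Omega_eq_integral:
  "Omega M c s t =
     P0 s 0 (integral {0..t} (\<lambda>\<tau>. PT (c s) \<tau> 0
        (curvature M (c s \<tau>) (path_dt M c s \<tau>) (path_ds M c s \<tau>)
           (PT (c s) t \<tau> (srv M c s t)))))"
proof -
  let ?e = "srv_tilde M c s t"
  obtain Z where Z: "\<And>\<tau>. \<tau> \<in> {0..1} \<Longrightarrow> has_cov (\<lambda>a. c a \<tau>) (\<lambda>a. frame ?e a \<tau>) (Z \<tau>) s {0..1}"
    and DZ: "\<And>\<tau>. \<tau> \<in> {0..1} \<Longrightarrow> has_cov (c s) Z (curvature M (c s \<tau>) (path_dt M c s \<tau>) (path_ds M c s \<tau>) (frame ?e s \<tau>)) \<tau> {0..1}"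
    using parameter_derivative[OF s parallel_frame has_cov_frame_0[OF s, of ?e]] by blast
  have Z0: "Z 0 = 0"
    using has_cov_cov_deriv[OF smooth_s[OF unit0] s Z[OF unit0]] has_cov_cov_deriv[OF smooth_s[OF unit0] s has_cov_frame_0[OF s]] by simp
  let ?f = "\<lambda>\<tau>. PT (c s) \<tau> 0 (curvature M (c s \<tau>) (path_dt M c s \<tau>) (path_ds M c s \<tau>) (frame ?e s \<tau>))"
  have "(?f has_integral PT (c s) t 0 (Z t) - PT (c s) 0 0 (Z 0)) {0..t}"
  proof (rule fundamental_theorem_of_calculus)
    fix \<tau> assume "\<tau> \<in> {0..t}"
    then have "\<tau> \<in> {0..1}" using t by auto
    from has_vector_derivative_parallel_transport[OF smooth_t[OF s] this unit0 DZ[OF this]]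
    show "((\<lambda>\<tau>. PT (c s) \<tau> 0 (Z \<tau>)) has_vector_derivative ?f \<tau>) (at \<tau> within {0..t})"
      by (rule has_vector_derivative_within_subset) (use t in auto)
  qed (use t in simp)
  moreover have "PT (c s) 0 0 (Z 0) = 0"
    using parallel_transport_self[OF smooth_t[OF s] unit0] Z0 by simp
  ultimately have "integral {0..t} ?f = PT (c s) t 0 (Z t)" by (simp add: integral_unique)
  moreover have "integral {0..t} ?f = integral {0..t} (\<lambda>\<tau>. PT (c s) \<tau> 0
        (curvature M (c s \<tau>) (path_dt M c s \<tau>) (path_ds M c s \<tau>) (PT (c s) t \<tau> (srv M c s t))))"
  proof (rule integral_cong)
    fix \<tau> assume "\<tau> \<in> {0..t}"
    then have \<tau>: "\<tau> \<in> {0..1}" using t by auto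
    \<comment> \<open>At \<open>a = s\<close> the transports along the base curve cancel, and the
      two along \<open>c s\<close> combine into one from \<open>t\<close> to \<tau>.\<close>
    have "frame ?e s \<tau> = PT (c s) t \<tau> (srv M c s t)"
      unfolding frame_def srv_tilde_def transport_to_origin_def
      by (simp only: o_def parallel_transport_compose[OF smooth_s[OF unit0] s unit0 s]
         parallel_transport_self[OF smooth_s[OF unit0] s] parallel_transport_compose[OF smooth_t[OF s] t unit0 \<tau>])
    then show "?f \<tau> = PT (c s) \<tau> 0
        (curvature M (c s \<tau>) (path_dt M c s \<tau>) (path_ds M c s \<tau>) (PT (c s) t \<tau> (srv M c s t)))" by simp
  qed
  ultimately show ?thesis unfolding Omega_eq[OF Z[OF t]] transport_to_origin_def by simp
qed

lemma srv_tilde_ds_Omega: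
  assumes Q: "has_cov (\<lambda>a. c a t) (\<lambda>a. srv M c a t) Q s {0..1}"
  shows "srv_tilde_ds M c s t + Omega M c s t = transport_to_origin M c s t Q"
proof -
  let ?e0 = "srv_tilde M c s t"
  have ex: "\<exists>D. has_cov (\<lambda>a. c a t) (\<lambda>a. frame e a t) D s {0..1}" for e
    by (rule parameter_derivative_exists[OF s parallel_frame has_cov_frame_0[OF s] t])
  obtain Z0 where Z0: "has_cov (\<lambda>a. c a t) (\<lambda>a. frame ?e0 a t) Z0 s {0..1}" using ex by blast
  note \<gamma> = smooth_s[OF t]
  have f0: "frame ?e0 s t = srv M c s t" unfolding srv_tilde_def by (rule frame_transport_to_origin[OF s t])
  \<comment> \<open>Testing against every \<open>e\<close> also yields existence of the derivative,
    which \<open>vector_derivative\<close> alone would not assert.\<close>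
  have "((\<lambda>a. srv_tilde M c a t) has_vector_derivative transport_to_origin M c s t Q - transport_to_origin M c s t Z0) (at s within {0..1})"
  proof (rule has_vector_derivative_MetricI[of "c 0 0"])
    fix e
    obtain Ze where Ze: "has_cov (\<lambda>a. c a t) (\<lambda>a. frame e a t) Ze s {0..1}" using ex by blast
    have "((\<lambda>a. Metric M (c a t) (srv M c a t) (frame e a t)) has_vector_derivative
        Metric M (c s t) Q (frame e s t) + Metric M (c s t) (srv M c s t) Ze) (at s within {0..1})"
      by (rule has_cov_Metric[OF \<gamma> s subset_refl Q Ze])
    then have 1: "((\<lambda>a. Metric M (c 0 0) (srv_tilde M c a t) e) has_vector_derivative
        Metric M (c s t) Q (frame e s t) + Metric M (c s t) (srv M c s t) Ze) (at s within {0..1})"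
      by (rule has_vector_derivative_transform[OF s, rotated])
        (simp add: srv_tilde_def Metric_transport_to_origin[OF _ t])
    \<comment> \<open>Comparing the two derivatives of this constant function eliminates the unknown
      \<open>Ze\<close>.\<close>
    have "((\<lambda>a. Metric M (c 0 0) ?e0 e) has_vector_derivative
        Metric M (c s t) Z0 (frame e s t) + Metric M (c s t) (frame ?e0 s t) Ze) (at s within {0..1})"
      by (rule has_vector_derivative_transform[OF s _ has_cov_Metric[OF \<gamma> s subset_refl Z0 Ze]])
        (simp add: Metric_frame[OF _ t])
    from vector_derivative_unique_within[OF at_within_unit_neq_bot[OF s] this has_vector_derivative_const]
    have "Metric M (c s t) (srv M c s t) Ze = - Metric M (c s t) Z0 (frame e s t)" by (simp add: f0)
    with 1 show "((\<lambda>a. Metric M (c 0 0) (srv_tilde M c a t) e) has_vector_derivative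
        Metric M (c 0 0) (transport_to_origin M c s t Q - transport_to_origin M c s t Z0) e) (at s within {0..1})"
      by (simp add: bilinear_lsub[OF bilinear_Metric] Metric_transport_to_origin[OF s t])
  qed
  then have "srv_tilde_ds M c s t = transport_to_origin M c s t Q - transport_to_origin M c s t Z0"
    unfolding srv_tilde_ds_def by (rule vector_derivative_unit[OF s])
  then show ?thesis by (simp add: Omega_eq[OF Z0])
qed

end

end

section \<open>The elastic metric and the distance\<close>

context curve_family
begin

context
  fixes s t :: real
  assumes s: "s \<in> {0..1}" and t: "t \<in> {0..1}" and immersed: "path_dt M c s t \<noteq> 0"
begin

text \<open>\<open>srv\<close> is \<open>path_dt\<close> times the power -1/4 of \<open>?m\<close>,
  written as an inverse double root; the derivative \<open>2 * ?B\<close> of \<open>?m\<close> leads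
  to the coefficient \<open>?B / (2 * r\<^sup>2)\<close>.\<close>

lemma has_cov_srv:
  assumes D: "has_cov (\<lambda>a. c a t) (\<lambda>a. path_dt M c a t) D s {0..1}"
  defines "v \<equiv> path_dt M c s t"
  defines "r \<equiv> tnorm M (c s t) v"
  shows "has_cov (\<lambda>a. c a t) (\<lambda>a. srv M c a t)
    ((1 / sqrt r) *\<^sub>R (D - (Metric M (c s t) D v / (2 * r\<^sup>2)) *\<^sub>R v)) s {0..1}"
proof -
  let ?m = "\<lambda>a. Metric M (c a t) (path_dt M c a t) (path_dt M c a t)"
  let ?B = "Metric M (c s t) D v"
  have m: "(?m has_field_derivative 2 * ?B) (at s within {0..1})"
    using has_cov_Metric[OF smooth_s[OF t] s subset_refl D D] Metric_commute[of "c s t" v D]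
    by (simp add: has_real_derivative_iff_has_vector_derivative v_def)
  have m0: "?m s > 0" using Metric_pos[OF immersed] .
  have r: "r > 0" "r = sqrt (?m s)" using m0 by (auto simp: r_def v_def tnorm_def)
  have "((\<lambda>a. inverse (sqrt (sqrt (?m a)))) has_field_derivative - (?B / (2 * r\<^sup>2)) / sqrt r) (at s within {0..1})"
  proof -
    let ?n = "sqrt r"
    have n: "?n > 0" "r = ?n * ?n" using r(1) by auto
    have "((\<lambda>a. sqrt (?m a)) has_field_derivative inverse r / 2 * (2 * ?B)) (at s within {0..1})"
      using DERIV_chain2[OF DERIV_real_sqrt[OF m0] m] unfolding r(2)[symmetric] .
    from DERIV_chain2[OF DERIV_real_sqrt[of "sqrt (?m s)"] this]
    have "((\<lambda>a. sqrt (sqrt (?m a))) has_field_derivative inverse ?n / 2 * (inverse r / 2 * (2 * ?B))) (at s within {0..1})"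
      using r by simp
    from DERIV_inverse'[OF this] r n
    have "((\<lambda>a. inverse (sqrt (sqrt (?m a)))) has_field_derivative
        - (inverse ?n * (inverse ?n / 2 * (inverse r / 2 * (2 * ?B))) * inverse ?n)) (at s within {0..1})" by simp
    \<comment> \<open>In terms of \<open>n = sqrt r\<close> all roots disappear and the claim is an
      identity of rational functions.\<close>
    moreover have "- (inverse n * (inverse n / 2 * (inverse (n * n) / 2 * (2 * B))) * inverse n) = - (B / (2 * (n * n)\<^sup>2)) / n"
      if "n > 0" for n B :: real
      using that by (simp add: field_simps power2_eq_square)
    from this[OF n(1), of ?B] have "- (inverse ?n * (inverse ?n / 2 * (inverse r / 2 * (2 * ?B))) * inverse ?n) = - (?B / (2 * r\<^sup>2)) / ?n"
      by (simp only: n(2)[symmetric])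
    ultimately show ?thesis by (simp only:)
  qed
  note * = has_cov_scaleR[OF smooth_s[OF t] s subset_refl this D]
  have srv: "(\<lambda>a. inverse (sqrt (sqrt (?m a))) *\<^sub>R path_dt M c a t) = (\<lambda>a. srv M c a t)"
    by (simp add: srv_def tnorm_def)
  have "x *\<^sub>R (D - y *\<^sub>R v) = x *\<^sub>R D + (- y * x) *\<^sub>R v" for x y :: real
    by (simp add: scaleR_diff_right)
  from this[of "1 / sqrt r" "?B / (2 * r\<^sup>2)"]
  have "(1 / sqrt r) *\<^sub>R (D - (?B / (2 * r\<^sup>2)) *\<^sub>R v) = inverse (sqrt r) *\<^sub>R D + (- (?B / (2 * r\<^sup>2)) / sqrt r) *\<^sub>R v"
    by (simp only: divide_inverse mult_1)
  with * show ?thesis unfolding srv r(2)[symmetric] v_def by (simp only:)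
qed

text \<open>Subtracting \<open>B / (2 * r\<^sup>2)\<close> times \<open>v\<close> from
  \<open>D\<close> removes half of its tangential part, so \<open>srv_ds\<close> is
  \<open>1 / sqrt r\<close> times the sum of the normal part and half the tangential part. Squaring
  gives the weight 1/4, and \<open>1 / r\<close> is the square of the arc-length factor times the
  speed.\<close>

lemma elastic_integrand:
  "(Metric M (c s t) (arc_deriv_nor M (c s) (path_ds M c s) t) (arc_deriv_nor M (c s) (path_ds M c s) t)
        + 1/4 * Metric M (c s t) (arc_deriv_tan M (c s) (path_ds M c s) t) (arc_deriv_tan M (c s) (path_ds M c s) t))
     * speed M (c s) t = (tnorm M (c s t) (srv_ds M c s t))\<^sup>2"
proof -
  obtain D where D: "has_cov (\<lambda>a. c a t) (\<lambda>a. path_dt M c a t) D s {0..1}"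
    "has_cov (c s) (path_ds M c s) D t {0..1}"
    using cov_deriv_commute[OF s t] by blast
  define v where "v = path_dt M c s t"
  define r where "r = tnorm M (c s t) v"
  let ?m = "Metric M (c s t)"
  define B where "B = ?m D v"
  have v0: "v \<noteq> 0" using immersed by (simp add: v_def)
  have vv: "?m v v = r\<^sup>2" and r0: "r > 0"
    using Metric_pos[OF v0, of "c s t"] by (auto simp: r_def tnorm_def)
  have vD: "?m v D = B" using Metric_commute by (simp add: B_def)
  note bl = bilinear_Metric[of "c s t"]
  note bls = bilinear_lsub[OF bl] bilinear_rsub[OF bl] bilinear_lmul[OF bl] bilinear_rmul[OF bl]
  have sp: "speed M (c s) t = r" "velocity M (c s) t = v"
    by (simp_all add: speed_def r_def v_def path_dt_def)
  have arc: "arc_deriv M (c s) (path_ds M c s) t = D /\<^sub>R r"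
    by (simp add: arc_deriv_def sp has_cov_cov_deriv[OF smooth_t[OF s] t D(2)])
  \<comment> \<open>Each of the two unit tangents contributes a factor \<open>1 / r\<close>, and so
    does the derivative by arc length.\<close>
  have tan: "arc_deriv_tan M (c s) (path_ds M c s) t = (B / r ^ 3) *\<^sub>R v"
    unfolding arc_deriv_tan_def unit_tangent_def arc sp
    by (simp add: bls B_def[symmetric] power3_eq_cube divide_inverse mult_ac)
  have nor: "arc_deriv_nor M (c s) (path_ds M c s) t = (1 / r) *\<^sub>R D - (B / r ^ 3) *\<^sub>R v"
    unfolding arc_deriv_nor_def arc tan by (simp add: divide_inverse)
  have srv: "srv_ds M c s t = (1 / sqrt r) *\<^sub>R (D - (B / (2 * r\<^sup>2)) *\<^sub>R v)"
    unfolding srv_ds_def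
    using has_cov_cov_deriv[OF smooth_s[OF t] s has_cov_srv[OF D(1)]] by (simp add: r_def v_def B_def)
  have "(tnorm M (c s t) (srv_ds M c s t))\<^sup>2 = ?m (srv_ds M c s t) (srv_ds M c s t)"
    using Metric_nonneg by (simp add: tnorm_def)
  also have "\<dots> = (1 / sqrt r)\<^sup>2 * (?m D D - 2 * (B / (2 * r\<^sup>2)) * B + (B / (2 * r\<^sup>2))\<^sup>2 * r\<^sup>2)"
    unfolding srv by (simp add: bls vv vD B_def[symmetric] power2_eq_square algebra_simps)
  \<comment> \<open>\<open>3 / 4\<close> arises because the cross term removes
    \<open>B\<^sup>2 / r\<^sup>2\<close> and the square restores a quarter of it.\<close>
  also have "\<dots> = (?m D D - 3 / 4 * B\<^sup>2 / r\<^sup>2) / r"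
    using r0 by (simp add: power_divide field_simps) (simp add: power2_eq_square algebra_simps power4_eq_xxxx)
  finally have 1: "(tnorm M (c s t) (srv_ds M c s t))\<^sup>2 = (?m D D - 3 / 4 * B\<^sup>2 / r\<^sup>2) / r" .
  have 2: "?m ((1 / r) *\<^sub>R D - (B / r ^ 3) *\<^sub>R v) ((1 / r) *\<^sub>R D - (B / r ^ 3) *\<^sub>R v)
      = (1 / r)\<^sup>2 * ?m D D - 2 * (1 / r) * (B / r ^ 3) * B + (B / r ^ 3)\<^sup>2 * r\<^sup>2"
    by (simp add: bls vv vD B_def[symmetric] power2_eq_square algebra_simps)
  have 3: "?m ((B / r ^ 3) *\<^sub>R v) ((B / r ^ 3) *\<^sub>R v) = (B / r ^ 3)\<^sup>2 * r\<^sup>2"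
    by (simp add: bls vv power2_eq_square)
  show ?thesis
    unfolding 1 tan nor 2 3 sp using r0 by (simp add: field_simps eval_nat_numeral)
qed

lemma tnorm_srv_tilde_ds:
  "tnorm M (c 0 0) (srv_tilde_ds M c s t + Omega M c s t) = tnorm M (c s t) (srv_ds M c s t)"
proof -
  obtain D where "has_cov (\<lambda>a. c a t) (\<lambda>a. path_dt M c a t) D s {0..1}"
    using cov_deriv_commute[OF s t] by blast
  then obtain Q where Q: "has_cov (\<lambda>a. c a t) (\<lambda>a. srv M c a t) Q s {0..1}"
    using has_cov_srv by blast
  have "srv_ds M c s t = Q" unfolding srv_ds_def by (rule has_cov_cov_deriv[OF smooth_s[OF t] s Q])
  then show ?thesis
    by (simp add: srv_tilde_ds_Omega[OF s t Q] tnorm_def Metric_transport_to_origin_isometry[OF s t])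
qed

end

end

theorem proposition3:
  fixes M :: "('m::{t2_space,second_countable_topology}, 'e::euclidean_space) riem_structure"
    and c\<^sub>0 c\<^sub>1 :: "real \<Rightarrow> 'm"
  assumes "riemannian_manifold M"
    and "c\<^sub>0 \<in> Imm M" and "c\<^sub>1 \<in> Imm M"
  shows "geodesic_distance M (elastic_metric M) c\<^sub>0 c\<^sub>1 =
      (INF c\<in>imm_paths M c\<^sub>0 c\<^sub>1. ereal (integral {0..1} (\<lambda>s.
         sqrt ((tnorm M (c s 0) (path_ds M c s 0))\<^sup>2
               + integral {0..1} (\<lambda>t. (tnorm M (c s t) (srv_ds M c s t))\<^sup>2)))))
    \<and> geodesic_distance M (elastic_metric M) c\<^sub>0 c\<^sub>1 =
      (INF c\<in>imm_paths M c\<^sub>0 c\<^sub>1. ereal (integral {0..1} (\<lambda>s.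
         sqrt ((tnorm M (c s 0) (path_ds M c s 0))\<^sup>2
               + integral {0..1} (\<lambda>t. (tnorm M (c\<^sub>0 0) (srv_tilde_ds M c s t + Omega M c s t))\<^sup>2)))))
    \<and> (\<forall>c\<in>imm_paths M c\<^sub>0 c\<^sub>1. \<forall>s\<in>{0..1}. \<forall>t\<in>{0..1}.
         Omega M c s t =
           parallel_transport M (\<lambda>a. c a 0) s 0
             (integral {0..t} (\<lambda>\<tau>. parallel_transport M (c s) \<tau> 0
                (curvature M (c s \<tau>) (path_dt M c s \<tau>) (path_ds M c s \<tau>)
                   (parallel_transport M (c s) t \<tau> (srv M c s t))))))"
proof -
  interpret riemannian M by standard (rule assms(1))
  have fam: "curve_family M c" if "c \<in> imm_paths M c\<^sub>0 c\<^sub>1" for c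
    using that by unfold_locales (simp add: imm_paths_def)
  have imm: "path_dt M c s t \<noteq> 0" if "c \<in> imm_paths M c\<^sub>0 c\<^sub>1" "s \<in> {0..1}" "t \<in> {0..1}" for c s t
    using that by (auto simp: imm_paths_def Imm_def path_dt_def)
  \<comment> \<open>All paths start in the same curve, so the transported vectors are measured by
    one fixed norm, at the starting point of that curve.\<close>
  have start: "c 0 0 = c\<^sub>0 0" if "c \<in> imm_paths M c\<^sub>0 c\<^sub>1" for c
    using that by (simp add: imm_paths_def)
  have elastic: "elastic_metric M (c s) (path_ds M c s) (path_ds M c s) =
      (tnorm M (c s 0) (path_ds M c s 0))\<^sup>2 + integral {0..1} (\<lambda>t. (tnorm M (c s t) (srv_ds M c s t))\<^sup>2)"
    if "c \<in> imm_paths M c\<^sub>0 c\<^sub>1" "s \<in> {0..1}" for c s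
  proof -
    have "integral {0..1} (\<lambda>t.
       (Metric M (c s t) (arc_deriv_nor M (c s) (path_ds M c s) t) (arc_deriv_nor M (c s) (path_ds M c s) t)
        + 1/4 * Metric M (c s t) (arc_deriv_tan M (c s) (path_ds M c s) t) (arc_deriv_tan M (c s) (path_ds M c s) t))
       * speed M (c s) t) = integral {0..1} (\<lambda>t. (tnorm M (c s t) (srv_ds M c s t))\<^sup>2)"
      by (rule integral_cong) (rule curve_family.elastic_integrand[OF fam[OF that(1)] that(2) _ imm[OF that]])
    then show ?thesis using Metric_nonneg by (simp add: elastic_metric_def tnorm_def)
  qed
  have tilde: "integral {0..1} (\<lambda>t. (tnorm M (c\<^sub>0 0) (srv_tilde_ds M c s t + Omega M c s t))\<^sup>2)
      = integral {0..1} (\<lambda>t. (tnorm M (c s t) (srv_ds M c s t))\<^sup>2)"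
    if "c \<in> imm_paths M c\<^sub>0 c\<^sub>1" "s \<in> {0..1}" for c s
    by (rule integral_cong)
      (simp only: curve_family.tnorm_srv_tilde_ds[OF fam[OF that(1)] that(2) _ imm[OF that]] start[OF that(1), symmetric])
  have 1: "geodesic_distance M (elastic_metric M) c\<^sub>0 c\<^sub>1 =
      (INF c\<in>imm_paths M c\<^sub>0 c\<^sub>1. ereal (integral {0..1} (\<lambda>s.
         sqrt ((tnorm M (c s 0) (path_ds M c s 0))\<^sup>2
               + integral {0..1} (\<lambda>t. (tnorm M (c s t) (srv_ds M c s t))\<^sup>2)))))"
    unfolding geodesic_distance_def
    by (intro INF_cong refl arg_cong[where f = ereal] integral_cong) (simp only: elastic)
  \<comment> \<open>Each path has the same length in both forms, so the infima agree term by
    term.\<close>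
  have 2: "(INF c\<in>imm_paths M c\<^sub>0 c\<^sub>1. ereal (integral {0..1} (\<lambda>s.
         sqrt ((tnorm M (c s 0) (path_ds M c s 0))\<^sup>2
               + integral {0..1} (\<lambda>t. (tnorm M (c s t) (srv_ds M c s t))\<^sup>2))))) =
      (INF c\<in>imm_paths M c\<^sub>0 c\<^sub>1. ereal (integral {0..1} (\<lambda>s.
         sqrt ((tnorm M (c s 0) (path_ds M c s 0))\<^sup>2
               + integral {0..1} (\<lambda>t. (tnorm M (c\<^sub>0 0) (srv_tilde_ds M c s t + Omega M c s t))\<^sup>2)))))"
    by (intro INF_cong refl arg_cong[where f = ereal] integral_cong) (simp only: tilde)
  show ?thesis
    by (intro conjI ballI 1 trans[OF 1 2] curve_family.Omega_eq_integral[OF fam])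
qed

end
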